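(* Let $F$ be an FCP specification satisfying the normal form assumptions below, and $N(F)$ its Petri net translation. Then the transition system $\mathcal{T}(F)=(\mathcal{R}(F)/_\equiv,\rightsquigarrow,[F])$ and the full transition system $\mathcal{T}(N(F))=(\mathcal{R}(N(F)),\rightarrow,M_0)$ of the net are weakly bisimilar, taking the relation $\mathcal{R}$ defined below as the weak bisimulation.
   Context: \textbf{Petri nets.} A Petri net is $N=(P,T,F,M_0)$ with disjoint places $P$ and transitions $T$, flow $F\subseteq(P\times T)\cup(T\times P)$, initial marking $M_0:P\to\mathbb{N}$. Transition $t$ is enabled at $M$ if $M(p)>0$ for all $p$ with $(p,t)\in F$; firing gives $M'(p)=M(p)-F(p,t)+F(t,p)$ (writing $M\rightarrow M'$). A "test" of place $p$ by $t$ means both arcs $(p,t),(t,p)$. $\mathcal{R}(N)$ is the set of reachable markings. Weak bisimilarity of two unlabelled transition systems means a relation containing the pair of initial states such that each step of one side from a related pair is matched by zero or more steps of the other side reaching a related pair. \textbf{FCPs.} Prefixes: $\overline{a}\langle b\rangle$ (send $b$ on $a$), $a(x)$ (receive into $x$), $\tau$. Threads: $S::=K\lfloor\tilde a\rfloor\mid\sum_{i\in I}\pi_i.S_i\mid\nu r.S$, where each process identifier $K$ has a defining equation $K(\tilde f):=S$ with distinct formal parameters. An FCP is $\nu\tilde r.(S_1\mid\dots\mid S_n)$. Structural congruence $\equiv$ is the smallest congruence with $\alpha$-conversion of bound names, $\mid$ associative and commutative with unit $0$ (the empty sum), $\nu r.0\equiv0$, $\nu r_1.\nu r_2.P\equiv\nu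 r_2.\nu r_1.P$, $\nu r.(P_1\mid P_2)\equiv P_1\mid\nu r.P_2$ if $r\notin fn(P_1)$. The reaction relation $\rightarrow$ is generated by $\tau.S+\dots\rightarrow S$; $K\lfloor\tilde a\rfloor\rightarrow S\{\tilde a/\tilde f\}$ if $K(\tilde f):=S$; $x(y).S_1+\dots\mid\overline{x}\langle z\rangle.S_2+\dots\rightarrow S_1\{z/y\}\mid S_2$; closed under $\mid$, $\nu$, $\equiv$. $\mathcal{R}(F)$ is the set of processes reachable from $F$, and $[F_1]\rightsquigarrow[F_2]$ iff $F_1\rightarrow F_2$ ($[\cdot]$ = $\equiv$-class). \textbf{Normal form assumptions.} Names are partitioned into $\mathit{RESTR}$ (bound by $\nu$), $\mathit{INP}$ (bound by input), $\mathit{FRM}$ (formal parameters), $\mathit{PUB}$ (the rest); every name is bound at most once, these sets are disjoint, and substitutions never clash with bound names. Different threads call disjoint sets of identifiers; no defining equation calls its own identifier; for $K(\tilde f):=S$, $fn(S)=\tilde f$. $F=\nu\tilde r.(S_{init,1}\sigma_1\mid\dots\mid S_{init,n}\sigma_n)$ where $K_{init,i}(\tilde f_{init,i}):=S_{init,i}$ are defining equations, $S_{init,i}$ are choices or calls, $\sigma_i:\tilde f_{init,i}\to\tilde r\cup\mathit{PUB}$; $0$ does not occur; in $x(y).S$ we have $y\in fn(S)$ and in $\nu r.S$ we have $r\in fn(S)$. $\mathit{NEW}$ is a set of fresh names with $|\mathit{NEW}|=|\mathit{RESTR}|+|\mathit{INP}|+|\mathit{FRM}|$. \textbf{Substitution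 net $N_{\mathit{subst}}$.} Places (no transitions): $[x=p]$ for $x\in\mathit{INP}\cup\mathit{FRM}$, $p\in\mathit{PUB}$; $[x=n]$ for $x\in\mathit{INP}\cup\mathit{FRM}\cup\mathit{RESTR}$, $n\in\mathit{NEW}$; $[x\neq n]$ for $x\in\mathit{INP}\cup\mathit{FRM}\cup\{r_*\}$, $n\in\mathit{NEW}$. A substitution marking $M$ satisfies: for all $n\in\mathit{NEW}$, $M([r_*\neq n])+\sum_{r\in\mathit{RESTR}}M([r=n])=1$; for all $x$, $\sum_{a}M([x=a])\le1$; for $x\in\mathit{INP}\cup\mathit{FRM}$, $n\in\mathit{NEW}$, $M([x=n])+M([x\neq n])=1$. Given $\sigma:(\mathit{INP}'\cup\mathit{FRM}'\to\mathit{PUB}\cup\tilde r)\cup(\mathit{RESTR}'\to\tilde r)$ (subsets of the respective sets, second part injective, $\tilde r$ names outside $\mathit{PUB}$), $M$ corresponds to $\sigma$ if: $M([x=a])=0$ for all $x\notin dom(\sigma)$ and all $a$; $M([x=\sigma(x)])=1$ if $\sigma(x)\in\mathit{PUB}$; if $\sigma(x)\in\tilde r$ there is $n\in\mathit{NEW}$ with $M([x=n])=1$; and for $x,y$ with $\sigma(x),\sigma(y)\in\tilde r$: $\sigma(x)=\sigma(y)$ iff $M([x=n])=M([y=n])$ for all $n\in\mathit{NEW}$ (missing places count as $0$). \textbf{Control flow nets.} Augmented processes are pairs $(S,\lambda)$, $S$ a thread, $\lambda$ a sequence of names. Transitions carry a label in $\{\tau,\mathit{send}(a,b),\mathit{rec}(a,b)\}$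 and a set of commands $\mathit{map}(x,b),\mathit{unmap}(x,b),\mathit{test}[x=b]$ ($a,b\in\mathit{PUB}\cup\mathit{NEW}$): (ν) $(\nu r.S,\lambda)\to(S,\lambda)$, label $\tau$, commands $\{\mathit{map}(r,n)\}$, for each $n\in\mathit{NEW}$; (τ) $(\tau.S+\dots,\lambda)\to(S,\lambda\lambda')$, label $\tau$, no commands; (snd) $(\overline x\langle y\rangle.S+\dots,\lambda)\to(S,\lambda\lambda')$, label $\mathit{send}(a,b)$, commands $\{\mathit{test}[x=a],\mathit{test}[y=b]\}$, for all $a,b$; (rec) $(x(y).S+\dots,\lambda)\to(S,\lambda\lambda')$, label $\mathit{rec}(a,b)$, commands $\{\mathit{test}[x=a],\mathit{map}(y,b)\}$, for all $a,b$; where $\lambda'$ lists (in a fixed order) $fn$ of the choice minus $fn(S)$; (call1) for $K(f_1,\dots,f_k):=S$ and $m\ge1$: $(K\lfloor x_1..x_m\rfloor,\lambda)\to(K\lfloor x_1..x_{m-1}\rfloor,\lambda'')$, label $\tau$, commands $\{\mathit{test}[x_m=a],\mathit{map}(f_m,a)\}$, for each $a$, with $\lambda''=\lambda$ if $x_m\in\lambda$ else $\lambda\cdot x_m$; (call2) $(K\lfloor-\rfloor,x\lambda)\to(K\lfloor-\rfloor,\lambda)$, label $\tau$, commands $\{\mathit{unmap}(x,a)\}$, for each $a$; (call3) $(K\lfloor-\rfloor,\varepsilon)\to(S,\varepsilon)$, label $\tau$, no commands. $N(S_{init,i})$ has as places the augmented processes reachable from $(S_{init,i},\varepsilon)$,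 these transitions (one input, one output place each), and one token on $(S_{init,i},\varepsilon)$. \textbf{Composition.} Parallel composition of $N(S_{init,1}),\dots,N(S_{init,n})$: disjoint union plus, for each pair of transitions $t_1,t_2$ in different components with labels $\mathit{send}(a,b)$ and $\mathit{rec}(a,b)$, a new transition $(t_1,t_2)$ with the union of their pre- and postsets, label $\tau$, union of commands. Hiding removes all transitions not labelled $\tau$. $N(F)$ is obtained by placing $N_{\mathit{subst}}$ (initially marked with a substitution marking corresponding to $\sigma_1\cup\dots\cup\sigma_n$) next to the result and implementing commands of each transition $t$: $\mathit{test}[x=b]$: test $[x=b]$; $\mathit{map}(x,p)$, $p\in\mathit{PUB}$: arc $t\to[x=p]$; $\mathit{map}(x,n)$, $x\in\mathit{INP}\cup\mathit{FRM}$, $n\in\mathit{NEW}$: arcs $t\to[x=n]$, $[x\neq n]\to t$; $\mathit{map}(r,n)$, $r\in\mathit{RESTR}$: arcs $[r_*\neq n]\to t$, $t\to[r=n]$ and tests of $[x\neq n]$ for all $x\in\mathit{INP}\cup\mathit{FRM}$; $\mathit{unmap}(x,a)$: arc $[x=a]\to t$ and, if $a\in\mathit{NEW}$, arc $t\to[x\neq a]$ (for $x\in\mathit{INP}\cup\mathit{FRM}$) or $t\to[r_*\neq a]$ (for $x\in\mathit{RESTR}$). \textbf{Stability.} A place $(S,\lambda)$ of a control flow net is stable if $S$ is a choice or a call $K\lfloor\tilde x\rfloor$ with its full parameter list; a marking of $N(F)$ is stable if it marks a stable place in every control flow net. \textbf{The relation $\mathcal{R}$.} $([G],M_1\cup M_2)\in\mathcal{R}$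 (with $M_1$ the marking of $N_{\mathit{subst}}$ and $M_2$ the control flow marking, $M_1\cup M_2$ stable and reachable, $G$ reachable from $F$) iff $G\equiv\nu\tilde r.(S_1\sigma_1\mid\dots\mid S_n\sigma_n)$ where each $S_i$ is a choice or call derived from the body $S$ of some defining equation, i.e. $(S,\varepsilon)$ reaches $(S_i,\lambda_i)$ by control flow transitions with no intermediate process a call, each $\sigma_i:fn(S_i)\cup\lambda_i\to\tilde r\cup\mathit{PUB}$, $M_1$ corresponds to $\sigma_1\cup\dots\cup\sigma_n$, and $M_2((S_i,\lambda_i))=1$ for all $i$.
   Formalization: R relates only stable markings, so it is not itself a weak bisimulation on the full system; proved instead: ([F],M_0) is in R, and R closed under completing pending ν-allocations and calls is one, equal to R on stable, derived markings. A thread's identifiers include K_init and indirect calls. *)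

theory Defs
  imports Main
begin

section \<open>Transition systems and weak bisimulation\<close>

record 's tsys =
  states :: "'s set"
  steps :: "('s \<times> 's) set"
  start :: 's

definition weak_bisimulation :: "'s tsys \<Rightarrow> 't tsys \<Rightarrow> ('s \<times> 't) set \<Rightarrow> bool" where
  "weak_bisimulation A B Q \<longleftrightarrow>
     Q \<subseteq> states A \<times> states B \<and>
     (start A, start B) \<in> Q \<and>
     (\<forall>s t. (s, t) \<in> Q \<longrightarrow>
        (\<forall>s'. (s, s') \<in> steps A \<longrightarrow> (\<exists>t'. (t, t') \<in> (steps B)\<^sup>* \<and> (s', t') \<in> Q)) \<and>
        (\<forall>t'. (t, t') \<in> steps B \<longrightarrow> (\<exists>s'. (s, s') \<in> (steps A)\<^sup>* \<and> (s', t') \<in> Q)))"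

section \<open>Petri nets\<close>

text \<open>The flow relation is split into its two halves: \<open>flow_pt\<close> for the arcs from places to
  transitions and \<open>flow_tp\<close> for the arcs from transitions to places.\<close>

record ('p, 't) petri_net =
  places :: "'p set"
  transitions :: "'t set"
  flow_pt :: "('p \<times> 't) set"
  flow_tp :: "('t \<times> 'p) set"
  init_marking :: "'p \<Rightarrow> nat"

definition enabled :: "('p, 't) petri_net \<Rightarrow> ('p \<Rightarrow> nat) \<Rightarrow> 't \<Rightarrow> bool" where
  "enabled N M t \<longleftrightarrow> t \<in> transitions N \<and> (\<forall>p. (p, t) \<in> flow_pt N \<longrightarrow> M p > 0)"

definition fire :: "('p, 't) petri_net \<Rightarrow> ('p \<Rightarrow> nat) \<Rightarrow> 't \<Rightarrow> 'p \<Rightarrow> nat" where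
  "fire N M t = (\<lambda>p. M p - of_bool ((p, t) \<in> flow_pt N) + of_bool ((t, p) \<in> flow_tp N))"

definition net_steps :: "('p, 't) petri_net \<Rightarrow> (('p \<Rightarrow> nat) \<times> ('p \<Rightarrow> nat)) set" where
  "net_steps N = {(M, fire N M t) | M t. enabled N M t}"

definition reachable_markings :: "('p, 't) petri_net \<Rightarrow> ('p \<Rightarrow> nat) set" where
  "reachable_markings N = {M. (init_marking N, M) \<in> (net_steps N)\<^sup>*}"

definition net_tsys :: "('p, 't) petri_net \<Rightarrow> ('p \<Rightarrow> nat) tsys" where
  "net_tsys N =
     \<lparr>states = reachable_markings N,
      steps = net_steps N \<inter> reachable_markings N \<times> reachable_markings N,
      start = init_marking N\<rparr>"

section \<open>Processes\<close>

type_synonym name = nat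
type_synonym ident = nat

datatype prefix = Send name name | Recv name name | Tau

datatype proc =
    Call ident "name list"
  | Sum "(prefix \<times> proc) list"
  | Res name proc
  | Par proc proc

abbreviation Zero :: proc where "Zero \<equiv> Sum []"

fun prefix_free :: "prefix \<Rightarrow> name set" where
  "prefix_free (Send a b) = {a, b}"
| "prefix_free (Recv a x) = {a}"
| "prefix_free Tau = {}"

fun prefix_bound :: "prefix \<Rightarrow> name set" where
  "prefix_bound (Recv a x) = {x}"
| "prefix_bound _ = {}"

fun fn :: "proc \<Rightarrow> name set" where
  "fn (Call K as) = set as"
| "fn (Sum bs) = (\<Union>(\<pi>, P) \<in> set bs. prefix_free \<pi> \<union> (fn P - prefix_bound \<pi>))"
| "fn (Res r P) = fn P - {r}"
| "fn (Par P Q) = fn P \<union> fn Q"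

text \<open>Simultaneous capture-avoiding substitution: a binder is kept unless it would capture a
  substituted name, in which case it is renamed.\<close>

definition refresh :: "name \<Rightarrow> name set \<Rightarrow> name" where
  "refresh x A = (if x \<in> A then (LEAST z. z \<notin> A) else x)"

fun subst :: "(name \<Rightarrow> name) \<Rightarrow> proc \<Rightarrow> proc" where
  "subst \<sigma> (Call K as) = Call K (map \<sigma> as)"
| "subst \<sigma> (Sum bs) = Sum (map (\<lambda>(\<pi>, P).
     (case \<pi> of
        Tau \<Rightarrow> (Tau, subst \<sigma> P)
      | Send a b \<Rightarrow> (Send (\<sigma> a) (\<sigma> b), subst \<sigma> P)
      | Recv a x \<Rightarrow>
          (Recv (\<sigma> a) (refresh x (\<sigma> ` (fn P - {x}))),
           subst (\<sigma>(x := refresh x (\<sigma> ` (fn P - {x})))) P))) bs)"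
| "subst \<sigma> (Res r P) =
     Res (refresh r (\<sigma> ` (fn P - {r}))) (subst (\<sigma>(r := refresh r (\<sigma> ` (fn P - {r})))) P)"
| "subst \<sigma> (Par P Q) = Par (subst \<sigma> P) (subst \<sigma> Q)"

definition subst_map :: "(name \<rightharpoonup> name) \<Rightarrow> proc \<Rightarrow> proc" where
  "subst_map \<sigma> P = subst (\<lambda>x. case \<sigma> x of None \<Rightarrow> x | Some a \<Rightarrow> a) P"

abbreviation rename1 :: "proc \<Rightarrow> name \<Rightarrow> name \<Rightarrow> proc" where
  "rename1 P z y \<equiv> subst (id(y := z)) P"

fun par_list :: "proc list \<Rightarrow> proc" where
  "par_list [] = Zero"
| "par_list [P] = P"
| "par_list (P # Q # Ps) = Par P (par_list (Q # Ps))"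

definition res_list :: "name list \<Rightarrow> proc \<Rightarrow> proc" where
  "res_list rs P = foldr Res rs P"

inductive scong :: "proc \<Rightarrow> proc \<Rightarrow> bool" (infix "\<cong>" 50) where
  refl: "P \<cong> P"
| sym: "P \<cong> Q \<Longrightarrow> Q \<cong> P"
| trans: "P \<cong> Q \<Longrightarrow> Q \<cong> R \<Longrightarrow> P \<cong> R"
| cong_sum: "P \<cong> Q \<Longrightarrow> Sum (bs @ (\<pi>, P) # cs) \<cong> Sum (bs @ (\<pi>, Q) # cs)"
| cong_res: "P \<cong> Q \<Longrightarrow> Res r P \<cong> Res r Q"
| cong_par: "P \<cong> P' \<Longrightarrow> Q \<cong> Q' \<Longrightarrow> Par P Q \<cong> Par P' Q'"
| alpha_res: "z \<notin> fn P \<Longrightarrow> Res r P \<cong> Res z (rename1 P z r)"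
| alpha_recv: "z \<notin> fn P \<Longrightarrow>
    Sum (bs @ (Recv a x, P) # cs) \<cong> Sum (bs @ (Recv a z, rename1 P z x) # cs)"
| par_assoc: "Par (Par P Q) R \<cong> Par P (Par Q R)"
| par_comm: "Par P Q \<cong> Par Q P"
| par_unit: "Par P Zero \<cong> P"
| res_zero: "Res r Zero \<cong> Zero"
| res_swap: "Res r (Res s P) \<cong> Res s (Res r P)"
| res_extrude: "r \<notin> fn P \<Longrightarrow> Res r (Par P Q) \<cong> Par P (Res r Q)"

definition scong_class :: "proc \<Rightarrow> proc set" where
  "scong_class P = {Q. P \<cong> Q}"

section \<open>FCP specifications\<close>

text \<open>A specification consists of the defining equations \<open>K(fs) := S\<close> as triples \<open>(K, fs, S)\<close>,
  the top-level restricted names, and for each thread the pair of its initial identifier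
  \<open>K\<^sub>i\<^sub>n\<^sub>i\<^sub>t\<close> and its substitution \<open>\<sigma>\<close>.\<close>

type_synonym equation = "ident \<times> name list \<times> proc"

record fcp =
  eqs :: "equation list"
  restr :: "name list"
  inits :: "(ident \<times> (name \<rightharpoonup> name)) list"

abbreviation n_threads :: "fcp \<Rightarrow> nat" where
  "n_threads F \<equiv> length (inits F)"

abbreviation init_ident :: "fcp \<Rightarrow> nat \<Rightarrow> ident" where
  "init_ident F i \<equiv> fst (inits F ! i)"

abbreviation init_subst :: "fcp \<Rightarrow> nat \<Rightarrow> (name \<rightharpoonup> name)" where
  "init_subst F i \<equiv> snd (inits F ! i)"

definition init_body :: "fcp \<Rightarrow> nat \<Rightarrow> proc" where
  "init_body F i = snd (the (map_of (eqs F) (init_ident F i)))"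

definition fcp_proc :: "fcp \<Rightarrow> proc" where
  "fcp_proc F = res_list (restr F)
     (par_list (map (\<lambda>i. subst_map (init_subst F i) (init_body F i)) [0..<n_threads F]))"

inductive react :: "equation list \<Rightarrow> proc \<Rightarrow> proc \<Rightarrow> bool" for E :: "equation list" where
  tau: "(Tau, S) \<in> set bs \<Longrightarrow> react E (Sum bs) S"
| call: "(K, fs, S) \<in> set E \<Longrightarrow> length as = length fs \<Longrightarrow>
    react E (Call K as) (subst_map (map_of (zip fs as)) S)"
| comm: "(Recv x y, S\<^sub>1) \<in> set bs \<Longrightarrow> (Send x z, S\<^sub>2) \<in> set cs \<Longrightarrow>
    react E (Par (Sum bs) (Sum cs)) (Par (rename1 S\<^sub>1 z y) S\<^sub>2)"
| par: "react E P P' \<Longrightarrow> react E (Par P Q) (Par P' Q)"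
| res: "react E P P' \<Longrightarrow> react E (Res r P) (Res r P')"
| struct: "P \<cong> P' \<Longrightarrow> react E P' Q' \<Longrightarrow> Q' \<cong> Q \<Longrightarrow> react E P Q"

definition reachable_procs :: "fcp \<Rightarrow> proc set" where
  "reachable_procs F = {G. (react (eqs F))\<^sup>*\<^sup>* (fcp_proc F) G}"

definition fcp_tsys :: "fcp \<Rightarrow> proc set tsys" where
  "fcp_tsys F =
     \<lparr>states = scong_class ` reachable_procs F,
      steps = {(scong_class G, scong_class G') | G G'.
        G \<in> reachable_procs F \<and> G' \<in> reachable_procs F \<and> react (eqs F) G G'},
      start = scong_class (fcp_proc F)\<rparr>"

section \<open>Normal form\<close>

fun thread :: "proc \<Rightarrow> bool" where
  "thread (Call K as) = True"
| "thread (Sum bs) = (\<forall>(\<pi>, P) \<in> set bs. thread P)"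
| "thread (Res r P) = thread P"
| "thread (Par P Q) = False"

fun zero_free :: "proc \<Rightarrow> bool" where
  "zero_free (Call K as) = True"
| "zero_free (Sum bs) = (bs \<noteq> [] \<and> (\<forall>(\<pi>, P) \<in> set bs. zero_free P))"
| "zero_free (Res r P) = zero_free P"
| "zero_free (Par P Q) = (zero_free P \<and> zero_free Q)"

fun binders_used :: "proc \<Rightarrow> bool" where
  "binders_used (Call K as) = True"
| "binders_used (Sum bs) = (\<forall>(\<pi>, P) \<in> set bs. prefix_bound \<pi> \<subseteq> fn P \<and> binders_used P)"
| "binders_used (Res r P) = (r \<in> fn P \<and> binders_used P)"
| "binders_used (Par P Q) = (binders_used P \<and> binders_used Q)"

fun is_call :: "proc \<Rightarrow> bool" where
  "is_call (Call K as) = True"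
| "is_call _ = False"

fun is_choice :: "proc \<Rightarrow> bool" where
  "is_choice (Sum bs) = (bs \<noteq> [])"
| "is_choice _ = False"

text \<open>Binding occurrences, listed with multiplicity.\<close>

fun res_binders :: "proc \<Rightarrow> name list" where
  "res_binders (Call K as) = []"
| "res_binders (Sum bs) = concat (map (\<lambda>(\<pi>, P). res_binders P) bs)"
| "res_binders (Res r P) = r # res_binders P"
| "res_binders (Par P Q) = res_binders P @ res_binders Q"

fun inp_binders :: "proc \<Rightarrow> name list" where
  "inp_binders (Call K as) = []"
| "inp_binders (Sum bs) = concat (map (\<lambda>(\<pi>, P).
     (case \<pi> of Recv a x \<Rightarrow> [x] | _ \<Rightarrow> []) @ inp_binders P) bs)"
| "inp_binders (Res r P) = inp_binders P"
| "inp_binders (Par P Q) = inp_binders P @ inp_binders Q"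

text \<open>The called identifiers, each with the number of arguments it is called with.\<close>

fun calls :: "proc \<Rightarrow> (ident \<times> nat) set" where
  "calls (Call K as) = {(K, length as)}"
| "calls (Sum bs) = (\<Union>(\<pi>, P) \<in> set bs. calls P)"
| "calls (Res r P) = calls P"
| "calls (Par P Q) = calls P \<union> calls Q"

definition restr_binders :: "fcp \<Rightarrow> name list" where
  "restr_binders F = restr F @ concat (map (\<lambda>(K, fs, S). res_binders S) (eqs F))"

definition input_binders :: "fcp \<Rightarrow> name list" where
  "input_binders F = concat (map (\<lambda>(K, fs, S). inp_binders S) (eqs F))"

definition formal_binders :: "fcp \<Rightarrow> name list" where
  "formal_binders F = concat (map (\<lambda>(K, fs, S). fs) (eqs F))"

abbreviation RESTR :: "fcp \<Rightarrow> name set" where "RESTR F \<equiv> set (restr_binders F)"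
abbreviation INP :: "fcp \<Rightarrow> name set" where "INP F \<equiv> set (input_binders F)"
abbreviation FRM :: "fcp \<Rightarrow> name set" where "FRM F \<equiv> set (formal_binders F)"

text \<open>The free names of the equation bodies and the names in the ranges of the initial
  substitutions are all the names of the specification that may occur without being bound.\<close>

definition PUB :: "fcp \<Rightarrow> name set" where
  "PUB F = ((\<Union>(K, fs, S) \<in> set (eqs F). fn S) \<union> (\<Union>(K, \<sigma>) \<in> set (inits F). ran \<sigma>))
     - (RESTR F \<union> INP F \<union> FRM F)"

definition call_graph :: "fcp \<Rightarrow> (ident \<times> ident) set" where
  "call_graph F = {(K, K'). \<exists>fs S m. (K, fs, S) \<in> set (eqs F) \<and> (K', m) \<in> calls S}"

definition thread_idents :: "fcp \<Rightarrow> nat \<Rightarrow> ident set" where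
  "thread_idents F i = {K. (init_ident F i, K) \<in> (call_graph F)\<^sup>*}"

definition normal_form :: "fcp \<Rightarrow> bool" where
  "normal_form F \<longleftrightarrow>
     distinct (map fst (eqs F)) \<and>
     distinct (restr_binders F @ input_binders F @ formal_binders F) \<and>
     (\<forall>(K, fs, S) \<in> set (eqs F).
        thread S \<and> fn S = set fs \<and> zero_free S \<and> binders_used S \<and>
        K \<notin> fst ` calls S \<and>
        (\<forall>(K', m) \<in> calls S. \<exists>fs' S'. (K', fs', S') \<in> set (eqs F) \<and> length fs' = m)) \<and>
     (\<forall>(K, \<sigma>) \<in> set (inits F). \<exists>fs S. (K, fs, S) \<in> set (eqs F) \<and>
        (is_choice S \<or> is_call S) \<and> dom \<sigma> = set fs \<and> ran \<sigma> \<subseteq> set (restr F) \<union> PUB F) \<and>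
     (\<forall>i < n_threads F. \<forall>j < n_threads F. i \<noteq> j \<longrightarrow> thread_idents F i \<inter> thread_idents F j = {})"

definition new_names :: "fcp \<Rightarrow> name set \<Rightarrow> bool" where
  "new_names F NEW \<longleftrightarrow>
     finite NEW \<and> NEW \<inter> (PUB F \<union> RESTR F \<union> INP F \<union> FRM F) = {} \<and>
     card NEW = card (RESTR F) + card (INP F) + card (FRM F)"

section \<open>The substitution net\<close>

text \<open>\<open>EqP x a\<close>, \<open>NeqP x n\<close> and \<open>NeqStar n\<close> are the places \<open>[x = a]\<close>, \<open>[x \<noteq> n]\<close> and
  \<open>[r\<^sub>* \<noteq> n]\<close>.\<close>

datatype splace = EqP name name | NeqP name name | NeqStar name

definition subst_places :: "fcp \<Rightarrow> name set \<Rightarrow> splace set" where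
  "subst_places F NEW =
     {EqP x p | x p. x \<in> INP F \<union> FRM F \<and> p \<in> PUB F} \<union>
     {EqP x n | x n. x \<in> INP F \<union> FRM F \<union> RESTR F \<and> n \<in> NEW} \<union>
     {NeqP x n | x n. x \<in> INP F \<union> FRM F \<and> n \<in> NEW} \<union>
     {NeqStar n | n. n \<in> NEW}"

text \<open>Markings are total functions that vanish on missing places.\<close>

definition subst_marking :: "fcp \<Rightarrow> name set \<Rightarrow> (splace \<Rightarrow> nat) \<Rightarrow> bool" where
  "subst_marking F NEW M \<longleftrightarrow>
     (\<forall>p. p \<notin> subst_places F NEW \<longrightarrow> M p = 0) \<and>
     (\<forall>n \<in> NEW. M (NeqStar n) + (\<Sum>r \<in> RESTR F. M (EqP r n)) = 1) \<and>
     (\<forall>x \<in> INP F \<union> FRM F \<union> RESTR F. (\<Sum>a \<in> PUB F \<union> NEW. M (EqP x a)) \<le> 1) \<and>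
     (\<forall>x \<in> INP F \<union> FRM F. \<forall>n \<in> NEW. M (EqP x n) + M (NeqP x n) = 1)"

definition corresponds ::
  "fcp \<Rightarrow> name set \<Rightarrow> name set \<Rightarrow> (name \<rightharpoonup> name) \<Rightarrow> (splace \<Rightarrow> nat) \<Rightarrow> bool" where
  "corresponds F NEW R \<sigma> M \<longleftrightarrow>
     R \<inter> PUB F = {} \<and>
     dom \<sigma> \<subseteq> INP F \<union> FRM F \<union> RESTR F \<and> ran \<sigma> \<subseteq> PUB F \<union> R \<and>
     (\<forall>r \<in> dom \<sigma> \<inter> RESTR F. the (\<sigma> r) \<in> R) \<and> inj_on \<sigma> (dom \<sigma> \<inter> RESTR F) \<and>
     subst_marking F NEW M \<and>
     (\<forall>x a. x \<notin> dom \<sigma> \<longrightarrow> M (EqP x a) = 0) \<and>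
     (\<forall>x p. \<sigma> x = Some p \<and> p \<in> PUB F \<longrightarrow> M (EqP x p) = 1) \<and>
     (\<forall>x r. \<sigma> x = Some r \<and> r \<in> R \<longrightarrow> (\<exists>n \<in> NEW. M (EqP x n) = 1)) \<and>
     (\<forall>x y r s. \<sigma> x = Some r \<and> r \<in> R \<and> \<sigma> y = Some s \<and> s \<in> R \<longrightarrow>
        (r = s \<longleftrightarrow> (\<forall>n \<in> NEW. M (EqP x n) = M (EqP y n))))"

text \<open>\<open>\<sigma>\<close> is the union of \<open>\<sigma>s 0, \<dots>, \<sigma>s (k - 1)\<close>, as sets of pairs.\<close>

definition is_union :: "(name \<rightharpoonup> name) \<Rightarrow> nat \<Rightarrow> (nat \<Rightarrow> name \<rightharpoonup> name) \<Rightarrow> bool" where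
  "is_union \<sigma> k \<sigma>s \<longleftrightarrow> Map.graph \<sigma> = (\<Union>i<k. Map.graph (\<sigma>s i))"

section \<open>Control flow nets\<close>

type_synonym aug = "proc \<times> name list"

datatype label = LTau | LSend name name | LRec name name

datatype command = Test name name | MapTo name name | Unmap name name

type_synonym ctrans = "aug \<times> label \<times> command set \<times> aug"

definition dropped :: "(prefix \<times> proc) list \<Rightarrow> proc \<Rightarrow> name list" where
  "dropped bs S = sorted_list_of_set (fn (Sum bs) - fn S)"

inductive_set cf_trans :: "fcp \<Rightarrow> name set \<Rightarrow> ctrans set"
  for F :: fcp and NEW :: "name set" where
  nu: "n \<in> NEW \<Longrightarrow> ((Res r S, l), LTau, {MapTo r n}, (S, l)) \<in> cf_trans F NEW"
| tau: "(Tau, S) \<in> set bs \<Longrightarrow>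
    ((Sum bs, l), LTau, {}, (S, l @ dropped bs S)) \<in> cf_trans F NEW"
| snd: "(Send x y, S) \<in> set bs \<Longrightarrow> a \<in> PUB F \<union> NEW \<Longrightarrow> b \<in> PUB F \<union> NEW \<Longrightarrow>
    ((Sum bs, l), LSend a b, {Test x a, Test y b}, (S, l @ dropped bs S)) \<in> cf_trans F NEW"
| rec: "(Recv x y, S) \<in> set bs \<Longrightarrow> a \<in> PUB F \<union> NEW \<Longrightarrow> b \<in> PUB F \<union> NEW \<Longrightarrow>
    ((Sum bs, l), LRec a b, {Test x a, MapTo y b}, (S, l @ dropped bs S)) \<in> cf_trans F NEW"
| call1: "(K, fs, S) \<in> set (eqs F) \<Longrightarrow> length xs < length fs \<Longrightarrow> a \<in> PUB F \<union> NEW \<Longrightarrow>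
    ((Call K (xs @ [x]), l), LTau, {Test x a, MapTo (fs ! length xs) a},
     (Call K xs, if x \<in> set l then l else l @ [x])) \<in> cf_trans F NEW"
| call2: "a \<in> PUB F \<union> NEW \<Longrightarrow>
    ((Call K [], x # l), LTau, {Unmap x a}, (Call K [], l)) \<in> cf_trans F NEW"
| call3: "(K, fs, S) \<in> set (eqs F) \<Longrightarrow>
    ((Call K [], []), LTau, {}, (S, [])) \<in> cf_trans F NEW"

definition cf_step :: "fcp \<Rightarrow> name set \<Rightarrow> (aug \<times> aug) set" where
  "cf_step F NEW = {(s, s'). \<exists>lab C. (s, lab, C, s') \<in> cf_trans F NEW}"

definition cf_places :: "fcp \<Rightarrow> name set \<Rightarrow> nat \<Rightarrow> aug set" where
  "cf_places F NEW i = {s. ((init_body F i, []), s) \<in> (cf_step F NEW)\<^sup>*}"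

definition cf_net_trans :: "fcp \<Rightarrow> name set \<Rightarrow> nat \<Rightarrow> ctrans set" where
  "cf_net_trans F NEW i = {(s, lab, C, s') \<in> cf_trans F NEW. s \<in> cf_places F NEW i}"

section \<open>Composition\<close>

text \<open>\<open>Ctl i s\<close> is the place \<open>s\<close> of the control flow net of thread \<open>i\<close>.  \<open>Local i t\<close> is its
  transition \<open>t\<close>, and \<open>Sync i t j u\<close> merges a send of thread \<open>i\<close> with a receive of thread \<open>j\<close>.\<close>

datatype nplace = Ctl nat aug | Sub splace

datatype ntrans = Local nat ctrans | Sync nat ctrans nat ctrans

definition par_trans :: "fcp \<Rightarrow> name set \<Rightarrow> ntrans set" where
  "par_trans F NEW =
     {Local i t | i t. i < n_threads F \<and> t \<in> cf_net_trans F NEW i} \<union>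
     {Sync i (s, LSend a b, C, s') j (u, LRec a b, D, u') | i s a b C s' j u D u'.
        i < n_threads F \<and> j < n_threads F \<and> i \<noteq> j \<and>
        (s, LSend a b, C, s') \<in> cf_net_trans F NEW i \<and>
        (u, LRec a b, D, u') \<in> cf_net_trans F NEW j}"

fun ntrans_label :: "ntrans \<Rightarrow> label" where
  "ntrans_label (Local i (s, lab, C, s')) = lab"
| "ntrans_label (Sync i t j u) = LTau"

fun ntrans_commands :: "ntrans \<Rightarrow> command set" where
  "ntrans_commands (Local i (s, lab, C, s')) = C"
| "ntrans_commands (Sync i (s, lab, C, s') j (u, lab', D, u')) = C \<union> D"

fun ctl_pre :: "ntrans \<Rightarrow> (nat \<times> aug) set" where
  "ctl_pre (Local i (s, lab, C, s')) = {(i, s)}"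
| "ctl_pre (Sync i (s, lab, C, s') j (u, lab', D, u')) = {(i, s), (j, u)}"

fun ctl_post :: "ntrans \<Rightarrow> (nat \<times> aug) set" where
  "ctl_post (Local i (s, lab, C, s')) = {(i, s')}"
| "ctl_post (Sync i (s, lab, C, s') j (u, lab', D, u')) = {(i, s'), (j, u')}"

fun cmd_pre :: "fcp \<Rightarrow> name set \<Rightarrow> command \<Rightarrow> splace set" where
  "cmd_pre F NEW (Test x b) = {EqP x b}"
| "cmd_pre F NEW (MapTo x b) =
     (if b \<in> NEW then
        if x \<in> RESTR F then insert (NeqStar b) {NeqP y b | y. y \<in> INP F \<union> FRM F}
        else {NeqP x b}
      else {})"
| "cmd_pre F NEW (Unmap x a) = {EqP x a}"

fun cmd_post :: "fcp \<Rightarrow> name set \<Rightarrow> command \<Rightarrow> splace set" where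
  "cmd_post F NEW (Test x b) = {EqP x b}"
| "cmd_post F NEW (MapTo x b) =
     (if b \<in> NEW \<and> x \<in> RESTR F then insert (EqP x b) {NeqP y b | y. y \<in> INP F \<union> FRM F}
      else {EqP x b})"
| "cmd_post F NEW (Unmap x a) =
     (if a \<in> NEW then {if x \<in> RESTR F then NeqStar a else NeqP x a} else {})"

definition sub_pre :: "fcp \<Rightarrow> name set \<Rightarrow> ntrans \<Rightarrow> splace set" where
  "sub_pre F NEW t = (\<Union>c \<in> ntrans_commands t. cmd_pre F NEW c)"

definition sub_post :: "fcp \<Rightarrow> name set \<Rightarrow> ntrans \<Rightarrow> splace set" where
  "sub_post F NEW t = (\<Union>c \<in> ntrans_commands t. cmd_post F NEW c)"

text \<open>A transition whose commands mention a place that the substitution net does not have (a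
  restricted name \<open>r\<close> tested against or unmapped from a public name) is left out: a missing
  place counts as unmarked, so that the transition could never fire.\<close>

definition net_trans :: "fcp \<Rightarrow> name set \<Rightarrow> ntrans set" where
  "net_trans F NEW = {t \<in> par_trans F NEW. ntrans_label t = LTau \<and>
     sub_pre F NEW t \<union> sub_post F NEW t \<subseteq> subst_places F NEW}"

definition fcp_net ::
  "fcp \<Rightarrow> name set \<Rightarrow> (splace \<Rightarrow> nat) \<Rightarrow> (nplace, ntrans) petri_net" where
  "fcp_net F NEW M\<^sub>s =
     \<lparr>places = {Ctl i s | i s. i < n_threads F \<and> s \<in> cf_places F NEW i}
        \<union> Sub ` subst_places F NEW,
      transitions = net_trans F NEW,
      flow_pt = {(Ctl i s, t) | i s t. t \<in> net_trans F NEW \<and> (i, s) \<in> ctl_pre t}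
        \<union> {(Sub p, t) | p t. t \<in> net_trans F NEW \<and> p \<in> sub_pre F NEW t},
      flow_tp = {(t, Ctl i s) | i s t. t \<in> net_trans F NEW \<and> (i, s) \<in> ctl_post t}
        \<union> {(t, Sub p) | p t. t \<in> net_trans F NEW \<and> p \<in> sub_post F NEW t},
      init_marking = (\<lambda>p. case p of
          Ctl i s \<Rightarrow> of_bool (i < n_threads F \<and> s = (init_body F i, []))
        | Sub q \<Rightarrow> M\<^sub>s q)\<rparr>"

section \<open>Stability and the bisimulation\<close>

fun stable_place :: "fcp \<Rightarrow> aug \<Rightarrow> bool" where
  "stable_place F (Call K xs, l) = (\<exists>fs S. (K, fs, S) \<in> set (eqs F) \<and> length xs = length fs)"
| "stable_place F (S, l) = is_choice S"

definition stable_marking :: "fcp \<Rightarrow> (nplace \<Rightarrow> nat) \<Rightarrow> bool" where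
  "stable_marking F M \<longleftrightarrow> (\<forall>i < n_threads F. \<exists>s. stable_place F s \<and> M (Ctl i s) > 0)"

definition derived :: "fcp \<Rightarrow> name set \<Rightarrow> aug \<Rightarrow> bool" where
  "derived F NEW s \<longleftrightarrow> (\<exists>(K, fs, S) \<in> set (eqs F).
     ((S, []), s) \<in> {(u, v) \<in> cf_step F NEW. \<not> is_call (fst u)}\<^sup>*)"

definition bisim_rel ::
  "fcp \<Rightarrow> name set \<Rightarrow> (splace \<Rightarrow> nat) \<Rightarrow> (proc set \<times> (nplace \<Rightarrow> nat)) set" where
  "bisim_rel F NEW M\<^sub>s = {(scong_class G, M) | G M.
     G \<in> reachable_procs F \<and> M \<in> reachable_markings (fcp_net F NEW M\<^sub>s) \<and> stable_marking F M \<and>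
     (\<exists>rs Ss ls \<sigma>s \<sigma>.
        distinct rs \<and> set rs \<inter> PUB F = {} \<and>
        G \<cong> res_list rs (par_list (map (\<lambda>i. subst_map (\<sigma>s i) (Ss i)) [0..<n_threads F])) \<and>
        (\<forall>i < n_threads F.
           (is_choice (Ss i) \<or> is_call (Ss i)) \<and> derived F NEW (Ss i, ls i) \<and>
           dom (\<sigma>s i) = fn (Ss i) \<union> set (ls i) \<and> ran (\<sigma>s i) \<subseteq> set rs \<union> PUB F) \<and>
        is_union \<sigma> (n_threads F) \<sigma>s \<and>
        corresponds F NEW (set rs) \<sigma> (\<lambda>q. M (Sub q)) \<and>
        (\<forall>i < n_threads F. M (Ctl i (Ss i, ls i)) = 1))}"

text \<open>\<open>bisim_rel\<close> relates stable markings only, but a single step can lead from a stable marking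
  to one where some thread has yet to allocate restricted names or to pass and unmap parameters.
  On the full transition system such a marking is related to what \<open>bisim_rel\<close> assigns to
  the markings obtained by completing this housekeeping.  A place is settled if \<open>bisim_rel\<close> can
  put a thread there.  Every reachable stable place is settled, except \<open>(K\<lfloor>-\<rfloor>, \<lambda>)\<close> for a \<open>K\<close> without
  parameters when the unmapping of the caller's names has begun and no body calls \<open>K\<close> with
  exactly the names \<open>\<lambda>\<close> left to unmap.\<close>

definition settled_place :: "fcp \<Rightarrow> name set \<Rightarrow> aug \<Rightarrow> bool" where
  "settled_place F NEW s \<longleftrightarrow> stable_place F s \<and> derived F NEW s"

definition settled_marking :: "fcp \<Rightarrow> name set \<Rightarrow> (nplace \<Rightarrow> nat) \<Rightarrow> bool" where
  "settled_marking F NEW M \<longleftrightarrow>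
     (\<forall>i < n_threads F. \<exists>s. settled_place F NEW s \<and> M (Ctl i s) > 0)"

definition housekeeping ::
  "fcp \<Rightarrow> name set \<Rightarrow> (splace \<Rightarrow> nat) \<Rightarrow> ((nplace \<Rightarrow> nat) \<times> (nplace \<Rightarrow> nat)) set" where
  "housekeeping F NEW M\<^sub>s = (let N = fcp_net F NEW M\<^sub>s in
     {(M, fire N M t) | M t. enabled N M t \<and>
        (\<forall>i s. (Ctl i s, t) \<in> flow_pt N \<longrightarrow> \<not> settled_place F NEW s)})"

definition full_bisim_rel ::
  "fcp \<Rightarrow> name set \<Rightarrow> (splace \<Rightarrow> nat) \<Rightarrow> (proc set \<times> (nplace \<Rightarrow> nat)) set" where
  "full_bisim_rel F NEW M\<^sub>s = {(c, M). M \<in> reachable_markings (fcp_net F NEW M\<^sub>s) \<and>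
     (\<exists>M'. (M, M') \<in> (housekeeping F NEW M\<^sub>s)\<^sup>* \<and> (c, M') \<in> bisim_rel F NEW M\<^sub>s)}"

end

theory Submission
  imports Defs "HOL-Library.Multiset"
begin

text \<open>
  A reachable marking of the net determines the place of every thread and a substitution \<open>\<theta>\<close>
  assigning public or new names to the names in use.  Reading off the process at every place,
  instantiated by \<open>\<theta>\<close>, and restricting all new names gives a process that is unique up to \<open>\<cong>\<close>.
  Housekeeping steps (allocation of restricted names, passing and unmapping of parameters) do not
  change this process, every other step of the net is a reaction of it, and housekeeping always
  reaches a settled marking since \<open>NEW\<close> is large enough.  So the extended relation links a marking
  exactly with the class of its process.

  For the converse, a reaction of \<open>\<nu>A.(T\<^sub>1 | \<dots> | T\<^sub>n)\<close> with guarded \<open>T\<^sub>i\<close> must come from one or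
  two of the \<open>T\<^sub>i\<close>, although \<open>\<cong>\<close> may be applied at will.  This holds because the multiset of guarded components
  obtained by opening all top-level restrictions is invariant under \<open>\<cong>\<close> up to the continuations of
  the components.
\<close>

subsection \<open>Substitution and structural congruence\<close>

text \<open>Binders are renamed on demand, so substitutions compose only up to
  \<open>\<cong>\<close>, and \<open>\<cong>\<close> itself cannot be inverted syntactically:
  symmetry, transitivity and scope extrusion permit arbitrary detours. Therefore openings are taken
  relative to an arbitrary renaming and compared by simulations in both directions, which makes the
  symmetry rule harmless. On the net side the decisive question is which names carry a value at a
  control place. The set \<open>place_dom\<close> answers it, and the invariant \<open>inv\<close>
  asserts equality: a name to be read has a value, a name to be mapped has none. Hence firing a
  transition is the same as updating \<open>\<theta>\<close>. Pairwise disjoint identifier sets make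
  these updates local to one thread. Calls without parameters are the delicate case. No passing of
  an argument shows that such a call has begun, and unmapping may run through several places at
  which some body could itself perform the call. The reaction is therefore attributed to leaving the
  last settled place.\<close>

declare scong.trans [trans]

text \<open>Descends directly to the continuations of a choice, bypassing the list and pair layers
  of the generated rule.\<close>

lemma proc_induct [case_names Call Sum Res Par]:
  assumes "\<And>K as. Q (Call K as)"
    and "\<And>bs. (\<And>\<pi> P. (\<pi>, P) \<in> set bs \<Longrightarrow> Q P) \<Longrightarrow> Q (Sum bs)"
    and "\<And>r P. Q P \<Longrightarrow> Q (Res r P)"
    and "\<And>P R. Q P \<Longrightarrow> Q R \<Longrightarrow> Q (Par P R)"
  shows "Q P"
proof (induction P)
  case (Sum bs)
  then show ?case by (intro assms(2)) (metis snds.intros snd_conv)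
qed (use assms in auto)

text \<open>Names the case distinction inside the choice equation of \<open>subst\<close>, so that
  choices can be handled branch by branch.\<close>

fun subst_branch :: "(name \<Rightarrow> name) \<Rightarrow> prefix \<times> proc \<Rightarrow> prefix \<times> proc" where
  "subst_branch \<sigma> (Tau, P) = (Tau, subst \<sigma> P)"
| "subst_branch \<sigma> (Send a b, P) = (Send (\<sigma> a) (\<sigma> b), subst \<sigma> P)"
| "subst_branch \<sigma> (Recv a x, P) =
     (Recv (\<sigma> a) (refresh x (\<sigma> ` (fn P - {x}))), subst (\<sigma>(x := refresh x (\<sigma> ` (fn P - {x})))) P)"

lemma subst_Sum [simp]: "subst \<sigma> (Sum bs) = Sum (map (subst_branch \<sigma>) bs)"
  by (auto split: prefix.split)

declare subst.simps(2) [simp del]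

definition branch_fn :: "prefix \<times> proc \<Rightarrow> name set" where
  "branch_fn b = prefix_free (fst b) \<union> (fn (snd b) - prefix_bound (fst b))"

lemma fn_Sum [simp]: "fn (Sum bs) = (\<Union>b\<in>set bs. branch_fn b)"
  by (auto simp: branch_fn_def)

declare fn.simps(2) [simp del]

lemma finite_fn [simp]: "finite (fn P)"
proof (induction P rule: proc_induct)
  case (Sum bs)
  have "finite (prefix_free \<pi>)" for \<pi> by (cases \<pi>) auto
  with Sum show ?case by (auto simp: branch_fn_def)
qed auto

lemma ex_fresh: "finite A \<Longrightarrow> \<exists>z::name. z \<notin> A"
  by (simp add: ex_new_if_finite)

lemma refresh_fresh: "finite A \<Longrightarrow> refresh x A \<notin> A"
  unfolding refresh_def using LeastI_ex[OF ex_fresh] by simp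

lemma refresh_notin [simp]: "refresh x (\<sigma> ` (fn P - A)) \<notin> \<sigma> ` (fn P - A)"
  by (rule refresh_fresh) simp

lemma image_upd_fresh: "z \<notin> \<sigma> ` (A - {r}) \<Longrightarrow> (\<sigma>(r := z)) ` A - {z} = \<sigma> ` (A - {r})"
  by (auto simp: image_iff)

text \<open>A refreshed binder avoids the images of the other free names, so binding it again
  removes nothing else from the image.\<close>

lemma fn_subst [simp]: "fn (subst \<sigma> P) = \<sigma> ` fn P"
proof (induction P arbitrary: \<sigma> rule: proc_induct)
  case (Sum bs)
  have "branch_fn (subst_branch \<sigma> b) = \<sigma> ` branch_fn b" if "b \<in> set bs" for b
  proof -
    obtain \<pi> P where b: "b = (\<pi>, P)" by force
    with that Sum have "fn (subst \<tau> P) = \<tau> ` fn P" for \<tau> by auto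
    then show ?thesis
      by (cases \<pi>)
        (simp_all add: b branch_fn_def image_Un image_upd_fresh[OF refresh_notin] del: fun_upd_apply)
  qed
  then show ?case by (simp add: image_UN)
next
  case (Res r P)
  then show ?case by (simp add: image_upd_fresh[OF refresh_notin] del: fun_upd_apply)
qed (auto simp: image_Un)

lemma subst_cong: "(\<And>x. x \<in> fn P \<Longrightarrow> \<sigma> x = \<tau> x) \<Longrightarrow> subst \<sigma> P = subst \<tau> P"
proof (induction P arbitrary: \<sigma> \<tau> rule: proc_induct)
  case (Sum bs)
  have "subst_branch \<sigma> b = subst_branch \<tau> b" if "b \<in> set bs" for b
  proof -
    obtain \<pi> P where b: "b = (\<pi>, P)" by force
    have IH: "(\<And>x. x \<in> fn P \<Longrightarrow> \<sigma> x = \<tau> x) \<Longrightarrow> subst \<sigma> P = subst \<tau> P" for \<sigma> \<tau>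
      using Sum.IH that b by blast
    have eq: "\<sigma> x = \<tau> x" if "x \<in> branch_fn b" for x using Sum.prems that \<open>b \<in> set bs\<close> by auto
    show ?thesis
    proof (cases \<pi>)
      case (Recv a x)
      \<comment> \<open>The refreshed binder depends on the substitution through this image only, so
        both sides choose the same one.\<close>
      have "\<sigma> ` (fn P - {x}) = \<tau> ` (fn P - {x})"
        by (rule image_cong) (auto intro!: eq simp: b Recv branch_fn_def)
      then show ?thesis using eq by (auto simp: b Recv branch_fn_def intro!: IH)
    qed (use eq in \<open>auto simp: b branch_fn_def intro!: IH\<close>)
  qed
  then show ?case by simp
next
  case (Res r P)
  have "\<sigma> ` (fn P - {r}) = \<tau> ` (fn P - {r})"
    by (rule image_cong) (use Res.prems in auto)
  then show ?case using Res.prems by (auto intro!: Res.IH)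
next
  case (Par P R)
  have "subst \<sigma> P = subst \<tau> P" by (rule Par.IH(1)) (simp add: Par.prems)
  moreover have "subst \<sigma> R = subst \<tau> R" by (rule Par.IH(2)) (simp add: Par.prems)
  ultimately show ?case by simp
qed simp

lemma refresh_id: "refresh x (id ` (A - {x})) = x"
  by (simp add: refresh_def)

lemma subst_id [simp]: "subst id P = P"
proof (induction P rule: proc_induct)
  case (Sum bs)
  have "subst_branch id b = b" if "b \<in> set bs" for b
  proof -
    obtain \<pi> P where b: "b = (\<pi>, P)" by force
    have "id(x := x) = id" for x :: name by auto
    moreover have "subst id P = P" using Sum that b by blast
    ultimately show ?thesis by (cases \<pi>) (simp_all only: b subst_branch.simps refresh_id id_apply)
  qed
  then show ?case by (simp only: subst_Sum map_idI)
next
  case (Res r P)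
  have "id(r := r) = id" by auto
  with Res show ?case by (simp only: subst.simps refresh_id)
qed auto

lemma scong_fn: "P \<cong> Q \<Longrightarrow> fn P = fn Q"
proof (induction rule: scong.induct)
  case (alpha_res z P r)
  then show ?case by (auto simp: image_iff)
next
  case (alpha_recv z P bs a x cs)
  then have "branch_fn (Recv a x, P) = branch_fn (Recv a z, rename1 P z x)"
    by (auto simp: branch_fn_def image_iff)
  then show ?case by simp
qed (auto simp: branch_fn_def)

text \<open>Supplies the congruence judgement for single branches that \<open>scong\<close> lacks;
  quantifying over the neighbouring branches makes it usable at every position.\<close>

definition branch_cong :: "prefix \<times> proc \<Rightarrow> prefix \<times> proc \<Rightarrow> bool" where
  "branch_cong b c \<longleftrightarrow> (\<forall>bs cs. Sum (bs @ b # cs) \<cong> Sum (bs @ c # cs))"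

text \<open>Branches are exchanged from left to right; those already exchanged move into an
  arbitrary prefix over which the induction is generalised.\<close>

lemma scong_Sum: "list_all2 branch_cong bs cs \<Longrightarrow> Sum bs \<cong> Sum cs"
proof -
  have "list_all2 branch_cong bs cs \<Longrightarrow> Sum (ps @ bs) \<cong> Sum (ps @ cs)" for ps
  proof (induction arbitrary: ps rule: list_all2_induct)
    case (Cons b bs c cs)
    then have "Sum (ps @ b # bs) \<cong> Sum (ps @ c # bs)" by (simp add: branch_cong_def)
    moreover have "Sum (ps @ c # bs) \<cong> Sum (ps @ c # cs)"
      using Cons.IH[of "ps @ [c]"] by simp
    ultimately show ?case by (rule scong.trans)
  qed (simp add: scong.refl)
  from this[of "[]"] show "list_all2 branch_cong bs cs \<Longrightarrow> Sum bs \<cong> Sum cs" by simp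
qed

lemma branch_cong_trans [trans]: "branch_cong a b \<Longrightarrow> branch_cong b c \<Longrightarrow> branch_cong a c"
  unfolding branch_cong_def by (blast intro: scong.trans)

lemma branch_cong_cong: "P \<cong> Q \<Longrightarrow> branch_cong (\<pi>, P) (\<pi>, Q)"
  by (simp add: branch_cong_def scong.cong_sum)

text \<open>Composition of substitutions is a premise here and in the two lemmas that follow because
  they are applied inside the induction that proves it, where it is known for the subterm
  \<open>P\<close> only.\<close>

lemma rename_upd:
  assumes comp: "\<And>\<sigma> \<tau>. subst \<tau> (subst \<sigma> P) \<cong> subst (\<tau> \<circ> \<sigma>) P"
    and "z \<notin> \<sigma> ` (fn P - {r})"
  shows "rename1 (subst (\<sigma>(r := z)) P) w z \<cong> subst (\<sigma>(r := w)) P"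
proof -
  have "subst (id(z := w) \<circ> \<sigma>(r := z)) P = subst (\<sigma>(r := w)) P"
    by (rule subst_cong) (use assms(2) in auto)
  with comp[of "id(z := w)" "\<sigma>(r := z)"] show ?thesis by (simp del: fun_upd_apply)
qed

lemma res_alpha_aux:
  assumes comp: "\<And>\<sigma> \<tau>. subst \<tau> (subst \<sigma> P) \<cong> subst (\<tau> \<circ> \<sigma>) P"
    and z: "z \<notin> \<sigma> ` (fn P - {r})" and w: "w \<notin> \<sigma> ` (fn P - {r})"
  shows "Res z (subst (\<sigma>(r := z)) P) \<cong> Res w (subst (\<sigma>(r := w)) P)"
proof (cases "z = w")
  case False
  have "w \<notin> fn (subst (\<sigma>(r := z)) P)" using w False by auto
  then have "Res z (subst (\<sigma>(r := z)) P) \<cong> Res w (rename1 (subst (\<sigma>(r := z)) P) w z)"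
    by (rule scong.alpha_res)
  also have "\<dots> \<cong> Res w (subst (\<sigma>(r := w)) P)"
    by (intro scong.cong_res rename_upd comp z)
  finally show ?thesis .
qed (simp add: scong.refl)

lemma recv_alpha_aux:
  assumes comp: "\<And>\<sigma> \<tau>. subst \<tau> (subst \<sigma> P) \<cong> subst (\<tau> \<circ> \<sigma>) P"
    and z: "z \<notin> \<sigma> ` (fn P - {r})" and w: "w \<notin> \<sigma> ` (fn P - {r})"
  shows "branch_cong (Recv a z, subst (\<sigma>(r := z)) P) (Recv a w, subst (\<sigma>(r := w)) P)"
proof (cases "z = w")
  case False
  have "w \<notin> fn (subst (\<sigma>(r := z)) P)" using w False by auto
  then have "branch_cong (Recv a z, subst (\<sigma>(r := z)) P)
      (Recv a w, rename1 (subst (\<sigma>(r := z)) P) w z)"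
    unfolding branch_cong_def by (blast intro: scong.alpha_recv)
  also have "branch_cong \<dots> (Recv a w, subst (\<sigma>(r := w)) P)"
    by (intro branch_cong_cong rename_upd comp z)
  finally show ?thesis .
qed (simp add: branch_cong_cong scong.refl)

text \<open>Two passes may refresh a binder differently from a single pass, so equality fails; at
  each binder an alpha conversion closes the gap.\<close>

lemma subst_comp: "subst \<tau> (subst \<sigma> P) \<cong> subst (\<tau> \<circ> \<sigma>) P"
proof (induction P arbitrary: \<sigma> \<tau> rule: proc_induct)
  case (Sum bs)
  have "branch_cong (subst_branch \<tau> (subst_branch \<sigma> b)) (subst_branch (\<tau> \<circ> \<sigma>) b)"
    if "b \<in> set bs" for b
  proof -
    obtain \<pi> P where b: "b = (\<pi>, P)" by force
    with that Sum have IH: "subst \<tau> (subst \<sigma> P) \<cong> subst (\<tau> \<circ> \<sigma>) P" for \<sigma> \<tau> by blast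
    show ?thesis
    proof (cases \<pi>)
      case (Recv a x)
      define x' where "x' = refresh x (\<sigma> ` (fn P - {x}))"
      define x'' where "x'' = refresh x' (\<tau> ` (fn (subst (\<sigma>(x := x')) P) - {x'}))"
      have x': "x' \<notin> \<sigma> ` (fn P - {x})" by (simp add: x'_def)
      have "x'' \<notin> \<tau> ` (fn (subst (\<sigma>(x := x')) P) - {x'})"
        by (simp only: x''_def refresh_notin not_False_eq_True)
      also have "fn (subst (\<sigma>(x := x')) P) - {x'} = \<sigma> ` (fn P - {x})"
        using image_upd_fresh[OF x'] by (simp del: fun_upd_apply)
      \<comment> \<open>The binder obtained after both passes is admissible for the composed
        substitution as well, which is what the alpha conversion needs.\<close>
      finally have x'': "x'' \<notin> (\<tau> \<circ> \<sigma>) ` (fn P - {x})" by (simp add: image_comp)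
      have "subst_branch \<tau> (subst_branch \<sigma> b) =
          (Recv (\<tau> (\<sigma> a)) x'', subst (\<tau>(x' := x'')) (subst (\<sigma>(x := x')) P))"
        by (simp add: b Recv x'_def x''_def del: fun_upd_apply)
      also have "branch_cong \<dots> (Recv (\<tau> (\<sigma> a)) x'', subst (\<tau>(x' := x'') \<circ> \<sigma>(x := x')) P)"
        by (intro branch_cong_cong IH)
      also have "subst (\<tau>(x' := x'') \<circ> \<sigma>(x := x')) P = subst ((\<tau> \<circ> \<sigma>)(x := x'')) P"
        by (rule subst_cong) (use x' in auto)
      also have "branch_cong (Recv (\<tau> (\<sigma> a)) x'', subst ((\<tau> \<circ> \<sigma>)(x := x'')) P)
          (subst_branch (\<tau> \<circ> \<sigma>) b)"
        using recv_alpha_aux[OF IH x'' refresh_notin]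
        by (simp add: b Recv del: fun_upd_apply)
      finally show ?thesis .
    qed (use IH in \<open>auto simp: b intro!: branch_cong_cong\<close>)
  qed
  then show ?case
    by (simp only: subst_Sum map_map)
      (rule scong_Sum, simp add: list_all2_conv_all_nth del: comp_apply, simp)
next
  case (Res r P)
  define x' where "x' = refresh r (\<sigma> ` (fn P - {r}))"
  define x'' where "x'' = refresh x' (\<tau> ` (fn (subst (\<sigma>(r := x')) P) - {x'}))"
  have x': "x' \<notin> \<sigma> ` (fn P - {r})" by (simp add: x'_def)
  have "x'' \<notin> \<tau> ` (fn (subst (\<sigma>(r := x')) P) - {x'})"
    by (simp only: x''_def refresh_notin not_False_eq_True)
  also have "fn (subst (\<sigma>(r := x')) P) - {x'} = \<sigma> ` (fn P - {r})"
    using image_upd_fresh[OF x'] by (simp del: fun_upd_apply)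
  finally have x'': "x'' \<notin> (\<tau> \<circ> \<sigma>) ` (fn P - {r})" by (simp add: image_comp)
  have "subst \<tau> (subst \<sigma> (Res r P)) = Res x'' (subst (\<tau>(x' := x'')) (subst (\<sigma>(r := x')) P))"
    by (simp add: x'_def x''_def del: fun_upd_apply)
  also have "\<dots> \<cong> Res x'' (subst (\<tau>(x' := x'') \<circ> \<sigma>(r := x')) P)"
    by (intro scong.cong_res Res.IH)
  also have "subst (\<tau>(x' := x'') \<circ> \<sigma>(r := x')) P = subst ((\<tau> \<circ> \<sigma>)(r := x'')) P"
    by (rule subst_cong) (use x' in auto)
  also have "Res x'' (subst ((\<tau> \<circ> \<sigma>)(r := x'')) P) \<cong> subst (\<tau> \<circ> \<sigma>) (Res r P)"
    using res_alpha_aux[OF Res.IH x'' refresh_notin] by (simp del: fun_upd_apply)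
  finally show ?case .
next
  case (Call K as)
  then show ?case by (simp add: scong.refl comp_def)
next
  case (Par P R)
  then show ?case by (simp add: scong.cong_par)
qed

lemma rename_subst:
  "z \<notin> \<sigma> ` (fn P - {r}) \<Longrightarrow> rename1 (subst (\<sigma>(r := z)) P) w z \<cong> subst (\<sigma>(r := w)) P"
  by (intro rename_upd subst_comp)

text \<open>Makes later arguments independent of the particular binder that \<open>refresh\<close>
  selects.\<close>

lemma subst_Res:
  "z \<notin> \<sigma> ` (fn P - {r}) \<Longrightarrow> subst \<sigma> (Res r P) \<cong> Res z (subst (\<sigma>(r := z)) P)"
  by (simp only: subst.simps) (intro res_alpha_aux subst_comp refresh_notin)

lemma subst_Recv:
  "z \<notin> \<sigma> ` (fn P - {x}) \<Longrightarrow>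
   branch_cong (subst_branch \<sigma> (Recv a x, P)) (Recv (\<sigma> a) z, subst (\<sigma>(x := z)) P)"
  by (simp only: subst_branch.simps) (intro recv_alpha_aux subst_comp refresh_notin)

lemma subst_comp_upd:
  "z \<notin> \<tau> ` (fn P - {r}) \<Longrightarrow> subst (\<sigma>(z := w)) (subst (\<tau>(r := z)) P) \<cong> subst ((\<sigma> \<circ> \<tau>)(r := w)) P"
proof -
  assume "z \<notin> \<tau> ` (fn P - {r})"
  then have "subst (\<sigma>(z := w) \<circ> \<tau>(r := z)) P = subst ((\<sigma> \<circ> \<tau>)(r := w)) P"
    by (intro subst_cong) auto
  with subst_comp show ?thesis by metis
qed

text \<open>Where a rule changes binders or their scope, they are first moved to names outside all
  images involved; the rule can then be replayed under the substitution.\<close>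

lemma scong_subst: "P \<cong> Q \<Longrightarrow> subst \<sigma> P \<cong> subst \<sigma> Q"
proof (induction arbitrary: \<sigma> rule: scong.induct)
  case (cong_sum P Q bs \<pi> cs)
  have "branch_cong (subst_branch \<sigma> (\<pi>, P)) (subst_branch \<sigma> (\<pi>, Q))"
    using cong_sum scong_fn[OF cong_sum(1)] by (cases \<pi>) (auto intro!: branch_cong_cong)
  then show ?case by (simp add: branch_cong_def)
next
  case (cong_res P Q r)
  then show ?case using scong_fn[OF cong_res(1)] by (auto intro!: scong.cong_res)
next
  case (alpha_res z P r)
  obtain w where w: "w \<notin> \<sigma> ` fn P" using ex_fresh[of "\<sigma> ` fn P"] by auto
  have fn: "fn (rename1 P z r) - {z} = fn P - {r}" using alpha_res by (auto simp: image_iff)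
  have "subst \<sigma> (Res r P) \<cong> Res w (subst (\<sigma>(r := w)) P)" by (rule subst_Res) (use w in auto)
  also have "\<dots> \<cong> Res w (subst (\<sigma>(z := w)) (rename1 P z r))"
    using subst_comp_upd[of z id P r \<sigma> w] alpha_res by (intro scong.cong_res) (auto intro: scong.sym)
  also have "\<dots> \<cong> subst \<sigma> (Res z (rename1 P z r))"
    by (intro scong.sym[OF subst_Res]) (use w in \<open>auto simp only: fn\<close>)
  finally show ?case .
next
  case (alpha_recv z P bs a x cs)
  obtain w where w: "w \<notin> \<sigma> ` fn P" using ex_fresh[of "\<sigma> ` fn P"] by auto
  have fn: "fn (rename1 P z x) - {z} = fn P - {x}" using alpha_recv by (auto simp: image_iff)
  have sym: "branch_cong b c \<Longrightarrow> branch_cong c b" for b c by (simp add: branch_cong_def scong.sym)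
  have "branch_cong (subst_branch \<sigma> (Recv a x, P)) (Recv (\<sigma> a) w, subst (\<sigma>(x := w)) P)"
    by (rule subst_Recv) (use w in auto)
  also have "branch_cong \<dots> (Recv (\<sigma> a) w, subst (\<sigma>(z := w)) (rename1 P z x))"
    using subst_comp_upd[of z id P x \<sigma> w] alpha_recv by (intro branch_cong_cong) (auto intro: scong.sym)
  also have "branch_cong \<dots> (subst_branch \<sigma> (Recv a z, rename1 P z x))"
    by (intro sym[OF subst_Recv]) (use w in \<open>auto simp only: fn\<close>)
  finally show ?case by (simp only: subst_Sum map_append list.map branch_cong_def)
next
  case (res_swap r s P)
  show ?case
  proof (cases "r = s")
    case False
    have "finite (\<sigma> ` fn P)" by simp
    then obtain z where z: "z \<notin> \<sigma> ` fn P" using ex_fresh by blast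
    obtain w where w: "w \<notin> insert z (\<sigma> ` fn P)" using ex_fresh[of "insert z (\<sigma> ` fn P)"] by auto
    have "subst \<sigma> (Res r (Res s P)) \<cong> Res z (subst (\<sigma>(r := z)) (Res s P))"
      by (rule subst_Res) (use z in auto)
    also have "\<dots> \<cong> Res z (Res w (subst (\<sigma>(r := z, s := w)) P))"
      by (intro scong.cong_res subst_Res) (use w in auto)
    also have "\<dots> \<cong> Res w (Res z (subst (\<sigma>(r := z, s := w)) P))"
      by (rule scong.res_swap)
    also have "\<sigma>(r := z, s := w) = \<sigma>(s := w, r := z)" using False by (rule fun_upd_twist)
    also have "Res w (Res z (subst (\<sigma>(s := w, r := z)) P)) \<cong> Res w (subst (\<sigma>(s := w)) (Res r P))"
      by (intro scong.cong_res scong.sym[OF subst_Res]) (use w z in auto)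
    also have "\<dots> \<cong> subst \<sigma> (Res s (Res r P))"
      by (rule scong.sym[OF subst_Res]) (use w in auto)
    finally show ?thesis .
  qed (simp add: scong.refl)
next
  case (res_extrude r P Q)
  obtain z where z: "z \<notin> \<sigma> ` (fn P \<union> fn Q)" using ex_fresh[of "\<sigma> ` (fn P \<union> fn Q)"] by auto
  have "subst \<sigma> (Res r (Par P Q)) \<cong> Res z (subst (\<sigma>(r := z)) (Par P Q))"
    by (rule subst_Res) (use z in auto)
  also have "subst (\<sigma>(r := z)) (Par P Q) = Par (subst \<sigma> P) (subst (\<sigma>(r := z)) Q)"
    using res_extrude by (auto intro!: subst_cong)
  also have "Res z \<dots> \<cong> Par (subst \<sigma> P) (Res z (subst (\<sigma>(r := z)) Q))"
    by (rule scong.res_extrude) (use z in auto)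
  also have "\<dots> \<cong> Par (subst \<sigma> P) (subst \<sigma> (Res r Q))"
    by (intro scong.cong_par scong.refl scong.sym[OF subst_Res]) (use z in auto)
  finally show ?case by simp
next
  case (trans P Q R)
  then show ?case by (blast intro: scong.trans)
next
  case (res_zero r)
  then show ?case by (simp add: scong.res_zero)
next
  case (sym P Q)
  then show ?case by (blast intro: scong.sym)
qed (simp_all add: scong.refl scong.cong_par scong.par_assoc scong.par_comm scong.par_unit)

subsection \<open>Restriction of a set of names\<close>

text \<open>Order and repetition of restrictions are irrelevant up to \<open>\<cong>\<close>, so a
  set with its sorted listing allows calculation by set algebra. An infinite set has the empty
  listing, which is why many laws below ask for finiteness.\<close>

definition nu :: "name set \<Rightarrow> proc \<Rightarrow> proc" where
  "nu A P = res_list (sorted_list_of_set A) P"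

lemma res_list_simps [simp]:
  "res_list [] P = P" "res_list (r # rs) P = Res r (res_list rs P)"
  by (simp_all add: res_list_def)

lemma nu_empty [simp]: "nu {} P = P"
  by (simp add: nu_def)

lemma fn_res_list [simp]: "fn (res_list rs P) = fn P - set rs"
  by (induction rs) auto

lemma fn_nu [simp]: "finite A \<Longrightarrow> fn (nu A P) = fn P - A"
  by (simp add: nu_def)

lemma res_list_cong: "P \<cong> Q \<Longrightarrow> res_list rs P \<cong> res_list rs Q"
  by (induction rs) (auto intro: scong.cong_res)

lemma nu_cong: "P \<cong> Q \<Longrightarrow> nu A P \<cong> nu A Q"
  by (simp add: nu_def res_list_cong)

lemma res_garbage:
  assumes "r \<notin> fn P" shows "Res r P \<cong> P"
proof -
  have "Res r P \<cong> Res r (Par P Zero)" by (intro scong.cong_res scong.sym[OF scong.par_unit])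
  also have "\<dots> \<cong> Par P (Res r Zero)" using assms by (rule scong.res_extrude)
  also have "\<dots> \<cong> Par P Zero" by (intro scong.cong_par scong.refl scong.res_zero)
  also have "\<dots> \<cong> P" by (rule scong.par_unit)
  finally show ?thesis .
qed

lemma res_list_insort: "res_list (insort r rs) P \<cong> Res r (res_list rs P)"
proof (induction rs)
  case (Cons s rs)
  have "Res s (res_list (insort r rs) P) \<cong> Res r (Res s (res_list rs P))"
    using scong.trans[OF scong.cong_res[OF Cons] scong.res_swap] .
  then show ?case by (simp add: scong.refl)
qed (simp add: scong.refl)

lemma nu_insert:
  assumes "finite A" shows "nu (insert r A) P \<cong> Res r (nu A P)"
proof (cases "r \<in> A")
  case True
  then have "nu (insert r A) P = nu A P" by (simp add: insert_absorb)
  moreover have "Res r (nu A P) \<cong> nu A P" using True assms by (intro res_garbage) simp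
  ultimately show ?thesis by (simp add: scong.sym)
next
  case False
  then have "sorted_list_of_set (insert r A) = insort r (sorted_list_of_set A)"
    using assms by simp
  then show ?thesis by (simp only: nu_def res_list_insort)
qed

lemma nu_Un: "finite A \<Longrightarrow> finite B \<Longrightarrow> nu (A \<union> B) P \<cong> nu A (nu B P)"
proof (induction A rule: finite_induct)
  case (insert r A)
  have "nu (insert r A \<union> B) P \<cong> Res r (nu (A \<union> B) P)" using nu_insert insert by simp
  also have "\<dots> \<cong> Res r (nu A (nu B P))" using insert by (intro scong.cong_res) simp
  also have "\<dots> \<cong> nu (insert r A) (nu B P)" using insert by (intro scong.sym[OF nu_insert])
  finally show ?case .
qed (simp add: scong.refl)

lemma nu_garbage: "finite A \<Longrightarrow> A \<inter> fn P = {} \<Longrightarrow> nu A P \<cong> P"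
proof (induction A rule: finite_induct)
  case (insert r A)
  have "nu (insert r A) P \<cong> Res r (nu A P)" using insert by (intro nu_insert)
  also have "\<dots> \<cong> nu A P" using insert by (intro res_garbage) auto
  also have "\<dots> \<cong> P" using insert by auto
  finally show ?case .
qed (simp add: scong.refl)

lemma nu_inter_fn: "finite A \<Longrightarrow> nu A P \<cong> nu (A \<inter> fn P) P"
proof -
  assume A: "finite A"
  have "nu ((A \<inter> fn P) \<union> (A - fn P)) P \<cong> nu (A \<inter> fn P) (nu (A - fn P) P)"
    using A by (intro nu_Un) auto
  also have "\<dots> \<cong> nu (A \<inter> fn P) P" using A by (intro nu_cong nu_garbage) auto
  also have "(A \<inter> fn P) \<union> (A - fn P) = A" by auto
  finally show ?thesis .
qed

lemma nu_eq: "finite A \<Longrightarrow> finite B \<Longrightarrow> A \<inter> fn P = B \<inter> fn P \<Longrightarrow> nu A P \<cong> nu B P"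
  by (metis nu_inter_fn scong.trans scong.sym)

lemma nu_par: "finite A \<Longrightarrow> A \<inter> fn P = {} \<Longrightarrow> nu A (Par P Q) \<cong> Par P (nu A Q)"
proof (induction A rule: finite_induct)
  case (insert r A)
  have "nu (insert r A) (Par P Q) \<cong> Res r (nu A (Par P Q))" using insert by (intro nu_insert)
  also have "\<dots> \<cong> Res r (Par P (nu A Q))" using insert by (intro scong.cong_res) auto
  also have "\<dots> \<cong> Par P (Res r (nu A Q))" using insert by (intro scong.res_extrude) auto
  also have "\<dots> \<cong> Par P (nu (insert r A) Q)"
    using insert by (intro scong.cong_par scong.refl scong.sym[OF nu_insert])
  finally show ?case .
qed (simp add: scong.refl)

text \<open>The two blocks of restrictions leave the parallel composition one after the other; the
  crossed disjointness premises exclude capture.\<close>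

lemma nu_par2:
  assumes "finite A" "finite B" "A \<inter> fn Q = {}" "B \<inter> fn P = {}"
  shows "Par (nu A P) (nu B Q) \<cong> nu (A \<union> B) (Par P Q)"
proof -
  have "Par (nu A P) (nu B Q) \<cong> Par (nu B Q) (nu A P)" by (rule scong.par_comm)
  also have "\<dots> \<cong> nu A (Par (nu B Q) P)" using assms by (intro scong.sym[OF nu_par]) auto
  also have "\<dots> \<cong> nu A (Par P (nu B Q))" by (intro nu_cong scong.par_comm)
  also have "\<dots> \<cong> nu A (nu B (Par P Q))" using assms by (intro nu_cong scong.sym[OF nu_par]) auto
  also have "\<dots> \<cong> nu (A \<union> B) (Par P Q)" using assms by (intro scong.sym[OF nu_Un])
  finally show ?thesis .
qed

lemma res_list_nu: "res_list rs P \<cong> nu (set rs) P"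
proof (induction rs)
  case (Cons r rs)
  have "Res r (res_list rs P) \<cong> Res r (nu (set rs) P)" using Cons by (rule scong.cong_res)
  also have "\<dots> \<cong> nu (insert r (set rs)) P" by (rule scong.sym[OF nu_insert]) simp
  finally show ?case by simp
qed (simp add: scong.refl)

text \<open>A whole block of restricted names may be renamed at once. Only the occurring ones
  constrain \<open>h\<close>, because the others can be discarded.\<close>

lemma subst_nu:
  assumes "finite A" "inj_on h (A \<inter> fn P)" "h ` (A \<inter> fn P) \<inter> \<sigma> ` (fn P - A) = {}"
  shows "subst \<sigma> (nu A P) \<cong> nu (h ` (A \<inter> fn P)) (subst (\<lambda>x. if x \<in> A then h x else \<sigma> x) P)"
proof -
  \<comment> \<open>Lists expose an outermost restriction; \<open>\<sigma>\<close> must vary because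
    the renaming of that restriction is added to it.\<close>
  have *: "distinct rs \<Longrightarrow> inj_on h (set rs \<inter> fn P) \<Longrightarrow>
      h ` (set rs \<inter> fn P) \<inter> \<sigma> ` (fn P - set rs) = {} \<Longrightarrow>
    subst \<sigma> (res_list rs P) \<cong>
      nu (h ` (set rs \<inter> fn P)) (subst (\<lambda>x. if x \<in> set rs then h x else \<sigma> x) P)" for rs
  proof (induction rs arbitrary: \<sigma>)
    case (Cons r rs)
    let ?Q = "res_list rs P"
    show ?case
    proof (cases "r \<in> fn P")
      case True
      have rQ: "r \<in> fn ?Q" using True Cons.prems by auto
      have fresh: "h r \<notin> \<sigma> ` (fn ?Q - {r})" using True Cons.prems(3) by auto
      have inj: "inj_on h (insert r (set rs \<inter> fn P))"
        using Cons.prems(2) True by simp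
      then have hr: "h x \<noteq> h r" if "x \<in> set rs" "x \<in> fn P" for x
        using Cons.prems(1) that inj_onD[of h _ x r] by auto
      have "subst \<sigma> (Res r ?Q) \<cong> Res (h r) (subst (\<sigma>(r := h r)) ?Q)"
        using fresh by (rule subst_Res)
      also have "\<dots> \<cong> Res (h r) (nu (h ` (set rs \<inter> fn P))
          (subst (\<lambda>x. if x \<in> set rs then h x else (\<sigma>(r := h r)) x) P))"
        using Cons.prems hr inj by (intro scong.cong_res Cons.IH) auto
      also have "subst (\<lambda>x. if x \<in> set rs then h x else (\<sigma>(r := h r)) x) P
          = subst (\<lambda>x. if x \<in> set (r # rs) then h x else \<sigma> x) P"
        by (rule subst_cong) auto
      also have "Res (h r) (nu (h ` (set rs \<inter> fn P)) \<dots>)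
          \<cong> nu (insert (h r) (h ` (set rs \<inter> fn P))) \<dots>"
        by (rule scong.sym[OF nu_insert]) simp
      also have "insert (h r) (h ` (set rs \<inter> fn P)) = h ` (set (r # rs) \<inter> fn P)"
        using True by auto
      finally show ?thesis by simp
    next
      case False
      then have eq: "set (r # rs) \<inter> fn P = set rs \<inter> fn P" "fn P - set (r # rs) = fn P - set rs" by auto
      have "subst \<sigma> (Res r ?Q) \<cong> subst \<sigma> ?Q"
        using False by (intro scong_subst res_garbage) auto
      also have "\<dots> \<cong> nu (h ` (set rs \<inter> fn P)) (subst (\<lambda>x. if x \<in> set rs then h x else \<sigma> x) P)"
        using Cons.prems unfolding eq by (intro Cons.IH) auto
      also have "subst (\<lambda>x. if x \<in> set rs then h x else \<sigma> x) P
          = subst (\<lambda>x. if x \<in> set (r # rs) then h x else \<sigma> x) P"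
        using False by (intro subst_cong) auto
      finally show ?thesis by (simp only: res_list_simps eq)
    qed
  qed (auto intro!: scong.refl)
  from *[of "sorted_list_of_set A"] assms show ?thesis by (simp add: nu_def)
qed

subsection \<open>Parallel composition of a multiset of processes\<close>

lemma par_list_Cons: "par_list (P # Ps) \<cong> Par P (par_list Ps)"
  by (cases Ps) (auto intro: scong.refl scong.sym[OF scong.par_unit])

lemma par_list_append: "par_list (Ps @ Qs) \<cong> Par (par_list Ps) (par_list Qs)"
proof (induction Ps)
  case Nil
  have "par_list Qs \<cong> Par Zero (par_list Qs)"
    by (meson scong.par_unit scong.par_comm scong.sym scong.trans)
  then show ?case by simp
next
  case (Cons P Ps)
  have "par_list (P # (Ps @ Qs)) \<cong> Par P (par_list (Ps @ Qs))" by (rule par_list_Cons)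
  also have "\<dots> \<cong> Par P (Par (par_list Ps) (par_list Qs))" by (intro scong.cong_par scong.refl Cons)
  also have "\<dots> \<cong> Par (Par P (par_list Ps)) (par_list Qs)" by (rule scong.sym[OF scong.par_assoc])
  also have "\<dots> \<cong> Par (par_list (P # Ps)) (par_list Qs)"
    by (intro scong.cong_par scong.refl scong.sym[OF par_list_Cons])
  finally show ?case by simp
qed

lemma fn_par_list [simp]: "fn (par_list Ps) = (\<Union>P\<in>set Ps. fn P)"
  by (induction Ps rule: par_list.induct) auto

lemma par_list_cong: "list_all2 (\<cong>) Ps Qs \<Longrightarrow> par_list Ps \<cong> par_list Qs"
proof (induction rule: list_all2_induct)
  case (Cons P Ps Q Qs)
  have "par_list (P # Ps) \<cong> Par P (par_list Ps)" by (rule par_list_Cons)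
  also have "\<dots> \<cong> Par Q (par_list Qs)" using Cons by (intro scong.cong_par)
  also have "\<dots> \<cong> par_list (Q # Qs)" by (rule scong.sym[OF par_list_Cons])
  finally show ?case .
qed (simp add: scong.refl)

lemma par_list_rotate: "par_list (Ps @ Q # Qs) \<cong> Par Q (par_list (Ps @ Qs))"
proof -
  have "par_list (Ps @ Q # Qs) \<cong> Par (par_list Ps) (par_list (Q # Qs))" by (rule par_list_append)
  also have "\<dots> \<cong> Par (par_list (Q # Qs)) (par_list Ps)" by (rule scong.par_comm)
  also have "\<dots> \<cong> Par (Par Q (par_list Qs)) (par_list Ps)"
    by (intro scong.cong_par scong.refl par_list_Cons)
  also have "\<dots> \<cong> Par Q (Par (par_list Qs) (par_list Ps))" by (rule scong.par_assoc)
  also have "\<dots> \<cong> Par Q (Par (par_list Ps) (par_list Qs))"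
    by (intro scong.cong_par scong.refl scong.par_comm)
  also have "\<dots> \<cong> Par Q (par_list (Ps @ Qs))"
    by (intro scong.cong_par scong.refl scong.sym[OF par_list_append])
  finally show ?thesis .
qed

lemma par_list_perm: "mset Ps = mset Qs \<Longrightarrow> par_list Ps \<cong> par_list Qs"
proof (induction Ps arbitrary: Qs)
  case (Cons P Ps)
  then have "P \<in> set Qs" by (metis list.set_intros(1) set_mset_mset)
  then obtain As Bs where Qs: "Qs = As @ P # Bs" by (meson split_list)
  have "par_list (P # Ps) \<cong> Par P (par_list Ps)" by (rule par_list_Cons)
  also have "\<dots> \<cong> Par P (par_list (As @ Bs))"
    using Cons.prems Qs by (intro scong.cong_par scong.refl Cons.IH) simp
  also have "\<dots> \<cong> par_list Qs" unfolding Qs by (rule scong.sym[OF par_list_rotate])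
  finally show ?case .
qed (simp add: scong.refl)

lemma par_list_rel_mset:
  assumes "rel_mset (\<cong>) (mset Ps) (mset Qs)" shows "par_list Ps \<cong> par_list Qs"
proof -
  obtain Ps' Qs' where *: "mset Ps' = mset Ps" "mset Qs' = mset Qs" "list_all2 (\<cong>) Ps' Qs'"
    using assms by (auto simp: rel_mset_def)
  have "par_list Ps \<cong> par_list Ps'" using * by (intro par_list_perm) simp
  also have "\<dots> \<cong> par_list Qs'" using * by (intro par_list_cong)
  also have "\<dots> \<cong> par_list Qs" using * by (intro par_list_perm)
  finally show ?thesis .
qed

subsection \<open>Opening the top-level restrictions\<close>

text \<open>Received names are compared through all their instances, which makes the choice of the
  bound name invisible.\<close>

fun branch_eq :: "prefix \<times> proc \<Rightarrow> prefix \<times> proc \<Rightarrow> bool" where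
  "branch_eq (Tau, P) (Tau, Q) \<longleftrightarrow> P \<cong> Q"
| "branch_eq (Send a b, P) (Send c d, Q) \<longleftrightarrow> a = c \<and> b = d \<and> P \<cong> Q"
| "branch_eq (Recv a x, P) (Recv b y, Q) \<longleftrightarrow> a = b \<and> (\<forall>z. rename1 P z x \<cong> rename1 Q z y)"
| "branch_eq _ _ \<longleftrightarrow> False"

text \<open>An invertible fragment of \<open>\<cong>\<close>: calls and prefixes must agree
  outright, and freedom remains only in the continuations behind the prefixes. It is reflexive on
  calls and choices alone.\<close>

fun guard_eq :: "proc \<Rightarrow> proc \<Rightarrow> bool" where
  "guard_eq (Call K as) (Call L bs) \<longleftrightarrow> K = L \<and> as = bs"
| "guard_eq (Sum bs) (Sum cs) \<longleftrightarrow> list_all2 branch_eq bs cs"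
| "guard_eq _ _ \<longleftrightarrow> False"

lemma branch_eq_refl: "branch_eq b b"
  by (cases "(b, b)" rule: branch_eq.cases) (auto intro: scong.refl)

lemma branch_eq_sym: "branch_eq b c \<Longrightarrow> branch_eq c b"
  by (cases "(b, c)" rule: branch_eq.cases) (auto intro: scong.sym)

lemma branch_eq_trans: "branch_eq b c \<Longrightarrow> branch_eq c d \<Longrightarrow> branch_eq b d"
  by (cases "(b, c)" rule: branch_eq.cases; cases "(c, d)" rule: branch_eq.cases)
    (auto intro: scong.trans)

text \<open>Both receiving binders are moved to a common fresh name, and the hypothesis is used at
  that instance.\<close>

lemma branch_eq_cong: "branch_eq b c \<Longrightarrow> branch_cong b c"
proof (cases "(b, c)" rule: branch_eq.cases)
  case (3 a x P a' y Q)
  assume "branch_eq b c"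
  with 3 have *: "a = a'" "rename1 P z x \<cong> rename1 Q z y" for z by auto
  obtain z where "z \<notin> fn P \<union> fn Q" using ex_fresh[of "fn P \<union> fn Q"] by auto
  then have "branch_cong (Recv a x, P) (Recv a z, rename1 P z x)"
    "branch_cong (Recv a z, rename1 Q z y) (Recv a y, Q)"
    by (auto simp: branch_cong_def intro: scong.alpha_recv scong.sym[OF scong.alpha_recv])
  moreover have "branch_cong (Recv a z, rename1 P z x) (Recv a z, rename1 Q z y)"
    by (intro branch_cong_cong *)
  ultimately show ?thesis using 3 *(1) by (auto intro: branch_cong_trans)
qed (auto intro: branch_cong_cong)

lemma guard_eq_scong: "guard_eq P Q \<Longrightarrow> P \<cong> Q"
  by (cases "(P, Q)" rule: guard_eq.cases)
    (auto intro!: scong.refl scong_Sum branch_eq_cong elim: list_all2_mono)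

lemma guard_eq_sym: "guard_eq P Q \<Longrightarrow> guard_eq Q P"
  by (cases "(P, Q)" rule: guard_eq.cases)
    (auto simp: list_all2_conv_all_nth branch_eq_sym)

lemma guard_eq_trans:
  assumes "guard_eq P Q" "guard_eq Q R" shows "guard_eq P R"
proof (cases P)
  case (Sum bs)
  with assms(1) obtain cs where Q: "Q = Sum cs" "list_all2 branch_eq bs cs" by (cases Q) auto
  with assms(2) obtain ds where R: "R = Sum ds" "list_all2 branch_eq cs ds" by (cases R) auto
  have "list_all2 branch_eq bs ds"
    using Q(2) R(2) by (rule list_all2_trans[rotated]) (rule branch_eq_trans)
  with Sum R show ?thesis by simp
next
  case (Call K as)
  with assms show ?thesis by (cases Q) auto
qed (use assms in auto)

abbreviation mset_eq :: "proc multiset \<Rightarrow> proc multiset \<Rightarrow> bool" where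
  "mset_eq \<equiv> rel_mset guard_eq"

lemma mset_eq_sym: "mset_eq M N \<Longrightarrow> mset_eq N M"
proof -
  have "guard_eq\<inverse>\<inverse> = guard_eq" 
    unfolding fun_eq_iff conversep_iff using guard_eq_sym by blast
  then show "mset_eq M N \<Longrightarrow> mset_eq N M" using multiset.rel_flip[of guard_eq M N] by simp
qed

lemma mset_eq_trans: "mset_eq M N \<Longrightarrow> mset_eq N L \<Longrightarrow> mset_eq M L"
  using multiset.rel_compp[of guard_eq guard_eq] guard_eq_trans
  by (smt (verit, best) multiset.rel_mono_strong relcomppE relcomppI)

definition fns :: "proc multiset \<Rightarrow> name set" where
  "fns M = (\<Union>P\<in>set_mset M. fn P)"

lemma fns_simps [simp]:
  "fns {#} = {}" "fns (add_mset P M) = fn P \<union> fns M" "fns (M + N) = fns M \<union> fns N"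
  by (auto simp: fns_def)

lemma finite_fns [simp]: "finite (fns M)"
  by (simp add: fns_def)

lemma fns_mset: "fns (mset Ps) = fn (par_list Ps)"
  by (simp add: fns_def)

lemma mset_eq_fns: "mset_eq M N \<Longrightarrow> fns M = fns N"
proof -
  assume "mset_eq M N"
  then obtain Ps Qs where *: "mset Ps = M" "mset Qs = N" "list_all2 guard_eq Ps Qs"
    by (auto simp: rel_mset_def)
  have "par_list Ps \<cong> par_list Qs"
    by (rule par_list_cong, rule list_all2_mono[OF *(3)]) (rule guard_eq_scong)
  then show ?thesis unfolding *(1,2)[symmetric] fns_mset by (rule scong_fn)
qed

lemma rel_mset_plus: "rel_mset R M M' \<Longrightarrow> rel_mset R N N' \<Longrightarrow> rel_mset R (M + N) (M' + N')"
  unfolding rel_mset_def by (metis list_all2_appendI mset_append)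

text \<open>\<open>opn e P M\<close>: under the renaming \<open>e\<close>, the guarded components of \<open>P\<close> are \<open>M\<close> once the
  top-level restrictions have been given names of our choice.  The chosen names that matter are
  \<open>fns M - e ` fn P\<close>; keeping them implicit disposes of unused restrictions.\<close>

fun opn :: "(name \<Rightarrow> name) \<Rightarrow> proc \<Rightarrow> proc multiset \<Rightarrow> bool" where
  "opn e (Call K as) M \<longleftrightarrow> M = {#Call K (map e as)#}"
| "opn e (Sum bs) M \<longleftrightarrow> M = (if bs = [] then {#} else {#subst e (Sum bs)#})"
| "opn e (Res r P) M \<longleftrightarrow> (\<exists>z. z \<notin> e ` (fn P - {r}) \<and> opn (e(r := z)) P M)"
| "opn e (Par P Q) M \<longleftrightarrow> (\<exists>M1 M2. M = M1 + M2 \<and> opn e P M1 \<and> opn e Q M2 \<and>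
     (fns M1 - e ` fn P) \<inter> fns M2 = {} \<and> (fns M2 - e ` fn Q) \<inter> fns M1 = {})"

lemma opn_cong: "(\<And>x. x \<in> fn P \<Longrightarrow> e x = e' x) \<Longrightarrow> opn e P = opn e' P"
proof (induction P arbitrary: e e' rule: proc_induct)
  case (Call K as)
  then have "map e as = map e' as" by auto
  then show ?case by (intro ext) (simp only: opn.simps)
next
  case (Sum bs)
  then have "subst e (Sum bs) = subst e' (Sum bs)" by (intro subst_cong)
  then show ?case by (intro ext) (simp only: opn.simps)
next
  case (Res r P)
  have "opn (e(r := z)) P = opn (e'(r := z)) P" for z
    by (rule Res.IH) (use Res.prems in auto)
  moreover have "e ` (fn P - {r}) = e' ` (fn P - {r})"
    by (rule image_cong) (use Res.prems in auto)
  ultimately show ?case by (intro ext) simp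
next
  case (Par P Q)
  have "opn e P = opn e' P" "opn e Q = opn e' Q"
    by (rule Par.IH; use Par.prems in auto)+
  moreover have "e ` fn P = e' ` fn P" "e ` fn Q = e' ` fn Q"
    by (rule image_cong; use Par.prems in auto)+
  ultimately show ?case by (intro ext) simp
qed

text \<open>Prefixes and arguments survive opening, and with them every free name. In scope
  extrusion and associativity this converts freshness for components into freshness for free names
  and back.\<close>

lemma opn_fn: "opn e P M \<Longrightarrow> e ` fn P \<subseteq> fns M"
proof (induction P arbitrary: e M rule: proc_induct)
  case (Sum bs)
  have "fn (subst e (Sum bs)) = e ` fn (Sum bs)" by (rule fn_subst)
  with Sum show ?case by (cases "bs = []") auto
next
  case (Res r P)
  then obtain z where "opn (e(r := z)) P M" by auto
  with Res.IH have "(e(r := z)) ` fn P \<subseteq> fns M" by blast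
  moreover have "e ` (fn P - {r}) = (e(r := z)) ` (fn P - {r})" by (rule image_cong) auto
  ultimately show ?case by auto
next
  case (Par P Q)
  then show ?case by (fastforce simp: image_Un)
qed auto

section \<open>Openings compared up to equality of guards\<close>

definition opn_sim :: "(proc multiset \<Rightarrow> bool) \<Rightarrow> (proc multiset \<Rightarrow> bool) \<Rightarrow> bool" where
  "opn_sim A B \<longleftrightarrow> (\<forall>M. A M \<longrightarrow> (\<exists>N. B N \<and> mset_eq M N))"

lemma guard_eq_refl: "is_call P \<or> is_choice P \<Longrightarrow> guard_eq P P"
  by (cases P) (auto intro!: list_all2_refl branch_eq_refl)

lemma opn_guarded: "opn e P M \<Longrightarrow> Q \<in># M \<Longrightarrow> is_call Q \<or> is_choice Q"
  by (induction P arbitrary: e M rule: proc_induct) (fastforce split: if_splits)+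

lemma opn_mset_eq_refl: "opn e P M \<Longrightarrow> mset_eq M M"
  using opn_guarded guard_eq_refl by (metis multiset.rel_refl_strong)

lemma opn_sim_refl: "opn_sim (opn e P) (opn e P)"
  unfolding opn_sim_def using opn_mset_eq_refl by blast

lemma opn_sim_trans: "opn_sim A B \<Longrightarrow> opn_sim B C \<Longrightarrow> opn_sim A C"
  unfolding opn_sim_def by (meson mset_eq_trans)

lemma opn_simI: "(\<And>M. A M \<Longrightarrow> \<exists>N. B N \<and> mset_eq M N) \<Longrightarrow> opn_sim A B"
  by (simp add: opn_sim_def)

text \<open>The disjointness conditions of a parallel opening carry over because
  \<open>mset_eq\<close> preserves \<open>fns\<close>.\<close>

lemma opn_sim_Par:
  assumes "opn_sim (opn e P) (opn e' P')" "opn_sim (opn e Q) (opn e' Q')"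
    "e ` fn P = e' ` fn P'" "e ` fn Q = e' ` fn Q'"
  shows "opn_sim (opn e (Par P Q)) (opn e' (Par P' Q'))"
proof (rule opn_simI)
  fix M assume "opn e (Par P Q) M"
  then obtain M1 M2 where M: "M = M1 + M2" "opn e P M1" "opn e Q M2"
    and disj: "(fns M1 - e ` fn P) \<inter> fns M2 = {}" "(fns M2 - e ` fn Q) \<inter> fns M1 = {}" by auto
  from M assms obtain N1 N2 where N: "opn e' P' N1" "opn e' Q' N2" "mset_eq M1 N1" "mset_eq M2 N2"
    unfolding opn_sim_def by meson
  have "opn e' (Par P' Q') (N1 + N2)"
    using N(1,2) disj mset_eq_fns[OF N(3)] mset_eq_fns[OF N(4)] assms(3,4) by auto
  moreover have "mset_eq M (N1 + N2)" unfolding M using N(3,4) by (rule rel_mset_plus)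
  ultimately show "\<exists>N. opn e' (Par P' Q') N \<and> mset_eq M N" by blast
qed

lemma opn_sim_Res:
  assumes "\<And>z. z \<notin> e ` (fn P - {r}) \<Longrightarrow> opn_sim (opn (e(r := z)) P) (opn (e'(r' := z)) P')"
    "e ` (fn P - {r}) = e' ` (fn P' - {r'})"
  shows "opn_sim (opn e (Res r P)) (opn e' (Res r' P'))"
proof (rule opn_simI)
  fix M assume "opn e (Res r P) M"
  then obtain z where z: "z \<notin> e ` (fn P - {r})" "opn (e(r := z)) P M" by auto
  with assms(1)[OF z(1)] obtain N where N: "opn (e'(r' := z)) P' N" "mset_eq M N"
    unfolding opn_sim_def by blast
  have "opn e' (Res r' P') N" using N(1) z(1) assms(2) unfolding opn.simps by blast
  with N(2) show "\<exists>N. opn e' (Res r' P') N \<and> mset_eq M N" by blast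
qed

text \<open>Finer than \<open>subst_comp\<close>: the prefixes of the two choices agree outright,
  and \<open>\<cong>\<close> is confined to the continuations.\<close>

lemma subst_Sum_comp:
  assumes "bs \<noteq> []"
  shows "guard_eq (subst e (subst \<sigma> (Sum bs))) (subst (e \<circ> \<sigma>) (Sum bs))"
proof -
  have "branch_eq (subst_branch e (subst_branch \<sigma> b)) (subst_branch (e \<circ> \<sigma>) b)" for b
  proof -
    obtain \<pi> P where b: "b = (\<pi>, P)" by force
    show ?thesis
    proof (cases \<pi>)
      case (Recv a x)
      define x' where "x' = refresh x (\<sigma> ` (fn P - {x}))"
      have x': "x' \<notin> \<sigma> ` (fn P - {x})" by (simp add: x'_def)
      define P' where "P' = subst (\<sigma>(x := x')) P"
      have "rename1 (subst (e(x' := refresh x' (e ` (fn P' - {x'})))) P') w (refresh x' (e ` (fn P' - {x'})))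
        \<cong> rename1 (subst ((e \<circ> \<sigma>)(x := refresh x ((e \<circ> \<sigma>) ` (fn P - {x})))) P) w (refresh x ((e \<circ> \<sigma>) ` (fn P - {x})))"
        (is "?L \<cong> ?R") for w
      proof -
        have "?L \<cong> subst (e(x' := w)) P'" by (rule rename_subst) (rule refresh_notin)
        also have "\<dots> \<cong> subst ((e \<circ> \<sigma>)(x := w)) P" unfolding P'_def by (rule subst_comp_upd[OF x'])
        also have "\<dots> \<cong> ?R" by (rule scong.sym[OF rename_subst]) (rule refresh_notin)
        finally show ?thesis .
      qed
      then show ?thesis
        by (simp only: b Recv subst_branch.simps branch_eq.simps flip: x'_def P'_def) simp
    qed (auto simp: b intro!: subst_comp)
  qed
  then show ?thesis by (simp add: list_all2_conv_all_nth)
qed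

text \<open>Substituting first amounts to opening under the composed renaming; this is what alpha
  conversion requires of \<open>opn\<close>.\<close>

lemma opn_subst:
  "opn_sim (opn e (subst \<sigma> P)) (opn (e \<circ> \<sigma>) P) \<and> opn_sim (opn (e \<circ> \<sigma>) P) (opn e (subst \<sigma> P))"
proof (induction P arbitrary: e \<sigma> rule: proc_induct)
  case (Call K as)
  have "opn e (subst \<sigma> (Call K as)) = opn (e \<circ> \<sigma>) (Call K as)"
    by (intro ext) simp
  then show ?case using opn_sim_refl by metis
next
  case (Sum bs)
  show ?case
  proof (cases "bs = []")
    case False
    have *: "opn e (subst \<sigma> (Sum bs)) = (\<lambda>M. M = {#subst e (subst \<sigma> (Sum bs))#})"
      "opn (e \<circ> \<sigma>) (Sum bs) = (\<lambda>M. M = {#subst (e \<circ> \<sigma>) (Sum bs)#})"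
      using False by (auto intro!: ext)
    have "guard_eq P Q \<Longrightarrow> mset_eq {#P#} {#Q#}" for P Q by (simp add: rel_mset_Plus rel_mset_Zero)
    then show ?thesis unfolding * opn_sim_def
      using subst_Sum_comp[OF False, of e \<sigma>] guard_eq_sym by blast
  qed (auto simp: opn_sim_def rel_mset_Zero)
next
  case (Res r P)
  define r' where "r' = refresh r (\<sigma> ` (fn P - {r}))"
  have r': "r' \<notin> \<sigma> ` (fn P - {r})" by (simp add: r'_def)
  have eq: "subst \<sigma> (Res r P) = Res r' (subst (\<sigma>(r := r')) P)" by (simp add: r'_def)
  have im: "e ` (fn (subst (\<sigma>(r := r')) P) - {r'}) = (e \<circ> \<sigma>) ` (fn P - {r})"
    unfolding fn_subst image_upd_fresh[OF r'] by (simp add: image_comp)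
  have "opn (e(r' := z) \<circ> \<sigma>(r := r')) P = opn ((e \<circ> \<sigma>)(r := z)) P" for z
    by (rule opn_cong) (use r' in auto)
  with Res.IH[of "e(r' := z)" "\<sigma>(r := r')" for z]
  have "opn_sim (opn (e(r' := z)) (subst (\<sigma>(r := r')) P)) (opn ((e \<circ> \<sigma>)(r := z)) P)"
    "opn_sim (opn ((e \<circ> \<sigma>)(r := z)) P) (opn (e(r' := z)) (subst (\<sigma>(r := r')) P))" for z
    by metis+
  then show ?case unfolding eq using im by (intro conjI opn_sim_Res) metis+
next
  case (Par P Q)
  then show ?case
    by (simp only: subst.simps) (intro conjI opn_sim_Par; simp add: image_comp comp_def)
qed

text \<open>Some admissible name can always be chosen, and the choice leaves no trace in the
  components.\<close>

lemma opn_Res_unused: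
  assumes "r \<notin> fn P" shows "opn e (Res r P) = opn e P"
proof -
  have "opn (e(r := z)) P = opn e P" for z by (rule opn_cong) (use assms in auto)
  then show ?thesis using ex_fresh[of "e ` (fn P - {r})"] by (intro ext) auto
qed

text \<open>If the binders are distinct and both occur, the chosen names differ and the choices can
  be exchanged. In the remaining cases the binders coincide or one of them is irrelevant.\<close>

lemma opn_Res_swap:
  assumes "opn e (Res r (Res s P)) M" shows "opn e (Res s (Res r P)) M"
proof (cases "r = s \<or> r \<notin> fn P \<or> s \<notin> fn P")
  case True
  then consider "r = s" | "r \<notin> fn P" | "s \<notin> fn P" by auto
  then show ?thesis
  proof cases
    case 2
    then have "opn e (Res r (Res s P)) = opn e (Res s P)" by (intro opn_Res_unused) auto
    with assms have *: "opn e (Res s P) M" by simp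
    have "opn e' (Res r P) = opn e' P" for e' using 2 by (rule opn_Res_unused)
    moreover have "fn (Res r P) = fn P" using 2 by simp
    ultimately show ?thesis using * by (simp del: opn.simps add: opn.simps(3)[of e s])
  next
    case 3
    have "opn e' (Res s P) = opn e' P" for e' using 3 by (rule opn_Res_unused)
    moreover have "fn (Res s P) = fn P" using 3 by simp
    ultimately have "opn e (Res r P) M" using assms by (simp del: opn.simps add: opn.simps(3)[of e r])
    moreover have "opn e (Res s (Res r P)) = opn e (Res r P)" using 3 by (intro opn_Res_unused) auto
    ultimately show ?thesis by simp
  qed (use assms in simp)
next
  case False
  then obtain z w where zw: "z \<notin> e ` (fn P - {s} - {r})" "w \<notin> (e(r := z)) ` (fn P - {s})"
    "opn (e(r := z, s := w)) P M" using assms by auto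
  \<comment> \<open>\<open>r\<close> occurs in \<open>P\<close> and differs from \<open>s\<close>,
    so \<open>z\<close> lies in the image that \<open>w\<close> has to avoid.\<close>
  have "z \<noteq> w" using zw(2) False by auto
  then have "w \<notin> e ` (fn P - {r} - {s})" "z \<notin> (e(s := w)) ` (fn P - {r})"
    using zw(1,2) by auto
  moreover have "e(r := z, s := w) = e(s := w, r := z)" using False by (intro fun_upd_twist) auto
  ultimately show ?thesis using zw(3) by auto
qed

text \<open>The two sides impose freshness of the name for \<open>r\<close> in different ways:
  against the free names of \<open>P\<close> in the wide scope, against the components of
  \<open>P\<close> in the narrow one. The disjointness conditions of the parallel opening reconcile
  them.\<close>

lemma opn_extrude:
  assumes r: "r \<notin> fn P"
  shows "opn e (Res r (Par P Q)) M \<longleftrightarrow> opn e (Par P (Res r Q)) M"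
proof (cases "r \<in> fn Q")
  case True
  have eP: "opn (e(r := z)) P = opn e P" "(e(r := z)) ` fn P = e ` fn P"
    "(e(r := z)) ` fn Q = insert z (e ` (fn Q - {r}))" for z
    using r True by (auto intro!: opn_cong)
  have PQ: "fn P \<union> fn Q - {r} = fn P \<union> (fn Q - {r})" using r by auto
  show ?thesis
  proof
    assume "opn e (Res r (Par P Q)) M"
    then obtain z M1 M2 where z: "z \<notin> e ` (fn P \<union> fn Q - {r})" and M: "M = M1 + M2" "opn e P M1"
      "opn (e(r := z)) Q M2" and d: "(fns M1 - e ` fn P) \<inter> fns M2 = {}"
      "(fns M2 - insert z (e ` (fn Q - {r}))) \<inter> fns M1 = {}"
      by (auto simp: eP simp del: fun_upd_apply)
    \<comment> \<open>Occurring in \<open>M2\<close>, the chosen name could lie in \<open>M1\<close>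
      only as the image of a free name of \<open>P\<close>, which the wide scope rules out.\<close>
    have "z \<in> fns M2" using opn_fn[OF M(3)] eP(3) by blast
    then have "z \<notin> fns M1" using z r d(1) unfolding PQ by blast
    then have "(fns M2 - e ` (fn Q - {r})) \<inter> fns M1 = {}" using d(2) by blast
    moreover have "opn e (Res r Q) M2" using z M(3) unfolding opn.simps PQ by blast
    ultimately show "opn e (Par P (Res r Q)) M"
      using M(1,2) d(1) unfolding opn.simps(4) fn.simps by blast
  next
    assume "opn e (Par P (Res r Q)) M"
    then obtain z M1 M2 where z: "z \<notin> e ` (fn Q - {r})" and M: "M = M1 + M2" "opn e P M1"
      "opn (e(r := z)) Q M2" and d: "(fns M1 - e ` fn P) \<inter> fns M2 = {}"
      "(fns M2 - e ` (fn Q - {r})) \<inter> fns M1 = {}"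
      by (auto simp del: fun_upd_apply)
    have "z \<in> fns M2" using opn_fn[OF M(3)] eP(3) by blast
    then have "z \<notin> e ` fn P" using z d(2) opn_fn[OF M(2)] by blast
    then have "z \<notin> e ` (fn P \<union> fn Q - {r})" using z unfolding PQ by blast
    moreover have "opn (e(r := z)) (Par P Q) M"
      unfolding opn.simps eP using M d by blast
    ultimately show "opn e (Res r (Par P Q)) M" by (auto simp del: fun_upd_apply)
  qed
next
  case False
  then have "opn e (Res r (Par P Q)) = opn e (Par P Q)" using r by (intro opn_Res_unused) auto
  moreover have "opn e (Res r Q) = opn e Q" using False by (intro opn_Res_unused)
  moreover have "fn (Res r Q) = fn Q" using False by simp
  ultimately show ?thesis by (simp del: opn.simps add: opn.simps(4))
qed

text \<open>The set-theoretic core of associativity: the side conditions of the two bracketings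
  agree elementwise once the inclusions of \<open>opn_fn\<close> are known.\<close>

lemma disjoint_assoc:
  assumes "a \<subseteq> A" "b \<subseteq> B" "c \<subseteq> C"
  shows "(A - a) \<inter> B = {} \<and> (B - b) \<inter> A = {} \<and> (A \<union> B - (a \<union> b)) \<inter> C = {} \<and> (C - c) \<inter> (A \<union> B) = {}
    \<longleftrightarrow> (B - b) \<inter> C = {} \<and> (C - c) \<inter> B = {} \<and> (A - a) \<inter> (B \<union> C) = {} \<and> (B \<union> C - (b \<union> c)) \<inter> A = {}"
  (is "?L \<longleftrightarrow> ?R")
proof -
  have "?L \<longleftrightarrow> (\<forall>x. (x \<in> A \<and> x \<notin> a \<longrightarrow> x \<notin> B) \<and> (x \<in> B \<and> x \<notin> b \<longrightarrow> x \<notin> A) \<and>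
      ((x \<in> A \<or> x \<in> B) \<and> x \<notin> a \<and> x \<notin> b \<longrightarrow> x \<notin> C) \<and> (x \<in> C \<and> x \<notin> c \<longrightarrow> x \<notin> A \<and> x \<notin> B))"
    by auto
  also have "\<dots> \<longleftrightarrow> (\<forall>x. (x \<in> B \<and> x \<notin> b \<longrightarrow> x \<notin> C) \<and> (x \<in> C \<and> x \<notin> c \<longrightarrow> x \<notin> B) \<and>
      (x \<in> A \<and> x \<notin> a \<longrightarrow> x \<notin> B \<and> x \<notin> C) \<and> ((x \<in> B \<or> x \<in> C) \<and> x \<notin> b \<and> x \<notin> c \<longrightarrow> x \<notin> A))"
    using assms by (intro iff_allI) blast
  also have "\<dots> \<longleftrightarrow> ?R" by auto
  finally show ?thesis .
qed

text \<open>The invariance behind the inversion of reactions. The renaming \<open>e\<close> is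
  arbitrary because it is updated below every restriction, and both directions are carried along for
  the sake of the rule \<open>sym\<close>.\<close>

lemma scong_opn_sim:
  "P \<cong> Q \<Longrightarrow> opn_sim (opn e P) (opn e Q) \<and> opn_sim (opn e Q) (opn e P)"
proof (induction arbitrary: e rule: scong.induct)
  case (trans P Q R)
  then show ?case using opn_sim_trans by blast
next
  case (cong_sum P Q bs \<pi> cs)
  have "branch_eq (subst_branch e (\<pi>, P)) (subst_branch e (\<pi>, Q))"
    using cong_sum(1) scong_fn[OF cong_sum(1)]
    by (cases \<pi>) (auto intro!: scong_subst)
  then have "list_all2 branch_eq (map (subst_branch e) (bs @ (\<pi>, P) # cs))
      (map (subst_branch e) (bs @ (\<pi>, Q) # cs))"
    by (auto simp: list_all2_append list_all2_refl branch_eq_refl)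
  then have "mset_eq {#subst e (Sum (bs @ (\<pi>, P) # cs))#} {#subst e (Sum (bs @ (\<pi>, Q) # cs))#}"
    by (simp only: subst_Sum) (simp add: rel_mset_Plus rel_mset_Zero)
  then show ?case by (auto simp: opn_sim_def intro: mset_eq_sym)
next
  case (cong_res P Q r)
  then show ?case using scong_fn[OF cong_res(1)] by (intro conjI opn_sim_Res) auto
next
  case (cong_par P P' Q Q')
  then show ?case
    using scong_fn[OF cong_par(1)] scong_fn[OF cong_par(2)] by (intro conjI opn_sim_Par) auto
next
  case (alpha_res z P r)
  have fn: "fn (rename1 P z r) - {z} = fn P - {r}" using alpha_res by (auto simp: image_iff)
  have "opn (e(z := w) \<circ> id(r := z)) P = opn (e(r := w)) P" for w
    by (rule opn_cong) (use alpha_res in auto)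
  with opn_subst[of "e(z := w)" "id(r := z)" P for w]
  have "opn_sim (opn (e(z := w)) (rename1 P z r)) (opn (e(r := w)) P)"
    "opn_sim (opn (e(r := w)) P) (opn (e(z := w)) (rename1 P z r))" for w by metis+
  then show ?case using fn by (intro conjI opn_sim_Res) auto
next
  case (alpha_recv z P bs a x cs)
  have fn: "fn (rename1 P z x) - {z} = fn P - {x}" using alpha_recv by (auto simp: image_iff)
  have "rename1 (subst (e(x := refresh x (e ` (fn P - {x})))) P) w (refresh x (e ` (fn P - {x})))
    \<cong> rename1 (subst (e(z := refresh z (e ` (fn (rename1 P z x) - {z})))) (rename1 P z x)) w
        (refresh z (e ` (fn (rename1 P z x) - {z})))" (is "?L \<cong> ?R") for w
  proof -
    have "?L \<cong> subst (e(x := w)) P" by (rule rename_subst) (rule refresh_notin)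
    also have "\<dots> \<cong> subst (e(z := w)) (rename1 P z x)"
      using subst_comp_upd[of z id P x e w] alpha_recv by (auto intro: scong.sym)
    also have "\<dots> \<cong> ?R" by (rule scong.sym[OF rename_subst]) (rule refresh_notin)
    finally show ?thesis .
  qed
  then have "branch_eq (subst_branch e (Recv a x, P)) (subst_branch e (Recv a z, rename1 P z x))"
    by (simp only: subst_branch.simps branch_eq.simps) simp
  then have "list_all2 branch_eq (map (subst_branch e) (bs @ (Recv a x, P) # cs))
      (map (subst_branch e) (bs @ (Recv a z, rename1 P z x) # cs))"
    by (auto simp: list_all2_append list_all2_refl branch_eq_refl simp del: subst_branch.simps)
  then have "mset_eq {#subst e (Sum (bs @ (Recv a x, P) # cs))#}
      {#subst e (Sum (bs @ (Recv a z, rename1 P z x) # cs))#}"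
    by (simp only: subst_Sum) (simp add: rel_mset_Plus rel_mset_Zero del: subst_branch.simps)
  then show ?case by (auto simp: opn_sim_def intro: mset_eq_sym)
next
  case (par_assoc P Q R)
  let ?A = "\<lambda>P M. fns M - e ` fn P"
  have "opn e (Par (Par P Q) R) M \<longleftrightarrow> opn e (Par P (Par Q R)) M" for M
  proof
    assume "opn e (Par (Par P Q) R) M"
    then obtain M1 M2 M3 where M: "M = (M1 + M2) + M3" "opn e P M1" "opn e Q M2" "opn e R M3"
      and d: "?A P M1 \<inter> fns M2 = {}" "?A Q M2 \<inter> fns M1 = {}"
      "(fns M1 \<union> fns M2 - (e ` fn P \<union> e ` fn Q)) \<inter> fns M3 = {}" "?A R M3 \<inter> (fns M1 \<union> fns M2) = {}"
      by (auto simp: image_Un)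
    note d' = iffD1[OF disjoint_assoc[OF M(2-4)[THEN opn_fn]] conjI[OF d(1) conjI[OF d(2) conjI[OF d(3,4)]]]]
    have "opn e (Par Q R) (M2 + M3)" unfolding opn.simps using M(3,4) d' by blast
    then show "opn e (Par P (Par Q R)) M"
      unfolding opn.simps(4)[of e P] M(1) fn.simps image_Un
      by (intro exI[of _ M1] exI[of _ "M2 + M3"]) (use M(2) d' in \<open>simp add: add.assoc\<close>)
  next
    assume "opn e (Par P (Par Q R)) M"
    then obtain M1 M2 M3 where M: "M = M1 + (M2 + M3)" "opn e P M1" "opn e Q M2" "opn e R M3"
      and d: "?A Q M2 \<inter> fns M3 = {}" "?A R M3 \<inter> fns M2 = {}" "?A P M1 \<inter> (fns M2 \<union> fns M3) = {}"
      "(fns M2 \<union> fns M3 - (e ` fn Q \<union> e ` fn R)) \<inter> fns M1 = {}"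
      by (auto simp: image_Un)
    note d' = iffD2[OF disjoint_assoc[OF M(2-4)[THEN opn_fn]] conjI[OF d(1) conjI[OF d(2) conjI[OF d(3,4)]]]]
    have "opn e (Par P Q) (M1 + M2)" unfolding opn.simps using M(2,3) d' by blast
    then show "opn e (Par (Par P Q) R) M"
      unfolding opn.simps(4)[of e _ R] M(1) fn.simps image_Un
      by (intro exI[of _ "M1 + M2"] exI[of _ M3]) (use M(4) d' in \<open>simp add: add.assoc\<close>)
  qed
  then have "opn e (Par (Par P Q) R) = opn e (Par P (Par Q R))" by blast
  then show ?case using opn_sim_refl by metis
next
  case (par_comm P Q)
  have "opn e (Par P Q) = opn e (Par Q P)" by (auto intro!: ext) (metis add.commute)+
  then show ?case using opn_sim_refl by metis
next
  case (par_unit P)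
  have "opn e (Par P Zero) = opn e P" by (auto intro!: ext)
  then show ?case using opn_sim_refl by metis
next
  case (res_zero r)
  have "opn e (Res r Zero) = opn e Zero" by (rule opn_Res_unused) simp
  then show ?case using opn_sim_refl by metis
next
  case (res_swap r s P)
  have "opn e (Res r (Res s P)) = opn e (Res s (Res r P))" using opn_Res_swap by blast
  then show ?case using opn_sim_refl by metis
next
  case (res_extrude r P Q)
  have "opn e (Res r (Par P Q)) = opn e (Par P (Res r Q))" using opn_extrude[OF res_extrude] by blast
  then show ?case using opn_sim_refl by metis
qed (auto intro: opn_sim_refl)

text \<open>Opening loses nothing: the opened names are recovered as those names of the components
  that no free name of \<open>P\<close> accounts for.\<close>

lemma opn_sound:
  "opn e P (mset Ps) \<Longrightarrow> subst e P \<cong> nu (fns (mset Ps) - e ` fn P) (par_list Ps)"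
proof (induction P arbitrary: e Ps rule: proc_induct)
  case (Call K as)
  then have "Ps = [Call K (map e as)]" by simp
  then show ?case by (simp add: scong.refl)
next
  case (Sum bs)
  have "fn (subst e (Sum bs)) = e ` fn (Sum bs)" by (rule fn_subst)
  moreover have "Ps = (if bs = [] then [] else [subst e (Sum bs)])"
    using Sum.prems by (simp split: if_splits)
  ultimately show ?case
    by (cases "bs = []", simp add: scong.refl) (auto simp: scong.refl fns_mset simp del: fn_Sum subst_Sum)
next
  case (Res r P)
  then obtain z where z: "z \<notin> e ` (fn P - {r})" "opn (e(r := z)) P (mset Ps)" by auto
  let ?B = "fns (mset Ps) - (e(r := z)) ` fn P"
  have "subst e (Res r P) \<cong> Res z (subst (e(r := z)) P)" using z(1) by (rule subst_Res)
  also have "\<dots> \<cong> Res z (nu ?B (par_list Ps))" using z(2) by (intro scong.cong_res Res.IH)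
  also have "\<dots> \<cong> nu (insert z ?B) (par_list Ps)" by (rule scong.sym[OF nu_insert]) simp
  also have "\<dots> \<cong> nu (fns (mset Ps) - e ` fn (Res r P)) (par_list Ps)"
    by (rule nu_eq) (use z(1) in \<open>auto simp: fns_mset simp del: fn_par_list\<close>)
  finally show ?case .
next
  case (Par P Q)
  then obtain M1 M2 where M: "mset Ps = M1 + M2" "opn e P M1" "opn e Q M2"
    and d: "(fns M1 - e ` fn P) \<inter> fns M2 = {}" "(fns M2 - e ` fn Q) \<inter> fns M1 = {}" by auto
  obtain Us Vs where UV: "mset Us = M1" "mset Vs = M2" by (meson ex_mset)
  let ?A = "fns M1 - e ` fn P" and ?B = "fns M2 - e ` fn Q"
  have "subst e (Par P Q) = Par (subst e P) (subst e Q)" by simp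
  also have "\<dots> \<cong> Par (nu ?A (par_list Us)) (nu ?B (par_list Vs))"
    using Par.IH M(2,3) UV by (auto intro!: scong.cong_par)
  also have "\<dots> \<cong> nu (?A \<union> ?B) (Par (par_list Us) (par_list Vs))"
    using d by (intro nu_par2) (auto simp: fns_mset simp flip: UV simp del: fn_par_list)
  also have "\<dots> \<cong> nu (?A \<union> ?B) (par_list (Us @ Vs))" by (intro nu_cong scong.sym[OF par_list_append])
  also have "\<dots> \<cong> nu (?A \<union> ?B) (par_list Ps)" by (intro nu_cong par_list_perm) (simp add: UV M)
  also have "\<dots> \<cong> nu (fns (mset Ps) - e ` fn (Par P Q)) (par_list Ps)"
    using d opn_fn[OF M(2)] opn_fn[OF M(3)]
    by (intro nu_eq) (auto simp: M(1) image_Un)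
  finally show ?case .
qed

subsection \<open>Inversion of reactions\<close>

text \<open>The axioms of \<open>react\<close> alone; its context and structural rules are absorbed
  by the passage to multisets of components.\<close>

inductive red :: "equation list \<Rightarrow> proc multiset \<Rightarrow> proc multiset \<Rightarrow> bool" for E where
  tau: "(Tau, S) \<in> set bs \<Longrightarrow> red E (add_mset (Sum bs) M) (add_mset S M)"
| call: "(K, fs, S) \<in> set E \<Longrightarrow> length as = length fs \<Longrightarrow>
    red E (add_mset (Call K as) M) (add_mset (subst_map (map_of (zip fs as)) S) M)"
| comm: "(Recv x y, S\<^sub>1) \<in> set bs \<Longrightarrow> (Send x z, S\<^sub>2) \<in> set cs \<Longrightarrow>
    red E (add_mset (Sum bs) (add_mset (Sum cs) M))
      (add_mset (rename1 S\<^sub>1 z y) (add_mset S\<^sub>2 M))"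

lemma red_plus: "red E M M' \<Longrightarrow> red E (M + N) (M' + N)"
  by (induction rule: red.induct) (auto intro: red.intros)

lemma Sum_branch_fn: "(\<pi>, S) \<in> set bs \<Longrightarrow> prefix_free \<pi> \<union> (fn S - prefix_bound \<pi>) \<subseteq> fn (Sum bs)"
  by (force simp: branch_fn_def)

lemma fn_call:
  assumes "fn S \<subseteq> set fs" "length as = length fs"
  shows "fn (subst_map (map_of (zip fs as)) S) \<subseteq> set as"
proof
  fix y assume "y \<in> fn (subst_map (map_of (zip fs as)) S)"
  then obtain x where x: "x \<in> fn S" "y = (case map_of (zip fs as) x of None \<Rightarrow> x | Some a \<Rightarrow> a)"
    by (auto simp: subst_map_def)
  then obtain a where "map_of (zip fs as) x = Some a" using assms
    by (metis map_of_zip_is_Some subsetD)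
  with x show "y \<in> set as" by (auto dest: map_of_SomeD set_zip_rightD)
qed

lemma fn_rename1: "fn (rename1 P z y) \<subseteq> insert z (fn P - {y})"
  by auto

lemma red_fns:
  assumes "\<And>K fs S. (K, fs, S) \<in> set E \<Longrightarrow> fn S \<subseteq> set fs" "red E M M'"
  shows "fns M' \<subseteq> fns M"
  using assms(2)
proof cases
  case (tau S bs N)
  then show ?thesis using Sum_branch_fn[of Tau S bs] by auto
next
  case (call K fs S as N)
  then show ?thesis using fn_call[OF assms(1)[OF call(3)] call(4)] by auto
next
  case (comm x y S1 bs z S2 cs N)
  then show ?thesis using Sum_branch_fn[of _ S1 bs] Sum_branch_fn[of _ S2 cs] fn_rename1[of y z S1]
    by (fastforce simp del: fn_Sum fn_subst)
qed

lemma branch_eq_Tau: "branch_eq (Tau, S) c \<Longrightarrow> \<exists>T. c = (Tau, T) \<and> S \<cong> T"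
  and branch_eq_Send: "branch_eq (Send a b, S) c \<Longrightarrow> \<exists>T. c = (Send a b, T) \<and> S \<cong> T"
  and branch_eq_Recv: "branch_eq (Recv a x, S) c \<Longrightarrow>
    \<exists>y T. c = (Recv a y, T) \<and> (\<forall>z. rename1 S z x \<cong> rename1 T z y)"
  by (cases c; cases "fst c"; auto)+

lemma guard_eq_Sum:
  assumes "guard_eq (Sum bs) Q" "b \<in> set bs"
  obtains cs c where "Q = Sum cs" "c \<in> set cs" "branch_eq b c"
proof (cases Q)
  case (Sum cs)
  with assms have *: "list_all2 branch_eq bs cs" by simp
  from assms(2) obtain i where i: "i < length bs" "b = bs ! i" by (auto simp: in_set_conv_nth)
  with * have "branch_eq b (cs ! i)" "cs ! i \<in> set cs" by (auto simp: list_all2_conv_all_nth)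
  with Sum that show ?thesis by blast
qed (use assms in auto)

lemma guard_eq_Call: "guard_eq (Call K as) Q \<Longrightarrow> Q = Call K as"
  by (cases Q) auto

lemma mset_eq_scong: "mset_eq M N \<Longrightarrow> rel_mset (\<cong>) M N"
  by (erule multiset.rel_mono_strong) (rule guard_eq_scong)

text \<open>A step exposes continuations, which need not be guarded and are related only by
  \<open>\<cong>\<close>; so \<open>mset_eq\<close> cannot be kept in the conclusion.\<close>

lemma red_mset_eq:
  assumes "red E M M'" "mset_eq M N"
  shows "\<exists>N'. red E N N' \<and> rel_mset (\<cong>) M' N'"
  using assms(1)
proof cases
  case (tau S bs M0)
  with assms(2) obtain Q N0 where N: "N = add_mset Q N0" "guard_eq (Sum bs) Q" "mset_eq M0 N0"
    using msed_rel_invL by metis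
  with tau obtain cs T where Q: "Q = Sum cs" "(Tau, T) \<in> set cs" "S \<cong> T"
    by (metis branch_eq_Tau guard_eq_Sum)
  then have "red E N (add_mset T N0)" using N by (auto intro: red.tau)
  moreover have "rel_mset (\<cong>) M' (add_mset T N0)"
    unfolding tau using Q(3) mset_eq_scong[OF N(3)] by (rule rel_mset_Plus[of "(\<cong>)", OF _ _])
  ultimately show ?thesis by blast
next
  case (call K fs S as M0)
  with assms(2) obtain Q N0 where N: "N = add_mset Q N0" "guard_eq (Call K as) Q" "mset_eq M0 N0"
    using msed_rel_invL by metis
  then have "red E N (add_mset (subst_map (map_of (zip fs as)) S) N0)"
    using call guard_eq_Call by (auto intro: red.call)
  moreover have "rel_mset (\<cong>) M' (add_mset (subst_map (map_of (zip fs as)) S) N0)"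
    unfolding call using scong.refl mset_eq_scong[OF N(3)] by (rule rel_mset_Plus)
  ultimately show ?thesis by blast
next
  case (comm x y S1 bs z S2 cs M0)
  with assms(2) obtain Q N1 where N1: "N = add_mset Q N1" "guard_eq (Sum bs) Q"
    "mset_eq (add_mset (Sum cs) M0) N1" using msed_rel_invL by metis
  then obtain Q' N0 where N0: "N1 = add_mset Q' N0" "guard_eq (Sum cs) Q'" "mset_eq M0 N0"
    using msed_rel_invL by metis
  from N1(2) comm obtain bs' y' T1 where Q: "Q = Sum bs'" "(Recv x y', T1) \<in> set bs'"
    "rename1 S1 z y \<cong> rename1 T1 z y'" by (metis branch_eq_Recv guard_eq_Sum)
  from N0(2) comm obtain cs' T2 where Q': "Q' = Sum cs'" "(Send x z, T2) \<in> set cs'"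
    "S2 \<cong> T2" by (metis branch_eq_Send guard_eq_Sum)
  have "red E N (add_mset (rename1 T1 z y') (add_mset T2 N0))"
    unfolding N1 N0 Q Q' using Q(2) Q'(2) by (rule red.comm)
  moreover have "rel_mset (\<cong>) M' (add_mset (rename1 T1 z y') (add_mset T2 N0))"
    unfolding comm by (intro rel_mset_Plus Q Q' mset_eq_scong N0)
  ultimately show ?thesis by blast
qed

context
  fixes E :: "equation list"
  assumes closed: "\<And>K fs S. (K, fs, S) \<in> set E \<Longrightarrow> fn S \<subseteq> set fs"
begin

lemma react_fn: "react E P Q \<Longrightarrow> fn Q \<subseteq> fn P"
proof (induction rule: react.induct)
  case (tau S bs)
  then show ?case using Sum_branch_fn[of Tau S bs] by simp
next
  case (call K fs S as)
  then show ?case using fn_call[OF closed] by fastforce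
next
  case (comm x y S1 bs z S2 cs)
  then show ?case using Sum_branch_fn[of _ S1 bs] Sum_branch_fn[of _ S2 cs] fn_rename1[of y z S1]
    by (fastforce simp del: fn_Sum fn_subst)
next
  case (struct P P' Q' Q)
  then show ?case using scong_fn by metis
qed auto

lemma subst_call:
  assumes "fn S \<subseteq> set fs" "length as = length fs"
  shows "subst e (subst_map (map_of (zip fs as)) S) \<cong> subst_map (map_of (zip fs (map e as))) S"
proof -
  have "subst (e \<circ> (\<lambda>x. case map_of (zip fs as) x of None \<Rightarrow> x | Some a \<Rightarrow> a)) S
     = subst (\<lambda>x. case map_of (zip fs (map e as)) x of None \<Rightarrow> x | Some a \<Rightarrow> a) S"
  proof (rule subst_cong)
    fix x assume "x \<in> fn S"
    then obtain a where "map_of (zip fs as) x = Some a" using assms by (metis map_of_zip_is_Some subsetD)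
    moreover have "map_of (zip fs (map e as)) x = map_option e (map_of (zip fs as) x)"
      using assms(2)[symmetric] by (induction fs as rule: list_induct2) auto
    ultimately show "(e \<circ> (\<lambda>x. case map_of (zip fs as) x of None \<Rightarrow> x | Some a \<Rightarrow> a)) x
      = (case map_of (zip fs (map e as)) x of None \<Rightarrow> x | Some a \<Rightarrow> a)" by simp
  qed
  then show ?thesis unfolding subst_map_def using subst_comp by metis
qed

lemma react_opn:
  "react E P Q \<Longrightarrow> opn e P M \<Longrightarrow>
   \<exists>M'. red E M M' \<and> (\<forall>Ps. mset Ps = M' \<longrightarrow> subst e Q \<cong> nu (fns M - e ` fn P) (par_list Ps))"
proof (induction arbitrary: e M rule: react.induct)
  case (tau S bs)
  then have M: "M = {#subst e (Sum bs)#}" by auto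
  then have "fns M = e ` fn (Sum bs)" by (simp only: fns_simps fn_subst) simp
  moreover have "(Tau, subst e S) \<in> set (map (subst_branch e) bs)"
    using tau(1) by (metis imageI list.set_map subst_branch.simps(1))
  then have "red E M {#subst e S#}" using red.tau[of "subst e S" _ E "{#}"] by (simp add: M)
  ultimately show ?case by (intro exI[of _ "{#subst e S#}"]) (auto intro: scong.refl)
next
  case (call K fs S as)
  let ?S = "subst_map (map_of (zip fs (map e as))) S"
  have M: "M = {#Call K (map e as)#}" using call by simp
  then have "red E M {#?S#}" using red.call[OF call(1), of "map e as" "{#}"] call(2) by simp
  moreover have "subst e (subst_map (map_of (zip fs as)) S) \<cong> ?S"
    using closed[OF call(1)] call(2) by (rule subst_call)
  ultimately show ?case by (intro exI[of _ "{#?S#}"]) (auto simp: M)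
next
  case (comm x y S1 bs z S2 cs)
  then have ne: "bs \<noteq> []" "cs \<noteq> []" by auto
  have M: "M = {#subst e (Sum bs), subst e (Sum cs)#}" using comm(3) ne by (auto simp del: subst_Sum)
  have fM: "fns M - e ` fn (Par (Sum bs) (Sum cs)) = {}"
    unfolding M fns_simps fn_subst by (auto simp: image_Un simp del: fn_Sum)
  let ?y = "refresh y (e ` (fn S1 - {y}))"
  let ?S1 = "subst (e(y := ?y)) S1"
  have "(Recv (e x) ?y, ?S1) \<in> set (map (subst_branch e) bs)"
    using comm(1) by (metis imageI list.set_map subst_branch.simps(3))
  moreover have "(Send (e x) (e z), subst e S2) \<in> set (map (subst_branch e) cs)"
    using comm(2) by (metis imageI list.set_map subst_branch.simps(2))
  ultimately have "red E M {#rename1 ?S1 (e z) ?y, subst e S2#}"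
    unfolding M subst_Sum using red.comm[where M = "{#}"] by blast
  moreover have "subst e (Par (rename1 S1 z y) S2) \<cong> Par (rename1 ?S1 (e z) ?y) (subst e S2)"
  proof -
    have "subst e (rename1 S1 z y) \<cong> subst (e \<circ> id(y := z)) S1" by (rule subst_comp)
    also have "e \<circ> id(y := z) = e(y := e z)" by auto
    also have "subst (e(y := e z)) S1 \<cong> rename1 ?S1 (e z) ?y"
      by (rule scong.sym[OF rename_subst]) (rule refresh_notin)
    finally show ?thesis unfolding subst.simps by (rule scong.cong_par) (rule scong.refl)
  qed
  moreover have "Par (rename1 ?S1 (e z) ?y) (subst e S2) \<cong> par_list Ps"
    if "mset Ps = {#rename1 ?S1 (e z) ?y, subst e S2#}" for Ps
    using par_list_perm[of "[rename1 ?S1 (e z) ?y, subst e S2]" Ps] that by (simp del: fun_upd_apply)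
  ultimately show ?case unfolding fM nu_empty using scong.trans by meson
next
  case (par P P' Q)
  then obtain M1 M2 where M: "M = M1 + M2" "opn e P M1" "opn e Q M2"
    and d: "(fns M1 - e ` fn P) \<inter> fns M2 = {}" "(fns M2 - e ` fn Q) \<inter> fns M1 = {}" by auto
  obtain M1' where M1': "red E M1 M1'"
    "\<And>Ps. mset Ps = M1' \<Longrightarrow> subst e P' \<cong> nu (fns M1 - e ` fn P) (par_list Ps)"
    using par.IH[OF M(2)] by blast
  obtain Us Vs where UV: "mset Us = M1'" "mset Vs = M2" by (meson ex_mset)
  \<comment> \<open>Keeps the reduct disjoint from the names opened on the other side, so that the
    two blocks of restrictions may be merged again.\<close>
  have fM1': "fns M1' \<subseteq> fns M1" using red_fns[OF _ M1'(1)] closed by blast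
  let ?A = "fns M1 - e ` fn P" and ?B = "fns M2 - e ` fn Q"
  have "subst e (Par P' Q) \<cong> nu (fns M - e ` fn (Par P Q)) (par_list Ps)" if "mset Ps = M1' + M2" for Ps
  proof -
    have "subst e (Par P' Q) = Par (subst e P') (subst e Q)" by simp
    also have "\<dots> \<cong> Par (nu ?A (par_list Us)) (nu ?B (par_list Vs))"
      using M1'(2)[OF UV(1)] opn_sound[of e Q Vs] M(3) UV(2) by (auto intro!: scong.cong_par)
    also have "\<dots> \<cong> nu (?A \<union> ?B) (Par (par_list Us) (par_list Vs))"
      using d fM1' by (intro nu_par2) (auto simp: fns_mset simp flip: UV simp del: fn_par_list)
    also have "\<dots> \<cong> nu (?A \<union> ?B) (par_list (Us @ Vs))" by (intro nu_cong scong.sym[OF par_list_append])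
    also have "\<dots> \<cong> nu (?A \<union> ?B) (par_list Ps)" by (intro nu_cong par_list_perm) (simp add: UV that)
    also have "\<dots> \<cong> nu (fns M - e ` fn (Par P Q)) (par_list Ps)"
      using d opn_fn[OF M(2)] opn_fn[OF M(3)]
      by (intro nu_eq) (auto simp: M(1) image_Un)
    finally show ?thesis .
  qed
  moreover have "red E M (M1' + M2)" unfolding M using M1'(1) by (rule red_plus)
  ultimately show ?case by blast
next
  case (res P P' r)
  then obtain z where z: "z \<notin> e ` (fn P - {r})" "opn (e(r := z)) P M" by auto
  let ?B = "fns M - (e(r := z)) ` fn P"
  obtain M' where M': "red E M M'"
    "\<And>Ps. mset Ps = M' \<Longrightarrow> subst (e(r := z)) P' \<cong> nu ?B (par_list Ps)"
    using res.IH[OF z(2)] by blast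
  have "subst e (Res r P') \<cong> nu (fns M - e ` fn (Res r P)) (par_list Ps)" if Ps: "mset Ps = M'" for Ps
  proof -
    have fM: "fn (par_list Ps) \<subseteq> fns M" using red_fns[OF _ M'(1)] closed Ps fns_mset by metis
    have "subst e (Res r P') \<cong> Res z (subst (e(r := z)) P')"
      using z(1) react_fn[OF res.hyps] by (intro subst_Res) auto
    also have "\<dots> \<cong> Res z (nu ?B (par_list Ps))" by (intro scong.cong_res M' Ps)
    also have "\<dots> \<cong> nu (insert z ?B) (par_list Ps)" by (rule scong.sym[OF nu_insert]) simp
    also have "\<dots> \<cong> nu (fns M - e ` fn (Res r P)) (par_list Ps)"
      by (rule nu_eq) (use z(1) fM in \<open>auto simp del: fn_par_list\<close>)
    finally show ?thesis .
  qed
  with M'(1) show ?case by blast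
next
  case (struct P P' Q' Q)
  \<comment> \<open>The only use of invariance under \<open>\<cong>\<close>: the opening is carried
    to the other representative, reacts there, and the reaction is brought back along
    \<open>mset_eq\<close>.\<close>
  from scong_opn_sim[OF struct.hyps(1), of e] struct.prems obtain N where N: "opn e P' N" "mset_eq M N"
    unfolding opn_sim_def by blast
  obtain N' where N': "red E N N'"
    "\<And>Ps. mset Ps = N' \<Longrightarrow> subst e Q' \<cong> nu (fns N - e ` fn P') (par_list Ps)"
    using struct.IH[OF N(1)] by blast
  obtain M' where M': "red E M M'" "rel_mset (\<cong>) N' M'"
    using red_mset_eq[OF N'(1) mset_eq_sym[OF N(2)]] by blast
  have "subst e Q \<cong> nu (fns M - e ` fn P) (par_list Ps)" if Ps: "mset Ps = M'" for Ps
  proof -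
    obtain Us where Us: "mset Us = N'" by (meson ex_mset)
    have "subst e Q \<cong> subst e Q'" using scong_subst[OF struct.hyps(3)] by (rule scong.sym)
    also have "\<dots> \<cong> nu (fns N - e ` fn P') (par_list Us)" using Us by (rule N'(2))
    also have "\<dots> \<cong> nu (fns N - e ` fn P') (par_list Ps)"
      by (intro nu_cong par_list_rel_mset) (simp add: Us Ps M')
    also have "fns N - e ` fn P' = fns M - e ` fn P"
      using mset_eq_fns[OF N(2)] scong_fn[OF struct.hyps(1)] by simp
    finally show ?thesis .
  qed
  with M'(1) show ?case by blast
qed

lemma opn_par_list:
  assumes "\<And>P. P \<in> set Ps \<Longrightarrow> is_call P \<or> is_choice P"
  shows "opn id (par_list Ps) (mset Ps)"
proof -
  have single: "opn id P {#P#}" if "is_call P \<or> is_choice P" for P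
    using that subst_id[of P] by (cases P) (auto simp del: subst_Sum)
  show ?thesis using assms
  proof (induction Ps rule: par_list.induct)
    case (3 P Q Ps)
    have "opn id P {#P#}" by (rule single) (simp add: 3)
    moreover have "opn id (par_list (Q # Ps)) (mset (Q # Ps))" by (rule 3) (simp add: 3)
    moreover have "fns (mset (Q # Ps)) - id ` fn (par_list (Q # Ps)) = {}"
      by (simp only: fns_mset image_id) simp
    ultimately show ?case
      unfolding par_list.simps opn.simps by (intro exI[of _ "{#P#}"] exI[of _ "mset (Q # Ps)"]) auto
  qed (use single in auto)
qed

text \<open>Each restricted name may be chosen to stand for itself, as its binder removes it from
  the names to be avoided.\<close>

lemma opn_res_list: "opn id P M \<Longrightarrow> opn id (res_list rs P) M"
proof (induction rs)
  case (Cons r rs)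
  have "id(r := r) = id" by auto
  with Cons have "opn (id(r := r)) (res_list rs P) M" by metis
  moreover have "r \<notin> id ` (fn (res_list rs P) - {r})" by simp
  ultimately show ?case unfolding res_list_simps opn.simps by blast
qed simp

text \<open>With the identity renaming the given list of guarded threads is itself an opening, so
  the redex consists of listed threads.\<close>

theorem react_nu_par_list:
  assumes "react E G G'" "G \<cong> nu A (par_list Ps)" "finite A"
    and "\<And>P. P \<in> set Ps \<Longrightarrow> is_call P \<or> is_choice P"
  shows "\<exists>M'. red E (mset Ps) M' \<and> (\<forall>Qs. mset Qs = M' \<longrightarrow> G' \<cong> nu A (par_list Qs))"
proof -
  let ?P = "nu A (par_list Ps)"
  have "react E ?P G'" using assms(1,2) by (meson react.struct scong.refl scong.sym)
  moreover have "opn id ?P (mset Ps)"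
    unfolding nu_def by (intro opn_res_list opn_par_list assms(4))
  ultimately obtain M' where M': "red E (mset Ps) M'"
    "\<And>Qs. mset Qs = M' \<Longrightarrow> subst id G' \<cong> nu (fns (mset Ps) - id ` fn ?P) (par_list Qs)"
    using react_opn by blast
  have "G' \<cong> nu A (par_list Qs)" if Qs: "mset Qs = M'" for Qs
  proof -
    have "fn (par_list Qs) \<subseteq> fns (mset Ps)" using red_fns[OF _ M'(1)] closed Qs fns_mset by metis
    then have "nu (fns (mset Ps) - id ` fn ?P) (par_list Qs) \<cong> nu A (par_list Qs)"
      using assms(3) by (intro nu_eq) (auto simp: fns_mset simp del: fn_par_list)
    with M'(2)[OF Qs] show ?thesis unfolding subst_id by (rule scong.trans)
  qed
  with M'(1) show ?thesis by blast
qed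

end

subsection \<open>Names of a specification\<close>

definition bset :: "proc \<Rightarrow> name set" where
  "bset S = set (res_binders S) \<union> set (inp_binders S)"

lemma bset_simps [simp]:
  "bset (Call K xs) = {}" "bset (Res r S) = insert r (bset S)"
  by (auto simp: bset_def)

lemma inp_binders_Sum:
  "set (inp_binders (Sum bs)) = (\<Union>(\<pi>, S)\<in>set bs. prefix_bound \<pi> \<union> set (inp_binders S))"
proof -
  have "set ((case \<pi> of Recv a x \<Rightarrow> [x] | _ \<Rightarrow> []) @ inp_binders S) = prefix_bound \<pi> \<union> set (inp_binders S)"
    for \<pi> S by (cases \<pi>) auto
  then show ?thesis by (auto simp del: set_append)
qed

lemma bset_Sum: "bset (Sum bs) = (\<Union>(\<pi>, S)\<in>set bs. prefix_bound \<pi> \<union> bset S)"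
  unfolding bset_def inp_binders_Sum by auto

declare inp_binders.simps(2) [simp del]

text \<open>Different branches are not compared: a run takes only one of them, and it is along a run
  that no name may be bound twice.\<close>

fun no_rebind :: "proc \<Rightarrow> bool" where
  "no_rebind (Call K xs) = True"
| "no_rebind (Sum bs) = (\<forall>(\<pi>, S)\<in>set bs. prefix_bound \<pi> \<inter> bset S = {} \<and> no_rebind S)"
| "no_rebind (Res r S) = (r \<notin> bset S \<and> no_rebind S)"
| "no_rebind (Par P Q) = (no_rebind P \<and> no_rebind Q)"

lemma no_rebindI:
  "distinct (res_binders S @ inp_binders S) \<Longrightarrow> no_rebind S"
proof (induction S rule: proc_induct)
  case (Sum bs)
  have "prefix_bound \<pi> \<inter> bset S = {} \<and> no_rebind S" if b: "(\<pi>, S) \<in> set bs" for \<pi> S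
  proof
    have d: "distinct (res_binders S)"
      using Sum.prems b by (auto simp: distinct_concat_iff)
    have "distinct ((case \<pi> of Recv a x \<Rightarrow> [x] | _ \<Rightarrow> []) @ inp_binders S)"
      using Sum.prems b unfolding inp_binders.simps distinct_append distinct_concat_iff by fastforce
    then have i: "distinct (inp_binders S)" "prefix_bound \<pi> \<inter> set (inp_binders S) = {}"
      by (cases \<pi>; auto)+
    have di: "set (res_binders (Sum bs)) \<inter> set (inp_binders (Sum bs)) = {}" using Sum.prems by auto
    have sub: "set (res_binders S) \<subseteq> set (res_binders (Sum bs))"
      "prefix_bound \<pi> \<union> set (inp_binders S) \<subseteq> set (inp_binders (Sum bs))"
      using b unfolding inp_binders_Sum by auto
    show "prefix_bound \<pi> \<inter> bset S = {}" unfolding bset_def using i(2) di sub by blast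
    have "set (res_binders S) \<inter> set (inp_binders S) = {}" using di sub by blast
    then show "no_rebind S" using Sum.IH[OF b] d i(1) by simp
  qed
  then show ?case by auto
next
  case (Res r P)
  then show ?case by (auto simp: bset_def)
qed auto

definition wf_proc :: "proc \<Rightarrow> bool" where
  "wf_proc S \<longleftrightarrow> fn S \<inter> bset S = {} \<and> no_rebind S \<and> thread S \<and> zero_free S \<and> binders_used S"

lemma fn_branch: "(\<pi>, S) \<in> set bs \<Longrightarrow> fn S \<subseteq> fn (Sum bs) \<union> prefix_bound \<pi>"
  using Sum_branch_fn by blast

lemma wf_proc_branch:
  assumes "wf_proc (Sum bs)" and b: "(\<pi>, S) \<in> set bs"
  shows "wf_proc S"
proof -
  have "prefix_bound \<pi> \<inter> bset S = {}" using assms by (auto simp: wf_proc_def)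
  moreover have "bset S \<subseteq> bset (Sum bs)" using b by (auto simp: bset_Sum)
  ultimately have "fn S \<inter> bset S = {}" using assms(1) fn_branch[OF b] unfolding wf_proc_def by blast
  then show ?thesis using assms by (auto simp: wf_proc_def)
qed

lemma wf_proc_Res: "wf_proc (Res r S) \<Longrightarrow> wf_proc S"
  by (auto simp: wf_proc_def)

lemma distinct_concat_map_disjoint:
  assumes "distinct (concat (map g xs))" "distinct xs" "x \<in> set xs" "y \<in> set xs" "x \<noteq> y"
  shows "set (g x) \<inter> set (g y) = {}"
  using assms by (induction xs) auto

locale fcp_spec =
  fixes F :: fcp and NEW :: "name set"
  assumes nf: "normal_form F" and nn: "new_names F NEW"
begin

definition idents :: "ident set" where
  "idents = fst ` set (eqs F)"

definition formals :: "ident \<Rightarrow> name list" where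
  "formals K = fst (the (map_of (eqs F) K))"

definition body :: "ident \<Rightarrow> proc" where
  "body K = snd (the (map_of (eqs F) K))"

lemma distinct_eqs: "distinct (map fst (eqs F))"
  using nf by (simp add: normal_form_def)

lemma eqsD:
  assumes "(K, fs, S) \<in> set (eqs F)"
  shows "K \<in> idents" "formals K = fs" "body K = S"
proof -
  have "map_of (eqs F) K = Some (fs, S)" using assms distinct_eqs by simp
  then show "formals K = fs" "body K = S" by (auto simp: formals_def body_def)
  show "K \<in> idents" using assms by (force simp: idents_def)
qed

lemma eqsI: "K \<in> idents \<Longrightarrow> (K, formals K, body K) \<in> set (eqs F)"
  using eqsD unfolding idents_def by force

lemma eqs_nf:
  assumes "K \<in> idents"
  shows "thread (body K)" "fn (body K) = set (formals K)" "zero_free (body K)"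
    "binders_used (body K)" "\<And>m. (K, m) \<notin> calls (body K)"
    "\<And>K' m. (K', m) \<in> calls (body K) \<Longrightarrow> K' \<in> idents \<and> length (formals K') = m"
proof -
  have "\<forall>(K, fs, S) \<in> set (eqs F).
        thread S \<and> fn S = set fs \<and> zero_free S \<and> binders_used S \<and>
        K \<notin> fst ` calls S \<and>
        (\<forall>(K', m) \<in> calls S. \<exists>fs' S'. (K', fs', S') \<in> set (eqs F) \<and> length fs' = m)"
    using nf by (simp add: normal_form_def)
  with eqsI[OF assms] have *: "thread (body K) \<and> fn (body K) = set (formals K) \<and> zero_free (body K) \<and>
      binders_used (body K) \<and> K \<notin> fst ` calls (body K) \<and>
      (\<forall>(K', m) \<in> calls (body K). \<exists>fs' S'. (K', fs', S') \<in> set (eqs F) \<and> length fs' = m)" by fast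
  then show "thread (body K)" "fn (body K) = set (formals K)" "zero_free (body K)"
    "binders_used (body K)" by auto
  show "(K, m) \<notin> calls (body K)" for m using * by (metis fst_conv imageI)
  show "K' \<in> idents \<and> length (formals K') = m" if "(K', m) \<in> calls (body K)" for K' m
    using * that eqsD by fast
qed

definition names :: "ident \<Rightarrow> name set" where
  "names K = set (formals K) \<union> bset (body K)"

lemma distinct_binders:
  "distinct (restr_binders F)" "distinct (input_binders F)" "distinct (formal_binders F)"
  "RESTR F \<inter> INP F = {}" "RESTR F \<inter> FRM F = {}" "INP F \<inter> FRM F = {}"
  using nf by (auto simp: normal_form_def)

lemma class_subset:
  assumes "K \<in> idents"
  shows "set (formals K) \<subseteq> FRM F" "set (res_binders (body K)) \<subseteq> RESTR F"
    "set (inp_binders (body K)) \<subseteq> INP F"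
  using eqsI[OF assms]
  by (fastforce simp: formal_binders_def restr_binders_def input_binders_def)+

lemma class_disjoint:
  assumes "K \<in> idents" "K' \<in> idents" "K \<noteq> K'"
  shows "set (formals K) \<inter> set (formals K') = {}"
    "set (res_binders (body K)) \<inter> set (res_binders (body K')) = {}"
    "set (inp_binders (body K)) \<inter> set (inp_binders (body K')) = {}"
proof -
  have d: "distinct (eqs F)" using distinct_eqs by (simp add: distinct_map)
  show "set (formals K) \<inter> set (formals K') = {}"
    using distinct_concat_map_disjoint[OF distinct_binders(3)[unfolded formal_binders_def] d
        eqsI[OF assms(1)] eqsI[OF assms(2)]] assms(3) by simp
  have "distinct (concat (map (\<lambda>(K, fs, S). res_binders S) (eqs F)))"
    using distinct_binders(1) by (simp add: restr_binders_def)
  from distinct_concat_map_disjoint[OF this d eqsI[OF assms(1)] eqsI[OF assms(2)]] assms(3)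
  show "set (res_binders (body K)) \<inter> set (res_binders (body K')) = {}" by simp
  show "set (inp_binders (body K)) \<inter> set (inp_binders (body K')) = {}"
    using distinct_concat_map_disjoint[OF distinct_binders(2)[unfolded input_binders_def] d
        eqsI[OF assms(1)] eqsI[OF assms(2)]] assms(3) by simp
qed

text \<open>Within each of the three kinds of binder the bodies share nothing because binders are
  distinct, and the kinds themselves do not overlap.\<close>

lemma names_disjoint:
  assumes "K \<in> idents" "K' \<in> idents" "K \<noteq> K'"
  shows "names K \<inter> names K' = {}"
  using class_disjoint[OF assms] class_subset[OF assms(1)] class_subset[OF assms(2)]
    distinct_binders(4-6)
  unfolding names_def bset_def by blast

lemma distinct_formals: "K \<in> idents \<Longrightarrow> distinct (formals K)"
  using distinct_binders(3) eqsI unfolding formal_binders_def distinct_concat_iff by fastforce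

lemma wf_body:
  assumes "K \<in> idents" shows "wf_proc (body K)"
proof -
  have "distinct (concat (map (\<lambda>(K, fs, S). res_binders S) (eqs F)))"
    using distinct_binders(1) by (simp add: restr_binders_def)
  then have "distinct (res_binders (body K))"
    using eqsI[OF assms] by (fastforce simp: distinct_concat_iff)
  moreover have "distinct (inp_binders (body K))"
    using distinct_binders(2) eqsI[OF assms] unfolding input_binders_def distinct_concat_iff by fastforce
  moreover have "set (res_binders (body K)) \<inter> set (inp_binders (body K)) = {}"
    using class_subset[OF assms] distinct_binders(4) by blast
  ultimately have "no_rebind (body K)" by (intro no_rebindI) simp
  moreover have "fn (body K) \<inter> bset (body K) = {}"
    using class_subset[OF assms] distinct_binders(4-6) eqs_nf(2)[OF assms] unfolding bset_def by blast
  ultimately show ?thesis using eqs_nf[OF assms] by (simp add: wf_proc_def)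
qed

subsection \<open>Places of the control flow nets\<close>

text \<open>The thread is working off the body of \<open>K\<close>. Names in \<open>l\<close> keep
  their values although \<open>S\<close> no longer mentions them; a later binder of \<open>S\<close>
  must not meet such an old value, hence the disjointness from \<open>bset S\<close>.\<close>

definition fresh_ok :: "ident \<Rightarrow> proc \<Rightarrow> name list \<Rightarrow> bool" where
  "fresh_ok K S l \<longleftrightarrow> K \<in> idents \<and> distinct l \<and> fn S \<union> set l \<subseteq> names K \<and> wf_proc S \<and>
     set l \<inter> (fn S \<union> bset S) = {} \<and>
     set (res_binders S) \<subseteq> set (res_binders (body K)) \<and>
     set (inp_binders S) \<subseteq> set (inp_binders (body K)) \<and>
     calls S \<subseteq> calls (body K) \<and> derived F NEW (S, l)"

text \<open>\<open>K\<close> is the caller and \<open>K'\<close> the callee. If at least one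
  argument exists and all are present, passing has not begun, which yields \<open>derived\<close>.
  For a callee without parameters the number of arguments cannot tell.\<close>

definition call_ok :: "ident \<Rightarrow> ident \<Rightarrow> name list \<Rightarrow> name list \<Rightarrow> bool" where
  "call_ok K K' xs l \<longleftrightarrow> K \<in> idents \<and> distinct l \<and> set xs \<union> set l \<subseteq> names K \<and>
     (\<exists>m. (K', m) \<in> calls (body K)) \<and> length xs \<le> length (formals K') \<and>
     (xs \<noteq> [] \<and> length xs = length (formals K') \<longrightarrow> derived F NEW (Call K' xs, l))"

fun place_ok :: "ident \<Rightarrow> aug \<Rightarrow> bool" where
  "place_ok K (Call K' xs, l) = call_ok K K' xs l"
| "place_ok K (S, l) = fresh_ok K S l"

lemma fresh_ok_place: "fresh_ok K S l \<Longrightarrow> place_ok K (S, l)"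
proof (cases S)
  case (Call K' xs)
  assume "fresh_ok K S l"
  then show ?thesis using eqs_nf(6)[of K K' "length xs"] by (auto simp: Call fresh_ok_def call_ok_def)
qed auto

lemma derived_step:
  "derived F NEW s \<Longrightarrow> (s, s') \<in> cf_step F NEW \<Longrightarrow> \<not> is_call (fst s) \<Longrightarrow> derived F NEW s'"
proof -
  assume "(s, s') \<in> cf_step F NEW" "\<not> is_call (fst s)"
  then have "(s, s') \<in> {(u, v) \<in> cf_step F NEW. \<not> is_call (fst u)}" by simp
  then show "derived F NEW s \<Longrightarrow> derived F NEW s'"
    unfolding derived_def by (fast intro: rtrancl.rtrancl_into_rtrancl)
qed

lemma fresh_ok_body: "K \<in> idents \<Longrightarrow> fresh_ok K (body K) []"
proof -
  assume K: "K \<in> idents"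
  then have "derived F NEW (body K, [])" unfolding derived_def using eqsI by fast
  then show ?thesis using K wf_body[OF K] eqs_nf(2)[OF K]
    unfolding fresh_ok_def names_def by auto
qed

lemma set_dropped [simp]: "set (dropped bs S) = fn (Sum bs) - fn S" "distinct (dropped bs S)"
  unfolding dropped_def by (auto simp del: fn_Sum)

text \<open>Dropped names were free in the choice. Hence they are not yet listed in
  \<open>l\<close>, and the continuation neither uses nor binds them.\<close>

lemma fresh_ok_Sum:
  assumes ok: "fresh_ok K (Sum bs) l" and b: "(\<pi>, S) \<in> set bs"
    and step: "((Sum bs, l), (S, l @ dropped bs S)) \<in> cf_step F NEW"
  shows "fresh_ok K S (l @ dropped bs S)"
proof -
  have "derived F NEW (S, l @ dropped bs S)"
    using ok derived_step[OF _ step] unfolding fresh_ok_def by simp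
  have sub: "set (res_binders S) \<subseteq> set (res_binders (Sum bs))"
    "set (inp_binders S) \<subseteq> set (inp_binders (Sum bs))" "calls S \<subseteq> calls (Sum bs)"
    "bset S \<subseteq> bset (Sum bs)" "prefix_bound \<pi> \<subseteq> bset (Sum bs)"
    using b by (auto simp: inp_binders_Sum bset_Sum)
  have K: "K \<in> idents" "distinct l" "fn (Sum bs) \<union> set l \<subseteq> names K"
    "set l \<inter> (fn (Sum bs) \<union> bset (Sum bs)) = {}" "fn (Sum bs) \<inter> bset (Sum bs) = {}"
    using ok by (simp_all add: fresh_ok_def wf_proc_def del: fn_Sum)
  have bK: "bset (Sum bs) \<subseteq> names K"
    using ok unfolding fresh_ok_def names_def bset_def by blast
  have "wf_proc S" using ok b wf_proc_branch unfolding fresh_ok_def by blast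
  moreover have "distinct (l @ dropped bs S)" using K(2,4) by (auto simp del: fn_Sum)
  moreover have "fn S \<union> set (l @ dropped bs S) \<subseteq> names K"
    using K(3) bK sub(5) fn_branch[OF b] by (auto simp del: fn_Sum)
  moreover have "set (l @ dropped bs S) \<inter> (fn S \<union> bset S) = {}"
    using K(4,5) sub(4,5) fn_branch[OF b] unfolding set_append set_dropped by blast
  moreover have "set (res_binders S) \<subseteq> set (res_binders (body K))"
    "set (inp_binders S) \<subseteq> set (inp_binders (body K))" "calls S \<subseteq> calls (body K)"
    using ok sub(1-3) unfolding fresh_ok_def by blast+
  ultimately show ?thesis
    using \<open>derived F NEW (S, l @ dropped bs S)\<close> K(1) unfolding fresh_ok_def by blast
qed

lemma fresh_ok_Res:
  assumes ok: "fresh_ok K (Res r S) l" and step: "((Res r S, l), (S, l)) \<in> cf_step F NEW"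
  shows "fresh_ok K S l"
proof -
  have "derived F NEW (S, l)"
    using ok derived_step[OF _ step] unfolding fresh_ok_def by simp
  moreover have "r \<in> names K" using ok unfolding fresh_ok_def names_def bset_def by auto
  ultimately show ?thesis using ok wf_proc_Res[of r S] unfolding fresh_ok_def by auto
qed

text \<open>The names that carry a value at the place. Arguments are passed from the last to the
  first, so the formals already set are those from position \<open>length xs\<close> on.\<close>

fun place_dom :: "aug \<Rightarrow> name set" where
  "place_dom (Call K xs, l) = set xs \<union> set l \<union> set (drop (length xs) (formals K))"
| "place_dom (S, l) = fn S \<union> set l"

lemma fresh_dom: "fresh_ok K S l \<Longrightarrow> place_dom (S, l) = fn S \<union> set l"
  using eqs_nf(6)[of K] by (cases S) (auto simp: fresh_ok_def)

definition thread_names :: "nat \<Rightarrow> name set" where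
  "thread_names i = (\<Union>K \<in> thread_idents F i \<inter> idents. names K)"

definition pl_ok :: "nat \<Rightarrow> aug \<Rightarrow> bool" where
  "pl_ok i q \<longleftrightarrow> (\<exists>K \<in> thread_idents F i. place_ok K q)"

lemma thread_names_disjoint:
  assumes "i < n_threads F" "j < n_threads F" "i \<noteq> j"
  shows "thread_names i \<inter> thread_names j = {}"
proof -
  have "thread_idents F i \<inter> thread_idents F j = {}"
    using nf assms by (simp add: normal_form_def)
  then show ?thesis using names_disjoint unfolding thread_names_def by blast
qed

lemma call_ok_facts:
  assumes "call_ok K K' xs l"
  shows "K \<in> idents" "K' \<in> idents" "K' \<noteq> K" "(K, K') \<in> call_graph F"
    "names K \<inter> names K' = {}"
proof -
  from assms obtain m where m: "K \<in> idents" "(K', m) \<in> calls (body K)" by (auto simp: call_ok_def)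
  then show "K \<in> idents" "K' \<in> idents" "K' \<noteq> K" using eqs_nf(5,6)[of K] by auto
  then show "names K \<inter> names K' = {}" using names_disjoint by blast
  show "(K, K') \<in> call_graph F" using m eqsI unfolding call_graph_def by blast
qed

lemma thread_idents_call: "K \<in> thread_idents F i \<Longrightarrow> (K, K') \<in> call_graph F \<Longrightarrow> K' \<in> thread_idents F i"
  unfolding thread_idents_def by (auto intro: rtrancl.rtrancl_into_rtrancl)

lemma place_ok_ident: "place_ok K q \<Longrightarrow> K \<in> idents"
  by (cases "(K, q)" rule: place_ok.cases) (auto simp: fresh_ok_def call_ok_def)

lemma pl_ok_names: "K \<in> thread_idents F i \<Longrightarrow> place_ok K q \<Longrightarrow> names K \<subseteq> thread_names i"
  using place_ok_ident unfolding thread_names_def by blast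

lemma call_ok_names:
  "K \<in> thread_idents F i \<Longrightarrow> call_ok K K' xs l \<Longrightarrow> names K \<union> names K' \<subseteq> thread_names i"
  using call_ok_facts[of K K' xs l] thread_idents_call unfolding thread_names_def by blast

lemma place_dom_names: "pl_ok i q \<Longrightarrow> place_dom q \<subseteq> thread_names i"
proof -
  assume "pl_ok i q"
  then obtain K where K: "K \<in> thread_idents F i" "place_ok K q" by (auto simp: pl_ok_def)
  show ?thesis
  proof (cases "is_call (fst q)")
    case True
    then obtain K' xs l where q: "q = (Call K' xs, l)" by (cases q; cases "fst q") auto
    have "set (drop (length xs) (formals K')) \<subseteq> names K'"
      using set_drop_subset unfolding names_def by fast
    then show ?thesis using K call_ok_names[of K i K' xs l] by (auto simp: q call_ok_def)
  next
    case False
    then have "fresh_ok K (fst q) (snd q)" "place_dom q = fn (fst q) \<union> set (snd q)"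
      using K by (cases q; cases "fst q"; auto)+
    then show ?thesis using pl_ok_names[OF K] unfolding fresh_ok_def by auto
  qed
qed

end

context fcp_spec
begin

subsection \<open>Markings and steps of the net\<close>

text \<open>The complementary places are functions of \<open>\<theta>\<close> too. A substitution
  marking is thus just a partial map, and counting tokens becomes updating that map.\<close>

fun mark_sub :: "(name \<rightharpoonup> name) \<Rightarrow> splace \<Rightarrow> nat" where
  "mark_sub \<theta> (EqP x a) = of_bool (\<theta> x = Some a)"
| "mark_sub \<theta> (NeqP x m) = of_bool (x \<in> INP F \<union> FRM F \<and> m \<in> NEW \<and> \<theta> x \<noteq> Some m)"
| "mark_sub \<theta> (NeqStar m) = of_bool (m \<in> NEW \<and> (\<forall>r\<in>RESTR F. \<theta> r \<noteq> Some m))"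

fun mark :: "(nat \<Rightarrow> aug) \<Rightarrow> (name \<rightharpoonup> name) \<Rightarrow> nplace \<Rightarrow> nat" where
  "mark s \<theta> (Ctl i q) = of_bool (i < n_threads F \<and> q = s i)"
| "mark s \<theta> (Sub p) = mark_sub \<theta> p"

definition subst_ok :: "(name \<rightharpoonup> name) \<Rightarrow> bool" where
  "subst_ok \<theta> \<longleftrightarrow> dom \<theta> \<subseteq> RESTR F \<union> INP F \<union> FRM F \<and> ran \<theta> \<subseteq> PUB F \<union> NEW \<and>
     (\<forall>r\<in>RESTR F. \<forall>a. \<theta> r = Some a \<longrightarrow> a \<in> NEW) \<and>
     (\<forall>r\<in>RESTR F. \<forall>r'\<in>RESTR F. \<forall>a. \<theta> r = Some a \<longrightarrow> \<theta> r' = Some a \<longrightarrow> r = r')"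

text \<open>Both inclusions of the equation with \<open>place_dom\<close> matter: names to be read
  have values, names to be mapped have none. The bound on the domain leaves no value that belongs to
  no thread.\<close>

definition inv :: "(nat \<Rightarrow> aug) \<Rightarrow> (name \<rightharpoonup> name) \<Rightarrow> bool" where
  "inv s \<theta> \<longleftrightarrow>
     (\<forall>i < n_threads F. pl_ok i (s i) \<and> s i \<in> cf_places F NEW i \<and>
        dom \<theta> \<inter> thread_names i = place_dom (s i)) \<and>
     dom \<theta> \<subseteq> (\<Union>i < n_threads F. thread_names i) \<and> subst_ok \<theta>"

text \<open>Local transitions that can fire, with their effect on the substitution. For an
  allocation, \<open>m \<notin> ran \<theta>\<close> sums up the test of \<open>NeqStar\<close> and
  of all places \<open>NeqP\<close>.\<close>

inductive lstep :: "(name \<rightharpoonup> name) \<Rightarrow> aug \<Rightarrow> command set \<Rightarrow> aug \<Rightarrow> (name \<rightharpoonup> name) \<Rightarrow> bool" where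
  nu: "m \<in> NEW \<Longrightarrow> m \<notin> ran \<theta> \<Longrightarrow> lstep \<theta> (Res r S, l) {MapTo r m} (S, l) (\<theta>(r \<mapsto> m))"
| tau: "(Tau, S) \<in> set bs \<Longrightarrow> lstep \<theta> (Sum bs, l) {} (S, l @ dropped bs S) \<theta>"
| call1: "K \<in> idents \<Longrightarrow> length xs < length (formals K) \<Longrightarrow> \<theta> x = Some a \<Longrightarrow>
    lstep \<theta> (Call K (xs @ [x]), l) {Test x a, MapTo (formals K ! length xs) a}
      (Call K xs, if x \<in> set l then l else l @ [x]) (\<theta>(formals K ! length xs \<mapsto> a))"
| call2: "\<theta> x = Some a \<Longrightarrow>
    lstep \<theta> (Call K [], x # l) {Unmap x a} (Call K [], l) (\<theta>(x := None))"
| call3: "K \<in> idents \<Longrightarrow> lstep \<theta> (Call K [], []) {} (body K, []) \<theta>"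

inductive cstep :: "(name \<rightharpoonup> name) \<Rightarrow> name \<Rightarrow> name \<Rightarrow> aug \<Rightarrow> command set \<Rightarrow> aug \<Rightarrow>
    aug \<Rightarrow> command set \<Rightarrow> aug \<Rightarrow> (name \<rightharpoonup> name) \<Rightarrow> bool" where
  "(Send x y, S) \<in> set bs \<Longrightarrow> (Recv x' y', S') \<in> set cs \<Longrightarrow>
   \<theta> x = Some a \<Longrightarrow> \<theta> y = Some b \<Longrightarrow> \<theta> x' = Some a \<Longrightarrow>
   cstep \<theta> a b (Sum bs, l) {Test x a, Test y b} (S, l @ dropped bs S)
     (Sum cs, l') {Test x' a, MapTo y' b} (S', l' @ dropped cs S') (\<theta>(y' \<mapsto> b))"

section \<open>Preservation of the invariant by steps\<close>

lemma subst_okD: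
  assumes "subst_ok \<theta>" "\<theta> x = Some a"
  shows "a \<in> PUB F \<union> NEW" "x \<in> RESTR F \<union> INP F \<union> FRM F" "x \<in> RESTR F \<Longrightarrow> a \<in> NEW"
  using assms by (auto simp: subst_ok_def ran_def)

text \<open>Names that fall out of use move to the list with their values. The only gain is the
  received name, which occurs in \<open>S\<close> because every binder is used.\<close>

lemma Sum_dom:
  assumes ok: "fresh_ok K (Sum bs) l" "fresh_ok K S (l @ dropped bs S)" and b: "(\<pi>, S) \<in> set bs"
  shows "place_dom (S, l @ dropped bs S) = place_dom (Sum bs, l) \<union> prefix_bound \<pi>"
proof -
  have "prefix_bound \<pi> \<subseteq> fn S" using ok(1) b by (auto simp: fresh_ok_def wf_proc_def)
  then show ?thesis
    using fn_branch[OF b] unfolding fresh_dom[OF ok(1)] fresh_dom[OF ok(2)] set_append set_dropped by blast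
qed

lemma cf_stepI: "(q, lab, C, q') \<in> cf_trans F NEW \<Longrightarrow> (q, q') \<in> cf_step F NEW"
  by (auto simp: cf_step_def)

lemma lstep_cf_trans: "lstep \<theta> q C q' \<theta>' \<Longrightarrow> subst_ok \<theta> \<Longrightarrow> (q, LTau, C, q') \<in> cf_trans F NEW"
proof (induction rule: lstep.induct)
  case (nu m \<theta> r S l)
  then show ?case by (intro cf_trans.nu)
next
  case (tau S bs \<theta> l)
  then show ?case by (intro cf_trans.tau)
next
  case (call1 K xs \<theta> x a l)
  then show ?case using eqsI subst_okD(1) by (intro cf_trans.call1) auto
next
  case (call2 \<theta> x a K l)
  then show ?case using subst_okD(1) by (intro cf_trans.call2)
next
  case (call3 K \<theta>)
  then show ?case using eqsI by (intro cf_trans.call3)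
qed

lemma cf_trans_cases:
  assumes "(q, lab, C, q') \<in> cf_trans F NEW"
  obtains (nu) m r S l where "q = (Res r S, l)" "lab = LTau" "C = {MapTo r m}" "q' = (S, l)" "m \<in> NEW"
    | (tau) S bs l where "q = (Sum bs, l)" "lab = LTau" "C = {}" "q' = (S, l @ dropped bs S)"
      "(Tau, S) \<in> set bs"
    | (snd) x y S bs a b l where "q = (Sum bs, l)" "lab = LSend a b" "C = {Test x a, Test y b}"
      "q' = (S, l @ dropped bs S)" "(Send x y, S) \<in> set bs"
    | (rec) x y S bs a b l where "q = (Sum bs, l)" "lab = LRec a b" "C = {Test x a, MapTo y b}"
      "q' = (S, l @ dropped bs S)" "(Recv x y, S) \<in> set bs"
    | (call1) K xs x a l where "q = (Call K (xs @ [x]), l)" "lab = LTau"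
      "C = {Test x a, MapTo (formals K ! length xs) a}" "q' = (Call K xs, if x \<in> set l then l else l @ [x])"
      "K \<in> idents" "length xs < length (formals K)"
    | (call2) K x l a where "q = (Call K [], x # l)" "lab = LTau" "C = {Unmap x a}" "q' = (Call K [], l)"
    | (call3) K where "q = (Call K [], [])" "lab = LTau" "C = {}" "q' = (body K, [])" "K \<in> idents"
proof -
  obtain S l S' l' where q: "q = (S, l)" "q' = (S', l')" by (cases q; cases q')
  from assms show thesis unfolding q
  proof (cases rule: cf_trans.cases)
    case (call1 K fs B xs a x)
    then show ?thesis using that(5)[of K xs x l a] eqsD[of K fs B] q by auto
  next
    case (call3 K fs)
    then show ?thesis using that(7)[of K] eqsD[of K fs S'] q by auto
  qed (use that q in \<open>auto; blast\<close>)+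
qed

lemma Res_binder:
  assumes "pl_ok i (Res r S, l)"
  shows "r \<in> RESTR F" "r \<in> thread_names i" "r \<notin> place_dom (Res r S, l)" "r \<in> fn S"
proof -
  from assms obtain K where K: "K \<in> thread_idents F i" "fresh_ok K (Res r S) l" by (auto simp: pl_ok_def)
  then have "K \<in> idents" "r \<in> set (res_binders (body K))" by (auto simp: fresh_ok_def)
  then show "r \<in> RESTR F" "r \<in> thread_names i"
    using class_subset(2) K(1) by (auto simp: thread_names_def names_def bset_def)
  show "r \<notin> place_dom (Res r S, l)" "r \<in> fn S" using K(2) by (auto simp: fresh_ok_def wf_proc_def)
qed

lemma Recv_binder:
  assumes "pl_ok i (Sum bs, l)" and b: "(Recv x y, S) \<in> set bs"
  shows "y \<in> INP F" "y \<in> thread_names i" "y \<notin> place_dom (Sum bs, l)"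
proof -
  from assms obtain K where K: "K \<in> thread_idents F i" "fresh_ok K (Sum bs) l" by (auto simp: pl_ok_def)
  have y: "y \<in> set (inp_binders (Sum bs))" using b by (force simp: inp_binders_Sum)
  then have "K \<in> idents" "y \<in> set (inp_binders (body K))" using K by (auto simp: fresh_ok_def)
  then show "y \<in> INP F" "y \<in> thread_names i"
    using class_subset(3) K(1) by (auto simp: thread_names_def names_def bset_def)
  have "y \<in> bset (Sum bs)" using y by (simp add: bset_def)
  then show "y \<notin> place_dom (Sum bs, l)"
    using K(2) unfolding fresh_dom[OF K(2)] fresh_ok_def wf_proc_def by blast
qed

text \<open>The target of the parameter is still unset: no body calls its own identifier, so caller
  and callee have disjoint names, and the formals set so far stand at later positions.\<close>

lemma call1_formal:
  assumes "pl_ok i (Call K (xs @ [x]), l)" "length xs < length (formals K)"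
  shows "formals K ! length xs \<in> FRM F" "formals K ! length xs \<in> thread_names i"
    "formals K ! length xs \<notin> place_dom (Call K (xs @ [x]), l)"
proof -
  let ?f = "formals K ! length xs"
  from assms obtain K0 where K0: "K0 \<in> thread_idents F i" "call_ok K0 K (xs @ [x]) l"
    by (auto simp: pl_ok_def)
  note facts = call_ok_facts[OF K0(2)]
  have f: "?f \<in> set (formals K)" using assms(2) by simp
  then show "?f \<in> FRM F" using class_subset(1)[OF facts(2)] by blast
  have fn: "?f \<in> names K" using f by (simp add: names_def)
  then show "?f \<in> thread_names i" using call_ok_names[OF K0] by blast
  have "?f \<notin> names K0" using fn facts(5) by blast
  moreover have "?f \<notin> set (drop (Suc (length xs)) (formals K))"
    using distinct_formals[OF facts(2)] assms(2)
    by (metis Cons_nth_drop_Suc distinct.simps(2) distinct_drop)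
  ultimately show "?f \<notin> place_dom (Call K (xs @ [x]), l)"
    using K0(2) by (auto simp: call_ok_def)
qed

lemma lstep_place:
  assumes "lstep \<theta> q C q' \<theta>'" "pl_ok i q" "dom \<theta> \<inter> thread_names i = place_dom q" "subst_ok \<theta>"
  shows "pl_ok i q' \<and> dom \<theta>' \<inter> thread_names i = place_dom q' \<and> subst_ok \<theta>' \<and>
    (\<forall>x. x \<notin> thread_names i \<longrightarrow> \<theta>' x = \<theta> x)"
proof -
  have step: "(q, q') \<in> cf_step F NEW" using lstep_cf_trans[OF assms(1,4)] by (rule cf_stepI)
  from assms(2) obtain K where K: "K \<in> thread_idents F i" "place_ok K q" by (auto simp: pl_ok_def)
  from assms(1) show ?thesis
  proof cases
    case (nu m r S l)
    note r = Res_binder[OF assms(2)[unfolded nu(1)]]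
    have "fresh_ok K S l" using K(2) step fresh_ok_Res by (simp add: nu)
    then have "pl_ok i q'" "place_dom q' = fn S \<union> set l"
      using K(1) fresh_ok_place fresh_dom by (auto simp: pl_ok_def nu)
    moreover have "dom \<theta>' \<inter> thread_names i = insert r (place_dom q)" using assms(3) r by (auto simp: nu)
    moreover have "subst_ok \<theta>'" unfolding nu using assms(4) nu r(1)
      unfolding subst_ok_def by (auto simp: ran_def)
    ultimately show ?thesis using r by (auto simp: nu)
  next
    case (tau S bs l)
    have ok: "fresh_ok K (Sum bs) l" using K(2) by (simp add: tau)
    have ok': "fresh_ok K S (l @ dropped bs S)" using fresh_ok_Sum[OF ok tau(5)] step by (simp add: tau)
    then have "pl_ok i q'" using K(1) fresh_ok_place by (auto simp: pl_ok_def tau)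
    moreover have "place_dom q' = place_dom q" using Sum_dom[OF ok ok' tau(5)] by (simp add: tau)
    ultimately show ?thesis using assms(3,4) by (simp add: tau)
  next
    case (call1 K' xs x a l)
    let ?f = "formals K' ! length xs"
    note f = call1_formal[OF assms(2)[unfolded call1(1)] call1(6)]
    have ok: "call_ok K K' (xs @ [x]) l" using K(2) by (simp add: call1)
    then have "place_ok K q'" using call1(6) unfolding call1(3) place_ok.simps call_ok_def by auto
    then have "pl_ok i q'" using K(1) by (auto simp: pl_ok_def)
    moreover have "set (drop (length xs) (formals K')) = insert ?f (set (drop (Suc (length xs)) (formals K')))"
      using call1(6) by (metis Cons_nth_drop_Suc list.simps(15))
    then have "place_dom q' = insert ?f (place_dom q)" by (auto simp: call1)
    moreover have "subst_ok \<theta>'" unfolding call1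
      using assms(4) call1(7) f(1) subst_okD(1)[OF assms(4) call1(7)] distinct_binders(5)
      unfolding subst_ok_def by (auto simp: ran_def)
    ultimately show ?thesis using assms(3) f by (auto simp: call1)
  next
    case (call2 x a K' l)
    have ok: "call_ok K K' [] (x # l)" using K(2) by (simp add: call2)
    then have "place_ok K q'" by (auto simp: call2 call_ok_def)
    then have "pl_ok i q'" using K(1) by (auto simp: pl_ok_def)
    moreover have x: "x \<in> names K" using ok by (auto simp: call_ok_def)
    then have "x \<notin> set (formals K')" using call_ok_facts(5)[OF ok] by (auto simp: names_def)
    then have "place_dom q' = place_dom q - {x}" using ok by (auto simp: call2 call_ok_def)
    moreover have "subst_ok \<theta>'" unfolding call2 using assms(4)
      unfolding subst_ok_def by (auto simp: ran_def)
    ultimately show ?thesis using assms(3) x pl_ok_names[OF K] by (auto simp: call2)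
  next
    case (call3 K')
    have ok: "call_ok K K' [] []" using K(2) by (simp add: call3)
    have "K' \<in> thread_idents F i" using K(1) call_ok_facts(4)[OF ok] by (rule thread_idents_call)
    moreover have "fresh_ok K' (body K') []" using call3 by (intro fresh_ok_body)
    ultimately have "pl_ok i q'" "place_dom q' = set (formals K')"
      using fresh_ok_place fresh_dom eqs_nf(2) call3(5) by (auto simp: pl_ok_def call3)
    then show ?thesis using assms(3,4) by (simp add: call3)
  qed
qed

lemma cstep_cf_trans:
  assumes "cstep \<theta> a b q1 C q1' q2 D q2' \<theta>'" "subst_ok \<theta>"
  shows "(q1, LSend a b, C, q1') \<in> cf_trans F NEW" "(q2, LRec a b, D, q2') \<in> cf_trans F NEW"
  using assms subst_okD(1)[OF assms(2)] by (auto elim!: cstep.cases intro!: cf_trans.snd cf_trans.rec)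

text \<open>The sender only tests; the single new value belongs to the receiving thread
  \<open>j\<close>.\<close>

lemma cstep_place:
  assumes "cstep \<theta> a b q1 C q1' q2 D q2' \<theta>'" "pl_ok i q1" "pl_ok j q2"
    "dom \<theta> \<inter> thread_names i = place_dom q1" "dom \<theta> \<inter> thread_names j = place_dom q2" "subst_ok \<theta>"
    "thread_names i \<inter> thread_names j = {}"
  shows "pl_ok i q1' \<and> dom \<theta>' \<inter> thread_names i = place_dom q1' \<and>
    pl_ok j q2' \<and> dom \<theta>' \<inter> thread_names j = place_dom q2' \<and> subst_ok \<theta>' \<and>
    (\<forall>x. x \<notin> thread_names j \<longrightarrow> \<theta>' x = \<theta> x)"
  using assms(1)
proof cases
  case (1 x y S bs x' y' S' cs l l')
  note steps = cstep_cf_trans[OF assms(1,6), THEN cf_stepI]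
  from assms(2) obtain K where K: "K \<in> thread_idents F i" "fresh_ok K (Sum bs) l"
    by (auto simp: pl_ok_def 1)
  from assms(3) obtain L where L: "L \<in> thread_idents F j" "fresh_ok L (Sum cs) l'"
    by (auto simp: pl_ok_def 1)
  note y' = Recv_binder[OF assms(3)[unfolded 1(4)] 1(9)]
  have K': "fresh_ok K S (l @ dropped bs S)" using fresh_ok_Sum[OF K(2) 1(8)] steps(1) by (simp add: 1)
  have L': "fresh_ok L S' (l' @ dropped cs S')"
    using fresh_ok_Sum[OF L(2) 1(9)] steps(2) by (simp add: 1)
  have "pl_ok i q1'" "pl_ok j q2'" using K(1) K' L(1) L' fresh_ok_place by (auto simp: pl_ok_def 1)
  moreover have "place_dom q1' = place_dom q1" using Sum_dom[OF K(2) K' 1(8)] by (simp add: 1)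
  moreover have "place_dom q2' = insert y' (place_dom q2)"
    using Sum_dom[OF L(2) L' 1(9)] by (simp add: 1)
  moreover have "subst_ok \<theta>'" unfolding 1
    using assms(6) y'(1) subst_okD(1)[OF assms(6) 1(11)] distinct_binders(4)
    unfolding subst_ok_def by (auto simp: ran_def)
  ultimately show ?thesis using assms(4,5,7) y' by (auto simp: 1)
qed

lemma inv_dom: "inv s \<theta> \<Longrightarrow> i < n_threads F \<Longrightarrow> x \<in> place_dom (s i) \<Longrightarrow> x \<in> dom \<theta>"
  unfolding inv_def by blast

lemma inv_lstep:
  assumes "inv s \<theta>" "i < n_threads F" "lstep \<theta> (s i) C q' \<theta>'"
  shows "inv (s(i := q')) \<theta>'" "\<And>x. x \<notin> thread_names i \<Longrightarrow> \<theta>' x = \<theta> x"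
proof -
  have ok: "subst_ok \<theta>" using assms(1) by (simp add: inv_def)
  have i: "pl_ok i (s i)" "dom \<theta> \<inter> thread_names i = place_dom (s i)" "s i \<in> cf_places F NEW i"
    using assms(1,2) by (auto simp: inv_def)
  note * = lstep_place[OF assms(3) i(1,2) ok]
  then show eq: "\<And>x. x \<notin> thread_names i \<Longrightarrow> \<theta>' x = \<theta> x" by blast
  have "(s i, q') \<in> cf_step F NEW" using lstep_cf_trans[OF assms(3) ok] by (rule cf_stepI)
  then have "q' \<in> cf_places F NEW i"
    using i(3) unfolding cf_places_def by (auto intro: rtrancl.rtrancl_into_rtrancl)
  moreover have "dom \<theta>' \<inter> thread_names j = place_dom (s j)" if "j < n_threads F" "j \<noteq> i" for j
  proof -
    have "dom \<theta>' \<inter> thread_names j = dom \<theta> \<inter> thread_names j"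
      using thread_names_disjoint[OF that(1) assms(2) that(2)] eq by (force simp: dom_def)
    then show ?thesis using assms(1) that by (simp add: inv_def)
  qed
  moreover have "dom \<theta>' \<subseteq> (\<Union>i < n_threads F. thread_names i)"
  proof
    fix x assume "x \<in> dom \<theta>'"
    then have "x \<in> thread_names i \<or> x \<in> dom \<theta>" using eq by (metis domIff)
    then show "x \<in> (\<Union>i < n_threads F. thread_names i)"
      using assms(1,2) unfolding inv_def by blast
  qed
  ultimately show "inv (s(i := q')) \<theta>'" using * assms(1) by (auto simp: inv_def)
qed

lemma inv_cstep:
  assumes "inv s \<theta>" "i < n_threads F" "j < n_threads F" "i \<noteq> j"
    "cstep \<theta> a b (s i) C q1' (s j) D q2' \<theta>'"
  shows "inv (s(i := q1', j := q2')) \<theta>'" "\<And>x. x \<notin> thread_names j \<Longrightarrow> \<theta>' x = \<theta> x"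
proof -
  have ok: "subst_ok \<theta>" using assms(1) by (simp add: inv_def)
  have i: "pl_ok i (s i)" "dom \<theta> \<inter> thread_names i = place_dom (s i)" "s i \<in> cf_places F NEW i"
    and j: "pl_ok j (s j)" "dom \<theta> \<inter> thread_names j = place_dom (s j)" "s j \<in> cf_places F NEW j"
    using assms(1-3) by (auto simp: inv_def)
  note * = cstep_place[OF assms(5) i(1) j(1) i(2) j(2) ok thread_names_disjoint[OF assms(2-4)]]
  then show eq: "\<And>x. x \<notin> thread_names j \<Longrightarrow> \<theta>' x = \<theta> x" by blast
  have "(s i, q1') \<in> cf_step F NEW" "(s j, q2') \<in> cf_step F NEW"
    using cstep_cf_trans[OF assms(5) ok] by (auto intro: cf_stepI)
  then have "q1' \<in> cf_places F NEW i" "q2' \<in> cf_places F NEW j"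
    using i(3) j(3) unfolding cf_places_def by (auto intro: rtrancl.rtrancl_into_rtrancl)
  moreover have "dom \<theta>' \<inter> thread_names k = place_dom (s k)" if "k < n_threads F" "k \<noteq> j" for k
  proof -
    have "dom \<theta>' \<inter> thread_names k = dom \<theta> \<inter> thread_names k"
      using thread_names_disjoint[OF that(1) assms(3) that(2)] eq by (force simp: dom_def)
    then show ?thesis using assms(1) that by (simp add: inv_def)
  qed
  moreover have "dom \<theta>' \<subseteq> (\<Union>i < n_threads F. thread_names i)"
  proof
    fix x assume "x \<in> dom \<theta>'"
    then have "x \<in> thread_names j \<or> x \<in> dom \<theta>" using eq by (metis domIff)
    then show "x \<in> (\<Union>i < n_threads F. thread_names i)"
      using assms(1,3) unfolding inv_def by blast
  qed
  ultimately show "inv (s(i := q1', j := q2')) \<theta>'" using * assms(1) by (auto simp: inv_def)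
qed

text \<open>Arcs carry no multiplicity. The presets and postsets of all commands are therefore
  united before tokens are counted, and commands that touch the same place share one arc.\<close>

definition cmd_ok :: "command set \<Rightarrow> (name \<rightharpoonup> name) \<Rightarrow> (name \<rightharpoonup> name) \<Rightarrow> bool" where
  "cmd_ok C \<theta> \<theta>' \<longleftrightarrow> (let pre = (\<Union>c\<in>C. cmd_pre F NEW c); post = (\<Union>c\<in>C. cmd_post F NEW c) in
     (\<forall>p\<in>pre. mark_sub \<theta> p > 0) \<and> pre \<union> post \<subseteq> subst_places F NEW \<and>
     (\<forall>p. mark_sub \<theta>' p = mark_sub \<theta> p - of_bool (p \<in> pre) + of_bool (p \<in> post)))"

lemma settled_Sum: "pl_ok i (Sum bs, l) \<Longrightarrow> settled_place F NEW (Sum bs, l)"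
  by (auto simp: pl_ok_def fresh_ok_def wf_proc_def settled_place_def)

lemma PUB_NEW: "PUB F \<inter> NEW = {}"
  using nn by (auto simp: new_names_def)

lemma EqP_place: "subst_ok \<theta> \<Longrightarrow> \<theta> x = Some a \<Longrightarrow> EqP x a \<in> subst_places F NEW"
  using subst_okD[of \<theta> x a] unfolding subst_places_def by blast

lemma cmd_ok_single:
  assumes "\<And>p. mark_sub \<theta>' p = mark_sub \<theta> p - of_bool (p \<in> cmd_pre F NEW c) + of_bool (p \<in> cmd_post F NEW c)"
    "\<And>p. p \<in> cmd_pre F NEW c \<Longrightarrow> mark_sub \<theta> p > 0"
    "cmd_pre F NEW c \<union> cmd_post F NEW c \<subseteq> subst_places F NEW"
  shows "cmd_ok {c} \<theta> \<theta>'"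
  using assms by (simp add: cmd_ok_def)

lemma cmd_ok_nu:
  assumes "subst_ok \<theta>" "r \<in> RESTR F" "m \<in> NEW" "m \<notin> ran \<theta>" "\<theta> r = None"
  shows "cmd_ok {MapTo r m} \<theta> (\<theta>(r \<mapsto> m))"
proof -
  have "mark_sub (\<theta>(r \<mapsto> m)) p = mark_sub \<theta> p - of_bool (p \<in> cmd_pre F NEW (MapTo r m))
      + of_bool (p \<in> cmd_post F NEW (MapTo r m))" for p
  proof (cases p)
    case (NeqStar k)
    have "(\<forall>r'\<in>RESTR F. (\<theta>(r \<mapsto> m)) r' \<noteq> Some k) \<longleftrightarrow> k \<noteq> m \<and> (\<forall>r'\<in>RESTR F. \<theta> r' \<noteq> Some k)"
      using assms(2,5) by (metis fun_upd_apply option.distinct(1) option.inject)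
    then show ?thesis using assms(2-4) NeqStar by (auto simp: ran_def)
  qed (use assms distinct_binders(4,5) in \<open>auto simp: ran_def\<close>)
  moreover have "mark_sub \<theta> p > 0" if "p \<in> cmd_pre F NEW (MapTo r m)" for p
    using that assms by (auto simp: ran_def)
  moreover have "cmd_pre F NEW (MapTo r m) \<union> cmd_post F NEW (MapTo r m) \<subseteq> subst_places F NEW"
    using assms by (auto simp: subst_places_def)
  ultimately show ?thesis by (rule cmd_ok_single)
qed

text \<open>Treats parameter passing and communication alike; \<open>T\<close> collects the tests of
  the transition.\<close>

lemma cmd_ok_map:
  assumes "subst_ok \<theta>" "f \<in> INP F \<union> FRM F" "\<theta> f = None" "b \<in> PUB F \<union> NEW"
    "\<And>x a. (x, a) \<in> T \<Longrightarrow> \<theta> x = Some a" "(y, b) \<in> T"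
  shows "cmd_ok (insert (MapTo f b) ((\<lambda>(x, a). Test x a) ` T)) \<theta> (\<theta>(f \<mapsto> b))"
proof -
  have f: "f \<notin> RESTR F" using assms(2) distinct_binders(4,5) by blast
  let ?C = "insert (MapTo f b) ((\<lambda>(x, a). Test x a) ` T)"
  let ?E = "(\<lambda>(x, a). EqP x a) ` T"
  have pre: "(\<Union>c\<in>?C. cmd_pre F NEW c) = ?E \<union> (if b \<in> NEW then {NeqP f b} else {})"
    and post: "(\<Union>c\<in>?C. cmd_post F NEW c) = insert (EqP f b) ?E"
    using f by (auto simp: case_prod_unfold)
  have E: "EqP x a \<in> ?E \<longleftrightarrow> (x, a) \<in> T" "NeqP x a \<notin> ?E" "NeqStar a \<notin> ?E" for x a by force+
  have "mark_sub (\<theta>(f \<mapsto> b)) p = mark_sub \<theta> p - of_bool (p \<in> ?E \<union> (if b \<in> NEW then {NeqP f b} else {}))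
      + of_bool (p \<in> insert (EqP f b) ?E)" for p
  proof (cases p)
    case (EqP x a)
    then show ?thesis using assms(3) assms(5)[of x a] E(1)[of x a] by auto
  next
    case (NeqP x m)
    then show ?thesis using assms(2,3,4) E(2)[of x m] by auto
  next
    case (NeqStar m)
    have "(\<forall>r\<in>RESTR F. (\<theta>(f \<mapsto> b)) r \<noteq> Some m) \<longleftrightarrow> (\<forall>r\<in>RESTR F. \<theta> r \<noteq> Some m)" using f by auto
    then show ?thesis using E(3)[of m] NeqStar by simp
  qed
  moreover have "mark_sub \<theta> p > 0" if "p \<in> ?E \<union> (if b \<in> NEW then {NeqP f b} else {})" for p
    using that assms(2,3,5) by (auto split: if_splits)
  moreover have "?E \<subseteq> subst_places F NEW"
    using EqP_place[OF assms(1) assms(5)] by auto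
  moreover have "b \<in> NEW \<Longrightarrow> NeqP f b \<in> subst_places F NEW" "EqP f b \<in> subst_places F NEW"
    using assms(2,4) unfolding subst_places_def by blast+
  ultimately show ?thesis unfolding cmd_ok_def Let_def pre post by simp
qed

lemma cmd_ok_unmap:
  assumes "subst_ok \<theta>" "\<theta> x = Some a"
  shows "cmd_ok {Unmap x a} \<theta> (\<theta>(x := None))"
proof -
  note x = subst_okD[OF assms]
  \<comment> \<open>Restricted names hold distinct new names, so after the unmapping no restricted
    name holds \<open>a\<close> and the token returned to \<open>NeqStar a\<close> is
    justified.\<close>
  have inj: "x \<in> RESTR F \<Longrightarrow> \<forall>r\<in>RESTR F. r \<noteq> x \<longrightarrow> \<theta> r \<noteq> Some a"
    using assms unfolding subst_ok_def by blast
  have "mark_sub (\<theta>(x := None)) p = mark_sub \<theta> p - of_bool (p \<in> cmd_pre F NEW (Unmap x a))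
      + of_bool (p \<in> cmd_post F NEW (Unmap x a))" for p
  proof (cases p)
    case (EqP y b)
    then show ?thesis using assms(2) by simp
  next
    case (NeqP y m)
    have "y \<in> INP F \<union> FRM F \<Longrightarrow> y \<notin> RESTR F" using distinct_binders(4,5) by blast
    then show ?thesis using assms(2) x(2) NeqP by auto
  next
    case (NeqStar m)
    show ?thesis
    proof (cases "x \<in> RESTR F")
      case True
      then show ?thesis using assms(2) inj[OF True] x(3)[OF True] NeqStar by auto
    next
      case False
      then have "(\<forall>r\<in>RESTR F. (\<theta>(x := None)) r \<noteq> Some m) \<longleftrightarrow> (\<forall>r\<in>RESTR F. \<theta> r \<noteq> Some m)" by auto
      then show ?thesis using NeqStar False by simp
    qed
  qed
  moreover have "mark_sub \<theta> p > 0" if "p \<in> cmd_pre F NEW (Unmap x a)" for p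
    using that assms by auto
  moreover have "cmd_pre F NEW (Unmap x a) \<union> cmd_post F NEW (Unmap x a) \<subseteq> subst_places F NEW"
    using EqP_place[OF assms] x by (auto simp: subst_places_def)
  ultimately show ?thesis by (rule cmd_ok_single)
qed

lemma cmd_ok_empty: "cmd_ok {} \<theta> \<theta>"
  by (simp add: cmd_ok_def)

lemma notin_dom: "dom \<theta> \<inter> A = B \<Longrightarrow> x \<in> A \<Longrightarrow> x \<notin> B \<Longrightarrow> \<theta> x = None"
  by auto

lemma lstep_cmd_ok:
  assumes "lstep \<theta> q C q' \<theta>'" "pl_ok i q" "dom \<theta> \<inter> thread_names i = place_dom q" "subst_ok \<theta>"
  shows "cmd_ok C \<theta> \<theta>'"
  using assms(1)
proof cases
  case (nu m r S l)
  note r = Res_binder[OF assms(2)[unfolded nu(1)]]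
  have "\<theta> r = None" using notin_dom[OF assms(3)] r nu(1) by blast
  then show ?thesis using cmd_ok_nu assms(4) r(1) nu by blast
next
  case (call1 K xs x a l)
  let ?f = "formals K ! length xs"
  note f = call1_formal[OF assms(2)[unfolded call1(1)] call1(6)]
  have "\<theta> ?f = None" using notin_dom[OF assms(3)] f call1(1) by blast
  from cmd_ok_map[OF assms(4) _ this _ _, of a "{(x, a)}" x] f(1) call1(7) subst_okD(1)[OF assms(4) call1(7)]
  show ?thesis by (simp add: call1 insert_commute)
next
  case (call2 x a K l)
  then show ?thesis using cmd_ok_unmap[OF assms(4)] by blast
qed (auto simp: cmd_ok_empty)

lemma cstep_cmd_ok:
  assumes "cstep \<theta> a b q1 C q1' q2 D q2' \<theta>'" "pl_ok j q2" "dom \<theta> \<inter> thread_names j = place_dom q2" "subst_ok \<theta>"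
  shows "cmd_ok (C \<union> D) \<theta> \<theta>'"
  using assms(1)
proof cases
  case (1 x y S bs x' y' S' cs l l')
  note f = Recv_binder[OF assms(2)[unfolded 1(4)] 1(9)]
  have "\<theta> y' = None" using notin_dom[OF assms(3)] f 1(4) by blast
  from cmd_ok_map[OF assms(4) _ this _ _, of b "{(x, a), (y, b), (x', a)}" y] f(1) 1(10-12)
    subst_okD(1)[OF assms(4) 1(11)]
  have "cmd_ok (insert (MapTo y' b) ((\<lambda>(x, a). Test x a) ` {(x, a), (y, b), (x', a)})) \<theta> (\<theta>(y' \<mapsto> b))"
    by blast
  also have "insert (MapTo y' b) ((\<lambda>(x, a). Test x a) ` {(x, a), (y, b), (x', a)}) = C \<union> D"
    unfolding 1 by auto
  finally show ?thesis unfolding 1(7) .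
qed

end

section \<open>Firing transitions of the composed net\<close>

locale fcp_net_spec = fcp_spec +
  fixes M\<^sub>s :: "splace \<Rightarrow> nat"
begin

abbreviation "N \<equiv> fcp_net F NEW M\<^sub>s"

lemma transitions_N [simp]: "transitions N = net_trans F NEW"
  by (simp add: fcp_net_def)

lemma flow_N:
  "(Ctl i q, t) \<in> flow_pt N \<longleftrightarrow> t \<in> net_trans F NEW \<and> (i, q) \<in> ctl_pre t"
  "(Sub p, t) \<in> flow_pt N \<longleftrightarrow> t \<in> net_trans F NEW \<and> p \<in> sub_pre F NEW t"
  "(t, Ctl i q) \<in> flow_tp N \<longleftrightarrow> t \<in> net_trans F NEW \<and> (i, q) \<in> ctl_post t"
  "(t, Sub p) \<in> flow_tp N \<longleftrightarrow> t \<in> net_trans F NEW \<and> p \<in> sub_post F NEW t"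
  by (cases q; auto simp: fcp_net_def)+

lemma enabled_N:
  "enabled N M t \<longleftrightarrow> t \<in> net_trans F NEW \<and> (\<forall>(i, q) \<in> ctl_pre t. M (Ctl i q) > 0) \<and>
     (\<forall>p \<in> sub_pre F NEW t. M (Sub p) > 0)"
proof -
  have "(\<forall>p. (p, t) \<in> flow_pt N \<longrightarrow> M p > 0) \<longleftrightarrow>
    (\<forall>i q. (Ctl i q, t) \<in> flow_pt N \<longrightarrow> M (Ctl i q) > 0) \<and> (\<forall>p. (Sub p, t) \<in> flow_pt N \<longrightarrow> M (Sub p) > 0)"
    by (metis nplace.exhaust)
  then show ?thesis unfolding enabled_def flow_N by auto
qed

lemma Local_par_trans:
  "i < n_threads F \<Longrightarrow> q \<in> cf_places F NEW i \<Longrightarrow> (q, lab, C, q') \<in> cf_trans F NEW \<Longrightarrow>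
   Local i (q, lab, C, q') \<in> par_trans F NEW"
  by (cases q; cases q') (auto simp: par_trans_def cf_net_trans_def)

lemma Sync_par_trans:
  "i < n_threads F \<Longrightarrow> j < n_threads F \<Longrightarrow> i \<noteq> j \<Longrightarrow>
   q1 \<in> cf_places F NEW i \<Longrightarrow> (q1, LSend a b, C, q1') \<in> cf_trans F NEW \<Longrightarrow>
   q2 \<in> cf_places F NEW j \<Longrightarrow> (q2, LRec a b, D, q2') \<in> cf_trans F NEW \<Longrightarrow>
   Sync i (q1, LSend a b, C, q1') j (q2, LRec a b, D, q2') \<in> par_trans F NEW"
  by (cases q1; cases q1'; cases q2; cases q2') (auto simp: par_trans_def cf_net_trans_def)

lemma par_trans_cases:
  assumes "t \<in> par_trans F NEW"
  obtains (Local) i q lab C q' where "t = Local i (q, lab, C, q')" "i < n_threads F"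
      "(q, lab, C, q') \<in> cf_trans F NEW"
    | (Sync) i j q1 a b C q1' q2 D q2' where "i < n_threads F" "j < n_threads F" "i \<noteq> j"
      "t = Sync i (q1, LSend a b, C, q1') j (q2, LRec a b, D, q2')"
      "(q1, LSend a b, C, q1') \<in> cf_trans F NEW" "(q2, LRec a b, D, q2') \<in> cf_trans F NEW"
  using assms unfolding par_trans_def cf_net_trans_def by auto

lemma lstep_fire:
  assumes "inv s \<theta>" "i < n_threads F" "lstep \<theta> (s i) C q' \<theta>'"
  shows "enabled N (mark s \<theta>) (Local i (s i, LTau, C, q'))"
    "fire N (mark s \<theta>) (Local i (s i, LTau, C, q')) = mark (s(i := q')) \<theta>'"
proof -
  let ?t = "Local i (s i, LTau, C, q')"
  have ok: "subst_ok \<theta>" using assms(1) by (simp add: inv_def)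
  have i: "pl_ok i (s i)" "dom \<theta> \<inter> thread_names i = place_dom (s i)" "s i \<in> cf_places F NEW i"
    using assms(1,2) by (auto simp: inv_def)
  note cmd = lstep_cmd_ok[OF assms(3) i(1,2) ok, unfolded cmd_ok_def Let_def]
  have t: "?t \<in> net_trans F NEW"
    using Local_par_trans[OF assms(2) i(3) lstep_cf_trans[OF assms(3) ok]] cmd
    by (simp add: net_trans_def sub_pre_def sub_post_def)
  then show "enabled N (mark s \<theta>) ?t" using assms(2) cmd by (simp add: enabled_N sub_pre_def)
  show "fire N (mark s \<theta>) ?t = mark (s(i := q')) \<theta>'"
  proof
    fix p show "fire N (mark s \<theta>) ?t p = mark (s(i := q')) \<theta>' p"
      using t cmd assms(2) by (cases p) (auto simp: fire_def flow_N sub_pre_def sub_post_def)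
  qed
qed

lemma cstep_fire:
  assumes "inv s \<theta>" "i < n_threads F" "j < n_threads F" "i \<noteq> j"
    "cstep \<theta> a b (s i) C q1' (s j) D q2' \<theta>'"
  shows "enabled N (mark s \<theta>) (Sync i (s i, LSend a b, C, q1') j (s j, LRec a b, D, q2'))"
    "fire N (mark s \<theta>) (Sync i (s i, LSend a b, C, q1') j (s j, LRec a b, D, q2'))
      = mark (s(i := q1', j := q2')) \<theta>'"
proof -
  let ?t = "Sync i (s i, LSend a b, C, q1') j (s j, LRec a b, D, q2')"
  have ok: "subst_ok \<theta>" using assms(1) by (simp add: inv_def)
  have i: "s i \<in> cf_places F NEW i"
    and j: "pl_ok j (s j)" "dom \<theta> \<inter> thread_names j = place_dom (s j)" "s j \<in> cf_places F NEW j"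
    using assms(1-3) by (auto simp: inv_def)
  note cmd = cstep_cmd_ok[OF assms(5) j(1,2) ok, unfolded cmd_ok_def Let_def]
  have t: "?t \<in> net_trans F NEW"
    using Sync_par_trans[OF assms(2-4) i(1) cstep_cf_trans(1)[OF assms(5) ok] j(3)
        cstep_cf_trans(2)[OF assms(5) ok]] cmd
    by (simp add: net_trans_def sub_pre_def sub_post_def)
  then show "enabled N (mark s \<theta>) ?t" using assms(2,3) cmd by (simp add: enabled_N sub_pre_def)
  show "fire N (mark s \<theta>) ?t = mark (s(i := q1', j := q2')) \<theta>'"
  proof
    fix p show "fire N (mark s \<theta>) ?t p = mark (s(i := q1', j := q2')) \<theta>' p"
      using t cmd assms(2-4) by (cases p) (auto simp: fire_def flow_N sub_pre_def sub_post_def)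
  qed
qed

text \<open>Conversely to the firing lemmas, the marked presets of an enabled transition yield the
  premises of \<open>lstep\<close> or \<open>cstep\<close>; unsynchronised sends and receives are
  excluded by hiding.\<close>

lemma enabled_cases:
  assumes "inv s \<theta>" "enabled N (mark s \<theta>) t"
  obtains (Local) i C q' \<theta>' where "i < n_threads F" "lstep \<theta> (s i) C q' \<theta>'"
      "t = Local i (s i, LTau, C, q')"
    | (Sync) i j a b C q1' D q2' \<theta>' where "i < n_threads F" "j < n_threads F" "i \<noteq> j"
      "cstep \<theta> a b (s i) C q1' (s j) D q2' \<theta>'"
      "t = Sync i (s i, LSend a b, C, q1') j (s j, LRec a b, D, q2')"
proof -
  have ok: "subst_ok \<theta>" using assms(1) by (simp add: inv_def)
  have t: "t \<in> par_trans F NEW" "ntrans_label t = LTau"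
    and pre: "\<And>i q. (i, q) \<in> ctl_pre t \<Longrightarrow> q = s i"
    and sub: "\<And>c p. c \<in> ntrans_commands t \<Longrightarrow> p \<in> cmd_pre F NEW c \<Longrightarrow> mark_sub \<theta> p > 0"
    using assms(2) by (auto simp: enabled_N net_trans_def sub_pre_def split: if_splits)
  have test: "\<theta> x = Some a" if "Test x a \<in> ntrans_commands t" for x a
    using sub[OF that] by (simp split: if_splits)
  from t(1) show thesis
  proof (cases rule: par_trans_cases)
    case L: (Local i q lab C q')
    have q: "q = s i" and lab: "lab = LTau" using pre t(2) L(1) by simp_all
    have "\<exists>\<theta>'. lstep \<theta> (s i) C q' \<theta>'"
      using L(3)
    proof (cases rule: cf_trans_cases)
      case (nu m r S l)
      have "pl_ok i (s i)" using assms(1) L(2) by (simp add: inv_def)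
      then have r: "r \<in> RESTR F" using Res_binder(1) nu q by metis
      \<comment> \<open>The preset of an allocation contains every complementary place of
        \<open>m\<close>, so a name of any kind that held \<open>m\<close> would leave one of them
        empty.\<close>
      have *: "mark_sub \<theta> p > 0" if "p \<in> cmd_pre F NEW (MapTo r m)" for p
        using sub[of "MapTo r m"] that L(1) nu by simp
      have "m \<notin> ran \<theta>"
      proof
        assume "m \<in> ran \<theta>"
        then obtain x where x: "\<theta> x = Some m" by (auto simp: ran_def)
        then consider "x \<in> RESTR F" | "x \<in> INP F \<union> FRM F" using subst_okD(2)[OF ok] by blast
        then show False
        proof cases
          case 1
          then show False using *[of "NeqStar m"] x r nu by auto
        next
          case 2
          then show False using *[of "NeqP x m"] x r nu by auto
        qed
      qed
      with nu(5) have "lstep \<theta> (Res r S, l) {MapTo r m} (S, l) (\<theta>(r \<mapsto> m))" by (rule lstep.nu)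
      then show ?thesis using nu q by auto
    next
      case (tau S bs l)
      then show ?thesis using lstep.tau[of S bs \<theta> l] q by auto
    next
      case (call1 K xs x a l)
      have "\<theta> x = Some a" using test[of x a] L(1) call1(3) by simp
      then show ?thesis using lstep.call1[OF call1(5,6), of \<theta> x a l] call1(1,3,4) q by auto
    next
      case (call2 K x l a)
      have "\<theta> x = Some a" using sub[of "Unmap x a" "EqP x a"] L(1) call2 by (simp split: if_splits)
      then show ?thesis using lstep.call2[of \<theta> x a K l] call2 q by auto
    next
      case (call3 K)
      then show ?thesis using lstep.call3[of K \<theta>] q by auto
    qed (use lab in auto)
    then show ?thesis using Local L q lab by blast
  next
    case S: (Sync i j q1 a b C q1' q2 D q2')
    have q: "q1 = s i" "q2 = s j" using pre S(4) by simp_all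
    have "\<exists>\<theta>'. cstep \<theta> a b (s i) C q1' (s j) D q2' \<theta>'"
      using S(5)
    proof (cases rule: cf_trans_cases)
      case (snd x y S1 bs a1 b1 l)
      note snd' = snd
      show ?thesis using S(6)
      proof (cases rule: cf_trans_cases)
        case (rec x' y' S2 cs a2 b2 l')
        have "\<theta> x = Some a" "\<theta> y = Some b" "\<theta> x' = Some a"
          using test S(4) snd' rec by simp_all
        with cstep.intros[OF snd'(5) rec(5) this, of l l'] show ?thesis using q snd' rec by auto
      qed auto
    qed auto
    then show ?thesis using Sync S q by blast
  qed
qed

lemma net_steps_lstep:
  assumes "inv s \<theta>" "i < n_threads F" "lstep \<theta> (s i) C q' \<theta>'"
  shows "(mark s \<theta>, mark (s(i := q')) \<theta>') \<in> net_steps N"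
  unfolding net_steps_def lstep_fire(2)[OF assms, symmetric] using lstep_fire(1)[OF assms] by blast

lemma net_steps_cstep:
  assumes "inv s \<theta>" "i < n_threads F" "j < n_threads F" "i \<noteq> j"
    "cstep \<theta> a b (s i) C q1' (s j) D q2' \<theta>'"
  shows "(mark s \<theta>, mark (s(i := q1', j := q2')) \<theta>') \<in> net_steps N"
  unfolding net_steps_def cstep_fire(2)[OF assms, symmetric] using cstep_fire(1)[OF assms] by blast

lemma housekeeping_lstep:
  assumes "inv s \<theta>" "i < n_threads F" "lstep \<theta> (s i) C q' \<theta>'" "\<not> settled_place F NEW (s i)"
  shows "(mark s \<theta>, mark (s(i := q')) \<theta>') \<in> housekeeping F NEW M\<^sub>s"
proof -
  have "\<forall>j q. (Ctl j q, Local i (s i, LTau, C, q')) \<in> flow_pt N \<longrightarrow> \<not> settled_place F NEW q"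
    using assms(4) by (auto simp: flow_N)
  then show ?thesis
    unfolding housekeeping_def Let_def lstep_fire(2)[OF assms(1-3), symmetric]
    using lstep_fire(1)[OF assms(1-3)] by blast
qed

text \<open>A communication starts from choices, which are always settled, and is therefore never
  housekeeping.\<close>

lemma housekeeping_cases:
  assumes "inv s \<theta>" "(mark s \<theta>, M') \<in> housekeeping F NEW M\<^sub>s"
  obtains i C q' \<theta>' where "i < n_threads F" "lstep \<theta> (s i) C q' \<theta>'" "\<not> settled_place F NEW (s i)"
    "M' = mark (s(i := q')) \<theta>'"
proof -
  from assms(2) obtain t where t: "enabled N (mark s \<theta>) t" "M' = fire N (mark s \<theta>) t"
    "\<And>i q. (Ctl i q, t) \<in> flow_pt N \<Longrightarrow> \<not> settled_place F NEW q"
    unfolding housekeeping_def Let_def by blast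
  have tn: "t \<in> net_trans F NEW" using t(1) by (simp add: enabled_N)
  from assms(1) t(1) show thesis
  proof (cases rule: enabled_cases)
    case (Local i C q' \<theta>')
    have "\<not> settled_place F NEW (s i)" using t(3)[of i "s i"] tn by (simp add: flow_N Local)
    then show ?thesis using that Local lstep_fire(2)[OF assms(1)] t(2) by blast
  next
    case (Sync i j a b C q1' D q2' \<theta>')
    have "\<not> settled_place F NEW (s i)" using t(3)[of i "s i"] tn by (simp add: flow_N Sync)
    moreover have "pl_ok i (s i)" using assms(1) Sync(1) by (simp add: inv_def)
    ultimately show ?thesis using settled_Sum Sync(4) by (auto elim: cstep.cases)
  qed
qed

lemma net_steps_cases:
  assumes "inv s \<theta>" "(mark s \<theta>, M') \<in> net_steps N"
  obtains (Local) i C q' \<theta>' where "i < n_threads F" "lstep \<theta> (s i) C q' \<theta>'"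
      "M' = mark (s(i := q')) \<theta>'"
    | (Sync) i j a b C q1' D q2' \<theta>' where "i < n_threads F" "j < n_threads F" "i \<noteq> j"
      "cstep \<theta> a b (s i) C q1' (s j) D q2' \<theta>'" "M' = mark (s(i := q1', j := q2')) \<theta>'"
proof -
  from assms(2) obtain t where t: "enabled N (mark s \<theta>) t" "M' = fire N (mark s \<theta>) t"
    unfolding net_steps_def by blast
  from assms(1) t(1) show thesis
  proof (cases rule: enabled_cases)
    case L: (Local i C q' \<theta>')
    then show ?thesis using Local lstep_fire(2)[OF assms(1)] t(2) by blast
  next
    case S: (Sync i j a b C q1' D q2' \<theta>')
    then show ?thesis using Sync cstep_fire(2)[OF assms(1)] t(2) by blast
  qed
qed

end

context fcp_spec
begin

subsection \<open>The process of a marking\<close>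

definition ap :: "(name \<rightharpoonup> name) \<Rightarrow> name \<Rightarrow> name" where
  "ap \<theta> x = (case \<theta> x of None \<Rightarrow> x | Some a \<Rightarrow> a)"

lemma subst_map_ap: "subst_map \<theta> S = subst (ap \<theta>) S"
  by (simp add: subst_map_def ap_def[abs_def])

lemma ap_Some: "\<theta> x = Some a \<Longrightarrow> ap \<theta> x = a"
  by (simp add: ap_def)

text \<open>\<open>zip\<close> stops at the end of \<open>xs\<close>: the leading formals are still
  represented by arguments of the caller, the others are read from their own values in
  \<open>\<theta>\<close>.\<close>

definition called :: "(name \<rightharpoonup> name) \<Rightarrow> ident \<Rightarrow> name list \<Rightarrow> proc" where
  "called \<theta> K xs = subst (ap \<theta> \<circ> ap (map_of (zip (formals K) xs))) (body K)"

text \<open>A call in progress stands for the body of its callee.  The exception are calls without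
  parameters: while the caller's names are being unmapped, housekeeping may run into another
  settled place of the same call, and then the process there has not yet reacted.\<close>

definition pending :: "ident \<Rightarrow> name list \<Rightarrow> name list \<Rightarrow> bool" where
  "pending K xs l \<longleftrightarrow> (\<exists>l1 l2. l = l1 @ l2 \<and> settled_place F NEW (Call K xs, l2))"

fun place_proc :: "(name \<rightharpoonup> name) \<Rightarrow> aug \<Rightarrow> proc" where
  "place_proc \<theta> (Call K xs, l) =
     (if pending K xs l then subst_map \<theta> (Call K xs) else called \<theta> K xs)"
| "place_proc \<theta> (S, l) = subst_map \<theta> S"

definition mark_proc :: "(nat \<Rightarrow> aug) \<Rightarrow> (name \<rightharpoonup> name) \<Rightarrow> proc" where
  "mark_proc s \<theta> = nu NEW (par_list (map (\<lambda>i. place_proc \<theta> (s i)) [0..<n_threads F]))"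

lemma finite_NEW [simp]: "finite NEW"
  using nn by (simp add: new_names_def)

lemma map_of_zip_nth:
  assumes "distinct fs" "j < length fs"
  shows "map_of (zip fs xs) (fs ! j) = (if j < length xs then Some (xs ! j) else None)"
  using assms
proof (induction fs arbitrary: j xs)
  case (Cons f fs)
  then show ?case by (cases xs; cases j) auto
qed simp

lemma ap_zip_nth:
  assumes "distinct fs" "j < length fs"
  shows "ap (map_of (zip fs xs)) (fs ! j) = (if j < length xs then xs ! j else fs ! j)"
  unfolding ap_def map_of_zip_nth[OF assms] by simp

lemma nth_in_drop: "n \<le> j \<Longrightarrow> j < length fs \<Longrightarrow> fs ! j \<in> set (drop n fs)"
  using nth_mem[of "j - n" "drop n fs"] by simp

lemma ap_ran: "x \<in> dom \<theta> \<Longrightarrow> ap \<theta> x \<in> ran \<theta>"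
  by (auto simp: ap_def ran_def)

lemma called_cong:
  assumes "K \<in> idents"
    "\<And>j. j < length (formals K) \<Longrightarrow>
      ap \<theta> (if j < length xs then xs ! j else formals K ! j) = ap \<theta>' (if j < length ys then ys ! j else formals K ! j)"
  shows "called \<theta> K xs = called \<theta>' K ys"
  unfolding called_def
proof (rule subst_cong)
  fix f assume "f \<in> fn (body K)"
  then obtain j where j: "j < length (formals K)" "f = formals K ! j"
    using eqs_nf(2)[OF assms(1)] by (auto simp: in_set_conv_nth)
  show "(ap \<theta> \<circ> ap (map_of (zip (formals K) xs))) f = (ap \<theta>' \<circ> ap (map_of (zip (formals K) ys))) f"
    using assms(2)[OF j(1)] ap_zip_nth[OF distinct_formals[OF assms(1)] j(1)] by (simp add: j(2))
qed

text \<open>With all arguments present this is literally the reduct that \<open>react\<close>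
  assigns to the instantiated call.\<close>

lemma called_full:
  assumes "K \<in> idents" "length xs = length (formals K)"
  shows "called \<theta> K xs = subst_map (map_of (zip (formals K) (map (ap \<theta>) xs))) (body K)"
  unfolding called_def subst_map_ap
proof (rule subst_cong)
  fix f assume "f \<in> fn (body K)"
  then obtain j where j: "j < length (formals K)" "f = formals K ! j"
    using eqs_nf(2)[OF assms(1)] by (auto simp: in_set_conv_nth)
  show "(ap \<theta> \<circ> ap (map_of (zip (formals K) xs))) f = ap (map_of (zip (formals K) (map (ap \<theta>) xs))) f"
    using ap_zip_nth[OF distinct_formals[OF assms(1)] j(1)] j assms(2) by simp
qed

lemma called_Nil: "called \<theta> K [] = subst_map \<theta> (body K)"
proof -
  have "ap \<theta> \<circ> ap (map_of (zip (formals K) [])) = ap \<theta>" by (auto simp: ap_def)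
  then show ?thesis by (simp add: called_def subst_map_ap)
qed

text \<open>The formal at position \<open>length xs\<close> is now read from its own value instead
  of through \<open>x\<close>, and both hold \<open>a\<close>. Freshness of that formal protects the
  arguments still to be passed.\<close>

lemma called_call1:
  assumes "pl_ok i (Call K (xs @ [x]), l)" "length xs < length (formals K)" "\<theta> x = Some a"
  shows "called (\<theta>(formals K ! length xs \<mapsto> a)) K xs = called \<theta> K (xs @ [x])"
proof -
  let ?f = "formals K ! length xs"
  from assms obtain K0 where K0: "K0 \<in> thread_idents F i" "call_ok K0 K (xs @ [x]) l"
    by (auto simp: pl_ok_def)
  note K = call_ok_facts(2)[OF K0(2)]
  have f: "?f \<notin> set (xs @ [x])" using call1_formal(3)[OF assms(1,2)] by auto
  show ?thesis
  proof (rule called_cong[OF K])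
    fix j assume j: "j < length (formals K)"
    consider "j < length xs" | "j = length xs" | "j > length xs" by linarith
    then show "ap (\<theta>(?f \<mapsto> a)) (if j < length xs then xs ! j else formals K ! j) =
      ap \<theta> (if j < length (xs @ [x]) then (xs @ [x]) ! j else formals K ! j)"
    proof cases
      case 1
      then have "xs ! j \<noteq> ?f" using f by (metis UnCI nth_mem set_append)
      then show ?thesis using 1 by (simp add: ap_def nth_append)
    next
      case 2
      then show ?thesis using assms(3) by (simp add: ap_def)
    next
      case 3
      then have "formals K ! j \<noteq> ?f"
        using distinct_formals[OF K] j assms(2) by (simp add: nth_eq_iff_index_eq)
      then show ?thesis using 3 by (simp add: ap_def nth_append)
    qed
  qed
qed

text \<open>The unmapped name belongs to the caller and is not among the formals of the
  callee.\<close>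

lemma called_call2:
  assumes "pl_ok i (Call K [], x # l)"
  shows "called (\<theta>(x := None)) K [] = called \<theta> K []"
proof -
  from assms obtain K0 where K0: "call_ok K0 K [] (x # l)" by (auto simp: pl_ok_def)
  have "x \<notin> set (formals K)" using call_ok_facts(5)[OF K0] K0 by (auto simp: call_ok_def names_def)
  then show ?thesis using call_ok_facts(2)[OF K0] by (intro called_cong) (auto simp: ap_def)
qed

lemma place_proc_cong:
  assumes "pl_ok i q" "\<And>x. x \<in> place_dom q \<Longrightarrow> \<theta> x = \<theta>' x"
  shows "place_proc \<theta> q = place_proc \<theta>' q"
proof (cases "is_call (fst q)")
  case True
  then obtain K xs l where q: "q = (Call K xs, l)" by (cases q; cases "fst q") auto
  from assms(1) obtain K0 where K0: "call_ok K0 K xs l" by (auto simp: pl_ok_def q)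
  have "called \<theta> K xs = called \<theta>' K xs"
  proof (rule called_cong[OF call_ok_facts(2)[OF K0]])
    fix j assume j: "j < length (formals K)"
    have "(if j < length xs then xs ! j else formals K ! j) \<in> place_dom q"
    proof (cases "j < length xs")
      case False
      then have "formals K ! j \<in> set (drop (length xs) (formals K))" using j by (intro nth_in_drop) auto
      then show ?thesis using False by (simp add: q)
    qed (simp add: q)
    then show "ap \<theta> (if j < length xs then xs ! j else formals K ! j) =
        ap \<theta>' (if j < length xs then xs ! j else formals K ! j)"
      using assms(2) by (simp add: ap_def)
  qed
  moreover have "subst_map \<theta> (Call K xs) = subst_map \<theta>' (Call K xs)"
    unfolding subst_map_ap by (rule subst_cong) (use assms(2) in \<open>auto simp: q ap_def\<close>)
  ultimately show ?thesis by (simp add: q)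
next
  case False
  then have "place_proc \<theta> q = subst_map \<theta> (fst q)" for \<theta> by (cases q; cases "fst q") auto
  moreover have "place_dom q = fn (fst q) \<union> set (snd q)" using False by (cases q; cases "fst q") auto
  moreover have "subst_map \<theta> (fst q) = subst_map \<theta>' (fst q)"
    unfolding subst_map_ap by (rule subst_cong) (use assms(2) calculation(2) in \<open>auto simp: ap_def\<close>)
  ultimately show ?thesis by simp
qed

lemma fresh_settled: "fresh_ok K (Call K' xs) l \<Longrightarrow> settled_place F NEW (Call K' xs, l)"
proof -
  assume *: "fresh_ok K (Call K' xs) l"
  then have "K' \<in> idents" "length (formals K') = length xs"
    using eqs_nf(6)[of K K' "length xs"] by (auto simp: fresh_ok_def)
  then have "stable_place F (Call K' xs, l)" using eqsI[of K'] by auto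
  then show ?thesis using * by (simp add: settled_place_def fresh_ok_def)
qed

lemma settled_pending: "settled_place F NEW (Call K xs, l) \<Longrightarrow> pending K xs l"
  unfolding pending_def by (metis append_Nil)

lemma place_proc_fresh: "fresh_ok K S l \<Longrightarrow> place_proc \<theta> (S, l) = subst_map \<theta> S"
  using fresh_settled settled_pending by (cases S) auto

lemma place_proc_settled: "settled_place F NEW (S, l) \<Longrightarrow> place_proc \<theta> (S, l) = subst_map \<theta> S"
  using settled_pending by (cases S) auto

lemma settled_length: "settled_place F NEW (Call K xs, l) \<Longrightarrow> length xs = length (formals K)"
  using eqsD by (auto simp: settled_place_def)

lemma not_pending: "length xs \<noteq> length (formals K) \<Longrightarrow> \<not> pending K xs l"
  using settled_length unfolding pending_def by blast

text \<open>A new name outside the range of \<open>\<theta>\<close> therefore occurs in no thread,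
  which licenses the scope extrusion at an allocation.\<close>

lemma fn_place_proc:
  assumes "pl_ok i q" "place_dom q \<subseteq> dom \<theta>"
  shows "fn (place_proc \<theta> q) \<subseteq> ran \<theta>"
proof (cases "is_call (fst q)")
  case True
  then obtain K xs l where q: "q = (Call K xs, l)" by (cases q; cases "fst q") auto
  from assms(1) obtain K0 where K0: "call_ok K0 K xs l" by (auto simp: pl_ok_def q)
  note K = call_ok_facts(2)[OF K0]
  have ran: "ap \<theta> x \<in> ran \<theta>" if "x \<in> place_dom q" for x
    using assms(2) that by (intro ap_ran) auto
  have "fn (called \<theta> K xs) \<subseteq> ran \<theta>"
  proof
    fix y assume "y \<in> fn (called \<theta> K xs)"
    then obtain j where j: "j < length (formals K)"
      "y = ap \<theta> (ap (map_of (zip (formals K) xs)) (formals K ! j))"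
      using eqs_nf(2)[OF K] by (auto simp: called_def in_set_conv_nth)
    have "ap (map_of (zip (formals K) xs)) (formals K ! j) \<in> place_dom q"
    proof (cases "j < length xs")
      case False
      then have "formals K ! j \<in> set (drop (length xs) (formals K))" using j by (intro nth_in_drop) auto
      then show ?thesis using False ap_zip_nth[OF distinct_formals[OF K] j(1)] by (simp add: q)
    qed (use ap_zip_nth[OF distinct_formals[OF K] j(1)] in \<open>simp add: q\<close>)
    then show "y \<in> ran \<theta>" using ran j by blast
  qed
  moreover have "fn (subst_map \<theta> (Call K xs)) \<subseteq> ran \<theta>" unfolding subst_map_ap using ran by (auto simp: q)
  ultimately show ?thesis by (simp add: q)
next
  case False
  then have "place_proc \<theta> q = subst_map \<theta> (fst q)" by (cases q; cases "fst q") auto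
  moreover have "place_dom q = fn (fst q) \<union> set (snd q)" using False by (cases q; cases "fst q") auto
  ultimately show ?thesis using assms(2) unfolding subst_map_ap by (auto intro!: ap_ran)
qed

lemma place_proc_other:
  assumes "inv s \<theta>" "i < n_threads F" "j < n_threads F" "j \<noteq> i"
    "\<And>x. x \<notin> thread_names i \<Longrightarrow> \<theta>' x = \<theta> x"
  shows "place_proc \<theta> (s j) = place_proc \<theta>' (s j)"
proof -
  have ok: "pl_ok j (s j)" using assms(1,3) by (simp add: inv_def)
  have "\<theta> x = \<theta>' x" if "x \<in> place_dom (s j)" for x
  proof -
    have "x \<notin> thread_names i"
      using place_dom_names[OF ok] that thread_names_disjoint[OF assms(3,2,4)] by blast
    then show ?thesis using assms(5) by metis
  qed
  with ok show ?thesis by (rule place_proc_cong)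
qed

lemma mset_map_remove1: "i \<in> set xs \<Longrightarrow> mset (map T xs) = add_mset (T i) (mset (map T (remove1 i xs)))"
  by (induction xs) auto

lemma par_list_split: "i < n \<Longrightarrow> par_list (map T [0..<n]) \<cong> Par (T i) (par_list (map T (remove1 i [0..<n])))"
proof -
  assume "i < n"
  then have "par_list (map T [0..<n]) \<cong> par_list (T i # map T (remove1 i [0..<n]))"
    using mset_map_remove1[of i "[0..<n]" T] by (intro par_list_perm) simp
  also have "\<dots> \<cong> Par (T i) (par_list (map T (remove1 i [0..<n])))" by (rule par_list_Cons)
  finally show ?thesis .
qed

lemma par_list_split2:
  assumes "i < n" "j < n" "i \<noteq> j"
  shows "par_list (map T [0..<n]) \<cong> Par (Par (T j) (T i)) (par_list (map T (remove1 i (remove1 j [0..<n]))))"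
proof -
  let ?r = "remove1 i (remove1 j [0..<n])"
  have "i \<in> set (remove1 j [0..<n])" "j \<in> set [0..<n]" using assms by (simp_all add: set_remove1_eq)
  then have "mset (map T [0..<n]) = mset (T j # T i # map T ?r)"
    by (simp only: mset_map_remove1[of j "[0..<n]"] mset_map_remove1[of i "remove1 j [0..<n]"] mset.simps)
  then have "par_list (map T [0..<n]) \<cong> par_list (T j # T i # map T ?r)" by (rule par_list_perm)
  also have "\<dots> \<cong> Par (Par (T j) (T i)) (par_list (map T ?r))"
    using par_list_append[of "[T j, T i]" "map T ?r"] by simp
  finally show ?thesis .
qed

lemma map_remove1_cong:
  "(\<And>j. j < n \<Longrightarrow> j \<noteq> i \<Longrightarrow> T j = T' j) \<Longrightarrow> map T (remove1 i [0..<n]) = map T' (remove1 i [0..<n])"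
  by (auto simp: set_remove1_eq)

lemma react_nu: "react E P Q \<Longrightarrow> react E (nu A P) (nu A Q)"
proof -
  have "react E P Q \<Longrightarrow> react E (res_list rs P) (res_list rs Q)" for rs
    by (induction rs) (auto intro: react.res)
  then show "react E P Q \<Longrightarrow> react E (nu A P) (nu A Q)" by (simp add: nu_def)
qed

lemma mark_proc_cong:
  assumes "i < n_threads F" "\<And>j. j < n_threads F \<Longrightarrow> j \<noteq> i \<Longrightarrow> place_proc \<theta> (s j) = place_proc \<theta>' (s' j)"
    "place_proc \<theta> (s i) \<cong> place_proc \<theta>' (s' i)"
  shows "mark_proc s \<theta> \<cong> mark_proc s' \<theta>'"
  unfolding mark_proc_def
proof (intro nu_cong par_list_cong)
  have "place_proc \<theta> (s j) \<cong> place_proc \<theta>' (s' j)" if "j < n_threads F" for j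
    using assms that scong.refl by metis
  then show "list_all2 (\<cong>) (map (\<lambda>i. place_proc \<theta> (s i)) [0..<n_threads F])
      (map (\<lambda>i. place_proc \<theta>' (s' i)) [0..<n_threads F])"
    by (simp add: list_all2_conv_all_nth)
qed

lemma mark_proc_react:
  assumes "i < n_threads F" "\<And>j. j < n_threads F \<Longrightarrow> j \<noteq> i \<Longrightarrow> place_proc \<theta> (s j) = place_proc \<theta>' (s' j)"
    "react (eqs F) (place_proc \<theta> (s i)) (place_proc \<theta>' (s' i))"
  shows "react (eqs F) (mark_proc s \<theta>) (mark_proc s' \<theta>')"
  unfolding mark_proc_def
proof (intro react_nu)
  let ?T = "\<lambda>i. place_proc \<theta> (s i)" and ?T' = "\<lambda>i. place_proc \<theta>' (s' i)" and ?n = "n_threads F"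
  have eq: "map ?T (remove1 i [0..<?n]) = map ?T' (remove1 i [0..<?n])"
    using assms(2) by (rule map_remove1_cong)
  have "react (eqs F) (Par (?T i) (par_list (map ?T (remove1 i [0..<?n]))))
     (Par (?T' i) (par_list (map ?T' (remove1 i [0..<?n]))))"
    unfolding eq using assms(3) by (rule react.par)
  from react.struct[OF par_list_split[OF assms(1), of ?T] this scong.sym[OF par_list_split[OF assms(1), of ?T']]]
  show "react (eqs F) (par_list (map ?T [0..<?n])) (par_list (map ?T' [0..<?n]))" .
qed

lemma ap_upd: "\<theta> x = None \<Longrightarrow> ap (\<theta>(x \<mapsto> a)) = (ap \<theta>)(x := a)"
  by (auto simp: ap_def)

lemma mark_proc_nu:
  assumes inv: "inv s \<theta>" and i: "i < n_threads F" and si: "s i = (Res r S, l)"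
    and m: "m \<in> NEW" "m \<notin> ran \<theta>" and step: "lstep \<theta> (s i) C (S, l) (\<theta>(r \<mapsto> m))"
  shows "mark_proc s \<theta> \<cong> mark_proc (s(i := (S, l))) (\<theta>(r \<mapsto> m))"
proof -
  let ?\<theta> = "\<theta>(r \<mapsto> m)" and ?s = "s(i := (S, l))" and ?n = "n_threads F"
  let ?T = "\<lambda>i. place_proc \<theta> (s i)" and ?T' = "\<lambda>i. place_proc ?\<theta> (?s i)"
  have ok: "pl_ok i (Res r S, l)" "dom \<theta> \<inter> thread_names i = place_dom (Res r S, l)"
    using inv i si by (auto simp: inv_def dest: spec[of _ i])
  note r = Res_binder[OF ok(1)]
  have \<theta>r: "\<theta> r = None" using notin_dom[OF ok(2) r(2,3)] .
  have others: "?T j = ?T' j" if j: "j < ?n" "j \<noteq> i" for j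
  proof -
    have "?\<theta> x = \<theta> x" if "x \<notin> thread_names i" for x using r(2) that by auto
    from place_proc_other[where \<theta>' = ?\<theta>, OF inv i j this] show ?thesis using j by simp
  qed
  obtain K where K: "K \<in> thread_idents F i" "fresh_ok K (Res r S) l" using ok by (auto simp: pl_ok_def)
  have "((Res r S, l), (S, l)) \<in> cf_step F NEW"
    using cf_stepI[OF cf_trans.nu[OF m(1)]] .
  then have "fresh_ok K S l" using fresh_ok_Res K by blast
  then have T'i: "?T' i = subst ((ap \<theta>)(r := m)) S"
    by (simp add: place_proc_fresh subst_map_ap ap_upd[of \<theta> r m, OF \<theta>r])
  have "m \<notin> ap \<theta> ` (fn S - {r})"
  proof
    assume "m \<in> ap \<theta> ` (fn S - {r})"
    then obtain x where x: "x \<in> fn S - {r}" "m = ap \<theta> x" by blast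
    then have "x \<in> dom \<theta>" using inv_dom[OF inv i] si by auto
    then show False using x m(2) by (auto simp: ap_def ran_def)
  qed
  then have Ti: "?T i \<cong> Res m (?T' i)"
    unfolding T'i by (simp add: si subst_map_ap del: subst.simps) (rule subst_Res)
  let ?R = "par_list (map ?T (remove1 i [0..<?n]))"
  have R: "?R = par_list (map ?T' (remove1 i [0..<?n]))"
    using map_remove1_cong[of ?n i ?T ?T'] others by metis
  have mR: "m \<notin> fn ?R"
  proof
    assume "m \<in> fn ?R"
    then obtain j where "j \<in> set (remove1 i [0..<?n])" and mj: "m \<in> fn (?T j)"
      unfolding fn_par_list set_map by blast
    then have j: "j < ?n" by (simp add: set_remove1_eq)
    have "pl_ok j (s j)" "place_dom (s j) \<subseteq> dom \<theta>" using inv j inv_dom[OF inv] by (auto simp: inv_def)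
    then show False using fn_place_proc mj m(2) by blast
  qed
  have "par_list (map ?T [0..<?n]) \<cong> Par (?T i) ?R" using i by (rule par_list_split)
  also have "\<dots> \<cong> Par ?R (?T i)" by (rule scong.par_comm)
  also have "\<dots> \<cong> Par ?R (Res m (?T' i))" by (intro scong.cong_par scong.refl Ti)
  also have "\<dots> \<cong> Res m (Par ?R (?T' i))" using mR by (rule scong.sym[OF scong.res_extrude])
  also have "\<dots> \<cong> Res m (Par (?T' i) ?R)" by (intro scong.cong_res scong.par_comm)
  also have "\<dots> \<cong> Res m (par_list (map ?T' [0..<?n]))"
    unfolding R using i by (intro scong.cong_res scong.sym[OF par_list_split])
  finally have "mark_proc s \<theta> \<cong> nu NEW (Res m (par_list (map ?T' [0..<?n])))"
    unfolding mark_proc_def by (rule nu_cong)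
  also have "\<dots> = nu NEW (nu {m} (par_list (map ?T' [0..<?n])))" by (simp add: nu_def)
  also have "\<dots> \<cong> nu (NEW \<union> {m}) (par_list (map ?T' [0..<?n]))"
    by (rule scong.sym[OF nu_Un]) auto
  \<comment> \<open>All new names are restricted from the outset, so the extruded restriction is
    absorbed.\<close>
  also have "NEW \<union> {m} = NEW" using m by auto
  finally show ?thesis by (simp only: mark_proc_def)
qed

lemma place_proc_tau:
  assumes "pl_ok i (Sum bs, l)" "(Tau, S) \<in> set bs"
  shows "place_proc \<theta> (S, l @ dropped bs S) = subst (ap \<theta>) S"
proof -
  obtain K where K: "fresh_ok K (Sum bs) l" using assms(1) by (auto simp: pl_ok_def)
  have "((Sum bs, l), (S, l @ dropped bs S)) \<in> cf_step F NEW"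
    using assms(2) by (intro cf_stepI[OF cf_trans.tau])
  then have "fresh_ok K S (l @ dropped bs S)" using fresh_ok_Sum[OF K assms(2)] by blast
  then show ?thesis using place_proc_fresh by (simp add: subst_map_ap)
qed

text \<open>The received name lies among the names of thread \<open>j\<close>, so the update does
  not reach the continuation of the sender.\<close>

lemma place_proc_comm:
  assumes inv: "inv s \<theta>" and ij: "i < n_threads F" "j < n_threads F" "i \<noteq> j"
    and si: "s i = (Sum bs, l)" "s j = (Sum cs, l')"
    and br: "(Send x y, S) \<in> set bs" "(Recv x' y', S') \<in> set cs"
    and \<theta>: "\<theta> x = Some a" "\<theta> y = Some b" "\<theta> x' = Some a"
  shows "place_proc (\<theta>(y' \<mapsto> b)) (S, l @ dropped bs S) = subst (ap \<theta>) S"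
    "place_proc (\<theta>(y' \<mapsto> b)) (S', l' @ dropped cs S') = subst ((ap \<theta>)(y' := b)) S'"
proof -
  let ?\<theta> = "\<theta>(y' \<mapsto> b)"
  have ok: "pl_ok i (s i)" "pl_ok j (s j)" "dom \<theta> \<inter> thread_names j = place_dom (s j)" "subst_ok \<theta>"
    using inv ij by (auto simp: inv_def)
  have step: "cstep \<theta> a b (s i) {Test x a, Test y b} (S, l @ dropped bs S)
      (s j) {Test x' a, MapTo y' b} (S', l' @ dropped cs S') ?\<theta>"
    unfolding si using br \<theta> by (rule cstep.intros)
  have yj: "y' \<in> thread_names j" "y' \<notin> place_dom (s j)"
    using Recv_binder(2,3)[OF ok(2)[unfolded si(2)] br(2)] si by auto
  have \<theta>y: "\<theta> y' = None" using notin_dom[OF ok(3) yj] .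
  obtain K where K: "fresh_ok K (Sum bs) l" using ok(1) by (auto simp: pl_ok_def si)
  obtain L where L: "fresh_ok L (Sum cs) l'" using ok(2) by (auto simp: pl_ok_def si)
  note steps = cstep_cf_trans[OF step ok(4), THEN cf_stepI]
  have K': "fresh_ok K S (l @ dropped bs S)" using fresh_ok_Sum[OF K br(1)] steps(1) by (simp add: si)
  have L': "fresh_ok L S' (l' @ dropped cs S')" using fresh_ok_Sum[OF L br(2)] steps(2) by (simp add: si)
  show "place_proc ?\<theta> (S', l' @ dropped cs S') = subst ((ap \<theta>)(y' := b)) S'"
    using place_proc_fresh[OF L'] ap_upd[of \<theta> y' b, OF \<theta>y] by (simp add: subst_map_ap)
  have "pl_ok i (S, l @ dropped bs S)" using inv_cstep(1)[OF inv ij step] ij by (auto simp: inv_def)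
  then have "place_dom (S, l @ dropped bs S) \<subseteq> thread_names i" by (rule place_dom_names)
  then have "y' \<notin> fn S"
    using yj(1) thread_names_disjoint[OF ij] unfolding fresh_dom[OF K'] by blast
  then have "subst (ap ?\<theta>) S = subst (ap \<theta>) S" by (intro subst_cong) (auto simp: ap_def)
  then show "place_proc ?\<theta> (S, l @ dropped bs S) = subst (ap \<theta>) S"
    using place_proc_fresh[OF K'] by (simp add: subst_map_ap)
qed

text \<open>A local step is a reaction only for a \<open>Tau\<close> branch or when a call leaves
  its last settled place. The conjunct \<open>settled_place\<close> records that this cannot happen
  in housekeeping.\<close>

lemma lstep_mark_proc:
  assumes inv: "inv s \<theta>" and i: "i < n_threads F" and step: "lstep \<theta> (s i) C q' \<theta>'"
  shows "mark_proc s \<theta> \<cong> mark_proc (s(i := q')) \<theta>' \<or>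
    settled_place F NEW (s i) \<and> react (eqs F) (mark_proc s \<theta>) (mark_proc (s(i := q')) \<theta>')"
proof -
  let ?s = "s(i := q')" and ?n = "n_threads F"
  have ok: "pl_ok i (s i)" using inv i by (simp add: inv_def)
  have others: "place_proc \<theta> (s j) = place_proc \<theta>' (?s j)" if j: "j < ?n" "j \<noteq> i" for j
    using place_proc_other[OF inv i j inv_lstep(2)[OF inv i step]] j by simp
  have same: ?thesis if "place_proc \<theta> (s i) = place_proc \<theta>' q'"
    using mark_proc_cong[of i \<theta> s \<theta>' ?s] i others that scong.refl by simp
  have react: ?thesis if "settled_place F NEW (s i)" "react (eqs F) (place_proc \<theta> (s i)) (place_proc \<theta>' q')"
    using mark_proc_react[of i \<theta> s \<theta>' ?s] i others that by simp
  have call_react: "react (eqs F) (place_proc \<theta> (Call K xs, l)) (called \<theta> K xs)"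
    if "pending K xs l" "K \<in> idents" for K xs l
  proof -
    have len: "length xs = length (formals K)" using that not_pending by blast
    then have "react (eqs F) (Call K (map (ap \<theta>) xs)) (subst_map (map_of (zip (formals K) (map (ap \<theta>) xs))) (body K))"
      using eqsI[OF that(2)] by (intro react.call) auto
    then show ?thesis using that called_full[OF that(2) len] by (simp add: subst_map_ap)
  qed
  show ?thesis using step
  proof cases
    case (nu m r S l)
    then show ?thesis using mark_proc_nu[OF inv i _ nu(5,6)] step by metis
  next
    case (tau S bs l)
    have "place_proc \<theta>' q' = subst (ap \<theta>) S"
      using place_proc_tau ok tau by metis
    moreover have "place_proc \<theta> (s i) = Sum (map (subst_branch (ap \<theta>)) bs)"
      by (simp add: tau subst_map_ap)
    moreover have "(Tau, subst (ap \<theta>) S) \<in> set (map (subst_branch (ap \<theta>)) bs)"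
      using tau(5) by (metis imageI list.set_map subst_branch.simps(1))
    ultimately show ?thesis using react settled_Sum ok tau by (metis react.tau)
  next
    case (call1 K xs x a l)
    have np: "\<not> pending K xs l'" for l' using call1(6) by (intro not_pending) simp
    have eq: "place_proc \<theta>' q' = called \<theta> K (xs @ [x])"
      using np called_call1[where \<theta> = \<theta> and a = a, OF ok[unfolded call1(1)] call1(6,7)]
        by (simp add: call1)
    show ?thesis
    proof (cases "pending K (xs @ [x]) l")
      case True
      \<comment> \<open>A pending call has its full argument list. Since this list is not empty,
        \<open>call_ok\<close> makes the place itself settled, so passing the first argument
        performs the reaction.\<close>
      then have "length (xs @ [x]) = length (formals K)" using not_pending by blast
      then have "settled_place F NEW (s i)"
        using ok eqsI[OF call1(5)] by (auto simp: call1 pl_ok_def call_ok_def settled_place_def)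
      then show ?thesis using react eq call_react[OF True call1(5)] call1(1) by metis
    next
      case False
      then show ?thesis using same eq by (simp add: call1)
    qed
  next
    case (call2 x a K l)
    have K: "K \<in> idents" using ok call_ok_facts(2) by (auto simp: call2 pl_ok_def)
    have eq: "called \<theta>' K [] = called \<theta> K []"
      using called_call2[OF ok[unfolded call2(1)]] by (simp add: call2)
    \<comment> \<open>A suffix of \<open>x # l\<close> is the list itself or a suffix of
      \<open>l\<close>. So the process changes precisely when the current place is settled and no
      settled place lies ahead.\<close>
    have pend: "pending K [] (x # l) \<longleftrightarrow> settled_place F NEW (Call K [], x # l) \<or> pending K [] l"
      unfolding pending_def by (metis append_Cons append_Nil append_eq_Cons_conv)
    show ?thesis
    proof (cases "pending K [] l")
      case True
      then have "place_proc \<theta> (s i) = place_proc \<theta>' q'" using pend by (simp add: call2 subst_map_ap)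
      then show ?thesis by (rule same)
    next
      case F: False
      show ?thesis
      proof (cases "settled_place F NEW (s i)")
        case True
        then have "react (eqs F) (place_proc \<theta> (s i)) (called \<theta> K [])"
          using call_react[of K "[]" "x # l"] pend K by (simp add: call2)
        then show ?thesis using react True F eq by (simp add: call2)
      next
        case False
        then have "place_proc \<theta> (s i) = place_proc \<theta>' q'" using F pend eq by (simp add: call2)
        then show ?thesis by (rule same)
      qed
    qed
  next
    case (call3 K)
    have eq: "place_proc \<theta>' q' = called \<theta> K []"
      using place_proc_fresh[OF fresh_ok_body[OF call3(5)]] by (simp add: call3 called_Nil)
    have pend: "pending K [] [] \<longleftrightarrow> settled_place F NEW (s i)" unfolding pending_def by (simp add: call3)
    show ?thesis
    proof (cases "settled_place F NEW (s i)")
      case True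
      then show ?thesis using react eq call_react[of K "[]" "[]"] pend call3 by metis
    next
      case False
      then show ?thesis using same eq pend by (simp add: call3)
    qed
  qed
qed

lemma cstep_mark_proc:
  assumes inv: "inv s \<theta>" and ij: "i < n_threads F" "j < n_threads F" "i \<noteq> j"
    and step: "cstep \<theta> a b (s i) C q1' (s j) D q2' \<theta>'"
  shows "react (eqs F) (mark_proc s \<theta>) (mark_proc (s(i := q1', j := q2')) \<theta>')"
  using step
proof cases
  case (1 x y S bs x' y' S' cs l l')
  let ?s = "s(i := q1', j := q2')" and ?n = "n_threads F"
  let ?T = "\<lambda>i. place_proc \<theta> (s i)" and ?T' = "\<lambda>i. place_proc \<theta>' (?s i)"
  have others: "?T k = ?T' k" if k: "k < ?n" "k \<noteq> i" "k \<noteq> j" for k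
    using place_proc_other[OF inv ij(2) k(1,3) inv_cstep(2)[OF inv ij step]] k by simp
  have Ti: "?T i = Sum (map (subst_branch (ap \<theta>)) bs)" and Tj: "?T j = Sum (map (subst_branch (ap \<theta>)) cs)"
    by (simp_all add: 1 subst_map_ap)
  have T'i: "?T' i = subst (ap \<theta>) S" and T'j: "?T' j = subst ((ap \<theta>)(y' := b)) S'"
    using place_proc_comm[OF inv ij 1(1,4,8-12)] ij 1(3,6,7) by simp_all
  let ?z = "refresh y' (ap \<theta> ` (fn S' - {y'}))"
  have "(Recv a ?z, subst ((ap \<theta>)(y' := ?z)) S') \<in> set (map (subst_branch (ap \<theta>)) cs)"
    using 1(9) ap_Some[of \<theta> x' a, OF 1(12)] by (metis imageI list.set_map subst_branch.simps(3))
  moreover have "(Send a b, subst (ap \<theta>) S) \<in> set (map (subst_branch (ap \<theta>)) bs)"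
    using 1(8) ap_Some[of \<theta> x a, OF 1(10)] ap_Some[of \<theta> y b, OF 1(11)]
      by (metis imageI list.set_map subst_branch.simps(2))
  ultimately have "react (eqs F) (Par (?T j) (?T i))
      (Par (rename1 (subst ((ap \<theta>)(y' := ?z)) S') b ?z) (subst (ap \<theta>) S))"
    unfolding Ti Tj by (rule react.comm)
  moreover have "rename1 (subst ((ap \<theta>)(y' := ?z)) S') b ?z \<cong> ?T' j"
    unfolding T'j by (rule rename_subst) (rule refresh_notin)
  ultimately have r: "react (eqs F) (Par (?T j) (?T i)) (Par (?T' j) (?T' i))"
    unfolding T'i by (meson react.struct scong.cong_par scong.refl)
  let ?r = "remove1 i (remove1 j [0..<?n])"
  have R: "map ?T ?r = map ?T' ?r" using others by (auto simp: set_remove1_eq)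
  note split = par_list_split2[OF ij]
  have "react (eqs F) (Par (Par (?T j) (?T i)) (par_list (map ?T ?r)))
      (Par (Par (?T' j) (?T' i)) (par_list (map ?T' ?r)))"
    unfolding R using r by (rule react.par)
  from react.struct[OF split[of ?T] this scong.sym[OF split[of ?T']]]
  show ?thesis unfolding mark_proc_def by (rule react_nu)
qed

end

context fcp_spec
begin

subsection \<open>Progress of housekeeping\<close>

fun res_depth :: "proc \<Rightarrow> nat" where
  "res_depth (Res r S) = Suc (res_depth S)"
| "res_depth _ = 0"

text \<open>Exceeds the number of leading restrictions of every body, so that entering a body lowers
  the measure.\<close>

definition depth_bound :: nat where
  "depth_bound = Suc (\<Sum>e\<leftarrow>eqs F. res_depth (snd (snd e)))"

text \<open>An argument weighs two because passing it may append one name to the list of names to be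
  unmapped. Settled calls weigh nothing, as housekeeping stops there.\<close>

fun meas :: "aug \<Rightarrow> nat" where
  "meas (Call K xs, l) =
     (if settled_place F NEW (Call K xs, l) then 0 else depth_bound + 2 * length xs + length l)"
| "meas (S, l) = res_depth S"

lemma res_depth_body: "K \<in> idents \<Longrightarrow> res_depth (body K) < depth_bound"
proof -
  assume "K \<in> idents"
  then have "res_depth (body K) \<in> set (map (\<lambda>e. res_depth (snd (snd e))) (eqs F))"
    using eqsI by force
  then have "res_depth (body K) \<le> (\<Sum>e\<leftarrow>eqs F. res_depth (snd (snd e)))"
    by (intro member_le_sum_list) simp_all
  then show ?thesis by (simp add: depth_bound_def)
qed

lemma meas_fresh: "fresh_ok K S l \<Longrightarrow> meas (S, l) \<le> res_depth S"
  using fresh_settled by (cases S) auto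

text \<open>A restricted name about to be allocated is not in use itself, so fewer than \<open>card NEW\<close>
  names are.\<close>

lemma ex_unused_new:
  assumes "subst_ok \<theta>" "r \<in> RESTR F" "\<theta> r = None"
  shows "\<exists>m\<in>NEW. m \<notin> ran \<theta>"
proof (rule ccontr)
  let ?V = "RESTR F \<union> INP F \<union> FRM F"
  assume "\<not> ?thesis"
  then have "NEW \<subseteq> ran \<theta>" by blast
  moreover have "ran \<theta> = (\<lambda>x. the (\<theta> x)) ` dom \<theta>" by (force simp: ran_def)
  moreover have dom: "dom \<theta> \<subseteq> ?V - {r}" using assms by (auto simp: subst_ok_def)
  then have fin: "finite (dom \<theta>)" by (rule finite_subset) simp
  ultimately have "card NEW \<le> card (dom \<theta>)" by (metis card_image_le card_mono finite_imageI le_trans)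
  also have "\<dots> \<le> card (?V - {r})" using dom by (intro card_mono) auto
  also have "\<dots> < card ?V" using assms(2) by (intro psubset_card_mono) auto
  also have "\<dots> \<le> card (RESTR F) + card (INP F) + card (FRM F)"
    by (meson add_le_mono1 card_Un_le le_trans)
  finally show False using nn by (simp add: new_names_def)
qed

lemma ex_lstep:
  assumes inv: "inv s \<theta>" and i: "i < n_threads F" and ns: "\<not> settled_place F NEW (s i)"
  shows "\<exists>C q' \<theta>'. lstep \<theta> (s i) C q' \<theta>' \<and> meas q' < meas (s i)"
proof -
  have ok: "pl_ok i (s i)" "dom \<theta> \<inter> thread_names i = place_dom (s i)" "subst_ok \<theta>"
    using inv i by (auto simp: inv_def)
  obtain K where K: "K \<in> thread_idents F i" "place_ok K (s i)" using ok(1) by (auto simp: pl_ok_def)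
  obtain S l where q: "s i = (S, l)" by force
  show ?thesis
  proof (cases S)
    case (Call K' xs)
    have c: "call_ok K K' xs l" using K(2) by (simp add: q Call)
    note K' = call_ok_facts(2)[OF c]
    show ?thesis
    proof (cases xs rule: rev_cases)
      case (snoc ys x)
      then have "x \<in> dom \<theta>" using inv_dom[OF inv i] by (simp add: q Call)
      then obtain a where "\<theta> x = Some a" by auto
      moreover have "length ys < length (formals K')" using c by (simp add: snoc call_ok_def)
      ultimately have "lstep \<theta> (s i) {Test x a, MapTo (formals K' ! length ys) a}
          (Call K' ys, if x \<in> set l then l else l @ [x]) (\<theta>(formals K' ! length ys \<mapsto> a))"
        unfolding q Call snoc using K' by (intro lstep.call1)
      moreover have "meas (Call K' ys, if x \<in> set l then l else l @ [x]) < meas (s i)"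
        using ns by (auto simp: q Call snoc depth_bound_def)
      ultimately show ?thesis by blast
    next
      case Nil
      show ?thesis
      proof (cases l)
        case (Cons x l')
        then have "x \<in> dom \<theta>" using inv_dom[OF inv i] by (simp add: q Call)
        then obtain a where "\<theta> x = Some a" by auto
        then have "lstep \<theta> (s i) {Unmap x a} (Call K' [], l') (\<theta>(x := None))"
          unfolding q Call Nil Cons by (rule lstep.call2)
        moreover have "meas (Call K' [], l') < meas (s i)"
          using ns by (auto simp: q Call Nil Cons depth_bound_def)
        ultimately show ?thesis by blast
      next
        case l: Nil
        have "lstep \<theta> (s i) {} (body K', []) \<theta>" unfolding q Call Nil l using K' by (rule lstep.call3)
        moreover have "meas (body K', []) < meas (s i)"
          using meas_fresh[OF fresh_ok_body[OF K']] res_depth_body[OF K'] ns by (simp add: q Call Nil l)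
        ultimately show ?thesis by blast
      qed
    qed
  next
    case (Sum bs)
    then show ?thesis using ns settled_Sum ok(1) q by simp
  next
    case (Res r S')
    note r = Res_binder[OF ok(1)[unfolded q Res]]
    have "\<theta> r = None" using notin_dom[OF ok(2)] r by (simp add: q Res)
    then obtain m where m: "m \<in> NEW" "m \<notin> ran \<theta>" using ex_unused_new[OF ok(3) r(1)] by blast
    then have "lstep \<theta> (s i) {MapTo r m} (S', l) (\<theta>(r \<mapsto> m))" unfolding q Res by (rule lstep.nu)
    moreover have "fresh_ok K S' l"
      using fresh_ok_Res[of K r S' l] K(2) cf_stepI[OF cf_trans.nu[OF m(1)]] by (simp add: q Res)
    then have "meas (S', l) < meas (s i)" using meas_fresh by (simp add: q Res less_Suc_eq_le)
    ultimately show ?thesis by blast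
  next
    case (Par P Q)
    then show ?thesis using K(2) by (simp add: q fresh_ok_def wf_proc_def)
  qed
qed

lemma subst_eq_Sum: "subst \<sigma> S = Sum cs \<Longrightarrow> \<exists>bs. S = Sum bs \<and> cs = map (subst_branch \<sigma>) bs"
  by (cases S) auto

lemma subst_eq_Call: "subst \<sigma> S = Call K as \<Longrightarrow> \<exists>xs. S = Call K xs \<and> as = map \<sigma> xs"
  by (cases S) auto

lemma subst_branch_Tau: "(Tau, S) = subst_branch \<sigma> b \<Longrightarrow> \<exists>S'. b = (Tau, S') \<and> S = subst \<sigma> S'"
  and subst_branch_Send: "(Send a c, S) = subst_branch \<sigma> b \<Longrightarrow>
    \<exists>x y S'. b = (Send x y, S') \<and> a = \<sigma> x \<and> c = \<sigma> y \<and> S = subst \<sigma> S'"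
  and subst_branch_Recv: "(Recv a z, S) = subst_branch \<sigma> b \<Longrightarrow>
    \<exists>x y S'. b = (Recv x y, S') \<and> a = \<sigma> x \<and> z = refresh y (\<sigma> ` (fn S' - {y})) \<and>
      S = subst (\<sigma>(y := z)) S'"
  by (cases b; cases "fst b"; auto)+

lemma mset_map_pick:
  assumes "mset (map T xs) = add_mset y M"
  obtains i where "i \<in> set xs" "T i = y" "M = mset (map T (remove1 i xs))"
proof -
  have "y \<in> set (map T xs)" using assms by (metis set_mset_mset union_single_eq_member)
  then obtain i where i: "i \<in> set xs" "T i = y" by auto
  with assms mset_map_remove1[OF i(1), of T] have "M = mset (map T (remove1 i xs))" by simp
  with i that show thesis by blast
qed

lemma mark_proc_replace:
  assumes "i < n_threads F" "\<And>j. j < n_threads F \<Longrightarrow> j \<noteq> i \<Longrightarrow> place_proc \<theta> (s j) = place_proc \<theta>' (s' j)"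
    "U = place_proc \<theta>' (s' i)"
  shows "nu NEW (par_list (U # map (\<lambda>j. place_proc \<theta> (s j)) (remove1 i [0..<n_threads F])))
    \<cong> mark_proc s' \<theta>'"
proof -
  have eq: "map (\<lambda>j. place_proc \<theta> (s j)) (remove1 i [0..<n_threads F])
      = map (\<lambda>j. place_proc \<theta>' (s' j)) (remove1 i [0..<n_threads F])"
    using assms(2) by (rule map_remove1_cong)
  show ?thesis unfolding mark_proc_def eq assms(3)
    using scong.trans[OF par_list_Cons scong.sym[OF par_list_split[OF assms(1)]]] by (rule nu_cong)
qed

end

section \<open>Completing housekeeping and answering reactions\<close>

context fcp_net_spec
begin

lemma housekeeping_subset: "housekeeping F NEW M\<^sub>s \<subseteq> net_steps N"
  unfolding housekeeping_def net_steps_def Let_def by blast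

text \<open>Each step lowers the total measure, and because it starts from an unsettled place it
  cannot be a reaction.\<close>

lemma progress:
  "inv s \<theta> \<Longrightarrow> \<exists>s' \<theta>'. (mark s \<theta>, mark s' \<theta>') \<in> (housekeeping F NEW M\<^sub>s)\<^sup>* \<and> inv s' \<theta>' \<and>
     (\<forall>i < n_threads F. settled_place F NEW (s' i)) \<and> mark_proc s \<theta> \<cong> mark_proc s' \<theta>'"
proof (induction "\<Sum>i < n_threads F. meas (s i)" arbitrary: s \<theta> rule: less_induct)
  case less
  show ?case
  proof (cases "\<forall>i < n_threads F. settled_place F NEW (s i)")
    case True
    then show ?thesis using less.prems scong.refl by blast
  next
    case False
    then obtain i where i: "i < n_threads F" and ns: "\<not> settled_place F NEW (s i)" by blast
    from ex_lstep[OF less.prems i ns] obtain C q' \<theta>' where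
      step: "lstep \<theta> (s i) C q' \<theta>'" and lt: "meas q' < meas (s i)" by blast
    let ?s = "s(i := q')"
    have "(\<Sum>j < n_threads F. meas (?s j)) < (\<Sum>j < n_threads F. meas (s j))"
      by (rule sum_strict_mono_ex1) (use lt i in auto)
    from less.hyps[OF this inv_lstep(1)[OF less.prems i step]] obtain s' \<theta>'' where
      *: "(mark ?s \<theta>', mark s' \<theta>'') \<in> (housekeeping F NEW M\<^sub>s)\<^sup>*" "inv s' \<theta>''"
      "\<forall>i < n_threads F. settled_place F NEW (s' i)" "mark_proc ?s \<theta>' \<cong> mark_proc s' \<theta>''" by blast
    have "mark_proc s \<theta> \<cong> mark_proc ?s \<theta>'" using lstep_mark_proc[OF less.prems i step] ns by blast
    then have "mark_proc s \<theta> \<cong> mark_proc s' \<theta>''" using *(4) by (rule scong.trans)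
    moreover have "(mark s \<theta>, mark s' \<theta>'') \<in> (housekeeping F NEW M\<^sub>s)\<^sup>*"
      using housekeeping_lstep[OF less.prems i step ns] *(1) by (rule converse_rtrancl_into_rtrancl)
    ultimately show ?thesis using *(2,3) by blast
  qed
qed

text \<open>The call is run to its end without stopping at settled places on the way. The process at
  intermediate places is not followed; \<open>called\<close> is constant along the run and
  suffices.\<close>

lemma run_call:
  assumes "inv s \<theta>" "i < n_threads F" "s i = (Call K xs, l)"
  shows "\<exists>\<theta>'. (mark s \<theta>, mark (s(i := (body K, []))) \<theta>') \<in> (net_steps N)\<^sup>* \<and>
    inv (s(i := (body K, []))) \<theta>' \<and> called \<theta> K xs = subst_map \<theta>' (body K) \<and>
    (\<forall>x. x \<notin> thread_names i \<longrightarrow> \<theta>' x = \<theta> x)"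
  using assms
proof (induction "2 * length xs + length l" arbitrary: s \<theta> xs l rule: less_induct)
  case less
  note i = less.prems(2)
  have ok: "pl_ok i (Call K xs, l)" using less.prems by (metis inv_def)
  then obtain K0 where c: "call_ok K0 K xs l" by (auto simp: pl_ok_def)
  note K = call_ok_facts(2)[OF c]
  have step: ?case if st: "lstep \<theta> (s i) C (Call K xs', l') \<theta>'"
    and lt: "2 * length xs' + length l' < 2 * length xs + length l"
    and eq: "called \<theta>' K xs' = called \<theta> K xs" for C xs' l' \<theta>'
  proof -
    let ?s = "s(i := (Call K xs', l'))"
    note inv = inv_lstep[OF less.prems(1) i st]
    from less.hyps[OF lt inv(1) i] obtain \<theta>'' where
      *: "(mark ?s \<theta>', mark (?s(i := (body K, []))) \<theta>'') \<in> (net_steps N)\<^sup>*"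
      "inv (?s(i := (body K, []))) \<theta>''" "called \<theta>' K xs' = subst_map \<theta>'' (body K)"
      "\<forall>x. x \<notin> thread_names i \<longrightarrow> \<theta>'' x = \<theta>' x" by auto
    have "(mark s \<theta>, mark (s(i := (body K, []))) \<theta>'') \<in> (net_steps N)\<^sup>*"
      using net_steps_lstep[OF less.prems(1) i st] *(1) by (simp add: converse_rtrancl_into_rtrancl)
    then show ?thesis using * inv(2) eq by auto
  qed
  show ?case
  proof (cases xs rule: rev_cases)
    case (snoc ys x)
    then have "x \<in> dom \<theta>" using inv_dom[OF less.prems(1) i] less.prems(3) by simp
    then obtain a where a: "\<theta> x = Some a" by auto
    have len: "length ys < length (formals K)" using c by (simp add: snoc call_ok_def)
    show ?thesis
    proof (rule step)
      show "lstep \<theta> (s i) {Test x a, MapTo (formals K ! length ys) a}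
          (Call K ys, if x \<in> set l then l else l @ [x]) (\<theta>(formals K ! length ys \<mapsto> a))"
        unfolding less.prems(3) snoc using K len a by (rule lstep.call1)
      show "called (\<theta>(formals K ! length ys \<mapsto> a)) K ys = called \<theta> K xs"
        using called_call1[where \<theta> = \<theta> and a = a, OF ok[unfolded snoc] len a] by (simp only: snoc)
    qed (simp add: snoc)
  next
    case Nil
    show ?thesis
    proof (cases l)
      case (Cons x l')
      then have "x \<in> dom \<theta>" using inv_dom[OF less.prems(1) i] less.prems(3) by simp
      then obtain a where a: "\<theta> x = Some a" by auto
      show ?thesis
      proof (rule step)
        show "lstep \<theta> (s i) {Unmap x a} (Call K [], l') (\<theta>(x := None))"
          unfolding less.prems(3) Nil Cons using a by (rule lstep.call2)
        show "called (\<theta>(x := None)) K [] = called \<theta> K xs"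
          unfolding Nil using called_call2[OF ok[unfolded Nil Cons]] .
      qed (simp add: Nil Cons)
    next
      case l: Nil
      have st: "lstep \<theta> (s i) {} (body K, []) \<theta>"
        unfolding less.prems(3) Nil l using K by (rule lstep.call3)
      have "(mark s \<theta>, mark (s(i := (body K, []))) \<theta>) \<in> (net_steps N)\<^sup>*"
        using net_steps_lstep[OF less.prems(1) i st] by blast
      then show ?thesis using inv_lstep(1)[OF less.prems(1) i st] called_Nil Nil by metis
    qed
  qed
qed

text \<open>Settled places carry guarded processes, so inversion applies and locates the redex in
  one or two threads. Undoing the substitution there exhibits the prefixes or the call that the net
  can execute.\<close>

lemma match:
  assumes inv: "inv s \<theta>" and settled: "\<And>i. i < n_threads F \<Longrightarrow> settled_place F NEW (s i)"
    and react: "react (eqs F) G G'" and G: "G \<cong> mark_proc s \<theta>"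
  shows "\<exists>s' \<theta>'. (mark s \<theta>, mark s' \<theta>') \<in> (net_steps N)\<^sup>* \<and> inv s' \<theta>' \<and> G' \<cong> mark_proc s' \<theta>'"
proof -
  let ?n = "n_threads F" and ?T = "\<lambda>i. place_proc \<theta> (s i)"
  have T: "?T i = subst (ap \<theta>) (fst (s i))" if "i < ?n" for i
    using place_proc_settled[of "fst (s i)" "snd (s i)"] settled[OF that] by (simp add: subst_map_ap)
  have guarded: "is_call P \<or> is_choice P" if "P \<in> set (map ?T [0..<?n])" for P
  proof -
    from that obtain i where i: "i < ?n" "P = ?T i" by auto
    have "stable_place F (s i)" using settled[OF i(1)] by (simp add: settled_place_def)
    then show ?thesis using T[OF i(1)] i(2) by (cases "s i"; cases "fst (s i)") auto
  qed
  have closed: "fn S \<subseteq> set fs" if "(K, fs, S) \<in> set (eqs F)" for K fs S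
    using eqsD[OF that] eqs_nf(2)[of K] by auto
  have "\<exists>M'. red (eqs F) (mset (map ?T [0..<?n])) M' \<and>
      (\<forall>Qs. mset Qs = M' \<longrightarrow> G' \<cong> nu NEW (par_list Qs))"
    using closed guarded
      by (intro react_nu_par_list[OF _ react G[unfolded mark_proc_def] finite_NEW]) blast+
  then obtain M' where M': "red (eqs F) (mset (map ?T [0..<?n])) M'"
    and G': "\<And>Qs. mset Qs = M' \<Longrightarrow> G' \<cong> nu NEW (par_list Qs)" by blast
  have sumD: "\<exists>bs l. s i = (Sum bs, l) \<and> cs = map (subst_branch (ap \<theta>)) bs"
    if "i < ?n" "?T i = Sum cs" for i cs
    using subst_eq_Sum[of "ap \<theta>" "fst (s i)" cs] T[OF that(1)] that(2) by (cases "s i") auto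
  from M' show ?thesis
  proof cases
    case (tau S' bs' M)
    from tau(1) obtain i where i: "i \<in> set [0..<?n]" "?T i = Sum bs'" "M = mset (map ?T (remove1 i [0..<?n]))"
      by (rule mset_map_pick)
    then have n: "i < ?n" by simp
    from sumD[OF n i(2)] obtain bs l where si: "s i = (Sum bs, l)" "bs' = map (subst_branch (ap \<theta>)) bs"
      by blast
    from tau(3) si(2) obtain S where S: "(Tau, S) \<in> set bs" "S' = subst (ap \<theta>) S"
      using subst_branch_Tau by fastforce
    have st: "lstep \<theta> (s i) {} (S, l @ dropped bs S) \<theta>" unfolding si using S(1) by (rule lstep.tau)
    let ?s = "s(i := (S, l @ dropped bs S))"
    have "pl_ok i (Sum bs, l)" using inv n si by (metis inv_def)
    then have "place_proc \<theta> (?s i) = S'" using place_proc_tau S by simp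
    then have "nu NEW (par_list (S' # map ?T (remove1 i [0..<?n]))) \<cong> mark_proc ?s \<theta>"
      using n by (intro mark_proc_replace) auto
    then have "G' \<cong> mark_proc ?s \<theta>"
      using G'[of "S' # map ?T (remove1 i [0..<?n])"] tau(2) i(3) by (auto intro: scong.trans)
    then show ?thesis using net_steps_lstep[OF inv n st] inv_lstep(1)[OF inv n st] by blast
  next
    case (call K fs S as M)
    from call(1) obtain i where i: "i \<in> set [0..<?n]" "?T i = Call K as" "M = mset (map ?T (remove1 i [0..<?n]))"
      by (rule mset_map_pick)
    then have n: "i < ?n" by simp
    from subst_eq_Call[of "ap \<theta>" "fst (s i)" K as] T[OF n] i(2)
    obtain xs l where si: "s i = (Call K xs, l)" "as = map (ap \<theta>) xs" by (cases "s i") auto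
    note e = eqsD[OF call(3)]
    from run_call[OF inv n si(1)] obtain \<theta>' where
      *: "(mark s \<theta>, mark (s(i := (body K, []))) \<theta>') \<in> (net_steps N)\<^sup>*"
      "inv (s(i := (body K, []))) \<theta>'" "called \<theta> K xs = subst_map \<theta>' (body K)"
      "\<And>x. x \<notin> thread_names i \<Longrightarrow> \<theta>' x = \<theta> x" by blast
    let ?s = "s(i := (body K, []))" and ?U = "subst_map (map_of (zip fs as)) S"
    have "?U = called \<theta> K xs" using called_full[OF e(1), of xs \<theta>] call(4) si(2) e by simp
    also have "\<dots> = place_proc \<theta>' (?s i)" using *(3) place_proc_fresh[OF fresh_ok_body[OF e(1)]] by simp
    finally have "nu NEW (par_list (?U # map ?T (remove1 i [0..<?n]))) \<cong> mark_proc ?s \<theta>'"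
      using n place_proc_other[OF inv n _ _ *(4)] by (intro mark_proc_replace) auto
    then have "G' \<cong> mark_proc ?s \<theta>'"
      using G'[of "?U # map ?T (remove1 i [0..<?n])"] call(2) i(3) by (auto intro: scong.trans)
    then show ?thesis using *(1,2) by blast
  next
    case (comm a z0 R' cs' b S0' bs' M)
    from comm(1) obtain j where j: "j \<in> set [0..<?n]" "?T j = Sum cs'"
      "add_mset (Sum bs') M = mset (map ?T (remove1 j [0..<?n]))"
      by (rule mset_map_pick)
    \<comment> \<open>The sender is picked from what remains after removing \<open>j\<close>, so the
      two threads differ.\<close>
    from j(3)[symmetric] obtain i where i: "i \<in> set (remove1 j [0..<?n])" "?T i = Sum bs'"
      "M = mset (map ?T (remove1 i (remove1 j [0..<?n])))"
      by (rule mset_map_pick)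
    have ij: "i < ?n" "j < ?n" "i \<noteq> j" using i(1) j(1) by (auto simp: set_remove1_eq)
    from sumD[OF ij(1) i(2)] obtain bs l where si: "s i = (Sum bs, l)" "bs' = map (subst_branch (ap \<theta>)) bs"
      by blast
    from sumD[OF ij(2) j(2)] obtain cs l' where sj: "s j = (Sum cs, l')" "cs' = map (subst_branch (ap \<theta>)) cs"
      by blast
    from comm(3) sj(2) obtain c where c: "c \<in> set cs" "(Recv a z0, R') = subst_branch (ap \<theta>) c" by auto
    then obtain x' y' S' where r: "(Recv x' y', S') \<in> set cs" "a = ap \<theta> x'"
      "z0 = refresh y' (ap \<theta> ` (fn S' - {y'}))" "R' = subst ((ap \<theta>)(y' := z0)) S'"
      using subst_branch_Recv by metis
    from comm(4) si(2) obtain d where d: "d \<in> set bs" "(Send a b, S0') = subst_branch (ap \<theta>) d" by auto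
    then obtain x y S where sd: "(Send x y, S) \<in> set bs" "a = ap \<theta> x" "b = ap \<theta> y" "S0' = subst (ap \<theta>) S"
      using subst_branch_Send by metis
    have "x \<in> fn (Sum bs)" "y \<in> fn (Sum bs)" "x' \<in> fn (Sum cs)"
      using Sum_branch_fn[OF sd(1)] Sum_branch_fn[OF r(1)] by auto
    then have "x \<in> dom \<theta>" "y \<in> dom \<theta>" "x' \<in> dom \<theta>"
      using inv_dom[OF inv ij(1)] inv_dom[OF inv ij(2)] by (simp_all add: si sj del: fn_Sum)
    then have \<theta>: "\<theta> x = Some a" "\<theta> y = Some b" "\<theta> x' = Some a"
      using sd(2,3) r(2) by (auto simp: ap_def)
    let ?\<theta> = "\<theta>(y' \<mapsto> b)" and ?s = "s(i := (S, l @ dropped bs S), j := (S', l' @ dropped cs S'))"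
    have st: "cstep \<theta> a b (s i) {Test x a, Test y b} (S, l @ dropped bs S)
        (s j) {Test x' a, MapTo y' b} (S', l' @ dropped cs S') ?\<theta>"
      unfolding si sj using sd(1) r(1) \<theta> by (rule cstep.intros)
    let ?T' = "\<lambda>k. place_proc ?\<theta> (?s k)" and ?r = "remove1 i (remove1 j [0..<?n])"
    have T': "?T' i = S0'" "?T' j = subst ((ap \<theta>)(y' := b)) S'"
      using place_proc_comm[OF inv ij si(1) sj(1) sd(1) r(1) \<theta>] sd(4) ij by simp_all
    \<comment> \<open>The component binds the refreshed name \<open>z0\<close> in place of
      \<open>y'\<close>; instantiating either of them with \<open>b\<close> gives the same process
      up to \<open>\<cong>\<close>.\<close>
    have "rename1 R' b z0 \<cong> ?T' j"
      unfolding T' r(4) unfolding r(3) by (rule rename_subst) (rule refresh_notin)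
    have others: "?T k = ?T' k" if "k \<in> set ?r" for k
      using that place_proc_other[where \<theta>' = ?\<theta>, OF inv ij(2) _ _ inv_cstep(2)[OF inv ij st], of k]
      by (auto simp: set_remove1_eq)
    have "nu NEW (par_list (rename1 R' b z0 # S0' # map ?T ?r)) \<cong> mark_proc ?s ?\<theta>"
    proof -
      have eq: "map ?T ?r = map ?T' ?r" using others by (intro map_cong) auto
      have "par_list ([rename1 R' b z0, S0'] @ map ?T ?r)
          \<cong> Par (par_list [rename1 R' b z0, S0']) (par_list (map ?T ?r))" by (rule par_list_append)
      also have "\<dots> \<cong> Par (Par (?T' j) (?T' i)) (par_list (map ?T' ?r))"
        unfolding eq par_list.simps T'(1)[symmetric] using \<open>rename1 R' b z0 \<cong> ?T' j\<close>
        by (intro scong.cong_par scong.refl)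
      also have "\<dots> \<cong> par_list (map ?T' [0..<?n])" by (rule scong.sym[OF par_list_split2[OF ij]])
      finally show ?thesis unfolding mark_proc_def append.simps by (rule nu_cong)
    qed
    moreover have "G' \<cong> nu NEW (par_list (rename1 R' b z0 # S0' # map ?T ?r))"
      by (rule G') (simp add: comm(2) i(3))
    ultimately have "G' \<cong> mark_proc ?s ?\<theta>" by (blast intro: scong.trans)
    then show ?thesis using net_steps_cstep[OF inv ij st] inv_cstep(1)[OF inv ij st] by blast
  qed
qed

end

context fcp_spec
begin

subsection \<open>The bisimulation\<close>

lemma mark_inj:
  assumes "mark s \<theta> = mark s' \<theta>'"
  shows "\<theta> = \<theta>'" "\<And>i. i < n_threads F \<Longrightarrow> s i = s' i"
proof -
  have "\<theta> x = Some a \<longleftrightarrow> \<theta>' x = Some a" for x a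
    using fun_cong[OF assms, of "Sub (EqP x a)"] by (simp only: mark.simps mark_sub.simps of_bool_eq_iff)
  then show "\<theta> = \<theta>'" by (intro ext) (metis not_Some_eq)
  show "s i = s' i" if "i < n_threads F" for i
    using fun_cong[OF assms, of "Ctl i (s i)"] that unfolding mark.simps of_bool_eq_iff by blast
qed

text \<open>Allows \<open>mark_proc\<close> to be treated as a function of the marking, whatever
  representation of it is at hand.\<close>

lemma mark_proc_inj: "mark s \<theta> = mark s' \<theta>' \<Longrightarrow> mark_proc s \<theta> = mark_proc s' \<theta>'"
  using mark_inj[of s \<theta> s' \<theta>'] unfolding mark_proc_def
    by (auto intro!: arg_cong[where f = "nu NEW"] arg_cong[where f = par_list])

lemma sum_of_bool_le_1:
  assumes "\<And>x y. x \<in> A \<Longrightarrow> y \<in> A \<Longrightarrow> P x \<Longrightarrow> P y \<Longrightarrow> x = y"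
  shows "(\<Sum>x\<in>A. of_bool (P x) :: nat) \<le> 1"
proof (cases "finite A")
  case True
  have "card (A \<inter> {x. P x}) \<le> 1"
    using True assms by (auto simp: card_le_Suc0_iff_eq)
  then show ?thesis using True by (simp add: sum_of_bool_eq)
qed simp

lemma subst_marking_mark:
  assumes "subst_ok \<theta>" shows "subst_marking F NEW (mark_sub \<theta>)"
  unfolding subst_marking_def
proof (intro conjI allI ballI impI)
  fix p assume p: "p \<notin> subst_places F NEW"
  show "mark_sub \<theta> p = 0"
  proof (cases p)
    case (EqP x a)
    then show ?thesis using p EqP_place[OF assms] by auto
  qed (use p in \<open>auto simp: subst_places_def\<close>)
next
  fix m assume m: "m \<in> NEW"
  have le: "(\<Sum>r\<in>RESTR F. mark_sub \<theta> (EqP r m)) \<le> 1"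
    unfolding mark_sub.simps using assms by (intro sum_of_bool_le_1) (auto simp: subst_ok_def)
  show "mark_sub \<theta> (NeqStar m) + (\<Sum>r\<in>RESTR F. mark_sub \<theta> (EqP r m)) = 1"
  proof (cases "\<exists>r\<in>RESTR F. \<theta> r = Some m")
    case True
    then obtain r where r: "r \<in> RESTR F" "\<theta> r = Some m" by blast
    have "mark_sub \<theta> (EqP r m) \<le> (\<Sum>r\<in>RESTR F. mark_sub \<theta> (EqP r m))"
      using r(1) by (intro member_le_sum) auto
    then show ?thesis using True r(2) le by auto
  next
    case False
    then show ?thesis using m by auto
  qed
next
  fix x assume "x \<in> INP F \<union> FRM F \<union> RESTR F"
  show "(\<Sum>a\<in>PUB F \<union> NEW. mark_sub \<theta> (EqP x a)) \<le> 1"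
    unfolding mark_sub.simps by (intro sum_of_bool_le_1) auto
next
  fix x m assume "x \<in> INP F \<union> FRM F" "m \<in> NEW"
  then show "mark_sub \<theta> (EqP x m) + mark_sub \<theta> (NeqP x m) = 1" by simp
qed

lemma settled_dom: "settled_place F NEW q \<Longrightarrow> place_dom q = fn (fst q) \<union> set (snd q)"
  using settled_length by (cases q; cases "fst q") auto

text \<open>Paths that avoid leaving a call stay within one body, so they preserve
  \<open>fresh_ok\<close>. This yields full argument lists for the calls that
  \<open>bisim_rel\<close> admits.\<close>

lemma derived_fresh: "derived F NEW q \<Longrightarrow> \<exists>K. fresh_ok K (fst q) (snd q)"
proof -
  assume "derived F NEW q"
  then obtain K fs B where e: "(K, fs, B) \<in> set (eqs F)"
    and path: "((B, []), q) \<in> {(u, v) \<in> cf_step F NEW. \<not> is_call (fst u)}\<^sup>*"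
    unfolding derived_def by fast
  from path have "fresh_ok K (fst q) (snd q)"
  proof (induction rule: rtrancl_induct)
    case base
    then show ?case using fresh_ok_body eqsD[OF e] by auto
  next
    case (step u v)
    then have st: "(u, v) \<in> cf_step F NEW" and nc: "\<not> is_call (fst u)" by auto
    then obtain lab C where "(u, lab, C, v) \<in> cf_trans F NEW" by (auto simp: cf_step_def)
    then show ?case
      using step.IH st nc fresh_ok_Sum fresh_ok_Res by (cases rule: cf_trans_cases) auto
  qed
  then show ?thesis ..
qed

section \<open>Correspondence between substitutions and markings\<close>

lemma subst_par_list: "subst \<sigma> (par_list Ps) = par_list (map (subst \<sigma>) Ps)"
  by (induction Ps rule: par_list.induct) auto

lemma is_unionD:
  assumes "is_union \<sigma> n \<sigma>s"
  shows "\<sigma> x = Some a \<longleftrightarrow> (\<exists>i<n. \<sigma>s i x = Some a)"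
proof -
  have "(x, a) \<in> Map.graph \<sigma> \<longleftrightarrow> (x, a) \<in> (\<Union>i<n. Map.graph (\<sigma>s i))"
    using assms by (simp add: is_union_def)
  then show ?thesis by (simp add: Map.graph_def Bex_def)
qed

text \<open>\<open>h\<close> sends a restricted name to the new name that represents it in the
  marking. The last clause of \<open>corresponds\<close> makes it both well defined and injective on
  the names in use.\<close>

lemma corresponds_renaming:
  assumes corr: "corresponds F NEW R \<sigma> (mark_sub \<theta>)"
  obtains h where "\<And>x r. \<sigma> x = Some r \<Longrightarrow> r \<in> R \<Longrightarrow> \<theta> x = Some (h r) \<and> h r \<in> NEW"
    "inj_on h (R \<inter> ran \<sigma>)" "\<And>x p. \<sigma> x = Some p \<Longrightarrow> p \<notin> R \<Longrightarrow> \<theta> x = Some p \<and> p \<in> PUB F"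
proof -
  \<comment> \<open>Any name holding \<open>r\<close> may be consulted, since all of them are marked
    at the same new name.\<close>
  define h where "h r = the (\<theta> (SOME x. \<sigma> x = Some r))" for r
  have new: "\<exists>m\<in>NEW. \<theta> x = Some m" if "\<sigma> x = Some r" "r \<in> R" for x r
  proof -
    have "\<exists>m\<in>NEW. mark_sub \<theta> (EqP x m) = 1" using corr that unfolding corresponds_def by blast
    then show ?thesis by (simp only: mark_sub.simps of_bool_eq_1_iff)
  qed
  have iff: "r = r' \<longleftrightarrow> (\<forall>m\<in>NEW. \<theta> x = Some m \<longleftrightarrow> \<theta> y = Some m)"
    if "\<sigma> x = Some r" "r \<in> R" "\<sigma> y = Some r'" "r' \<in> R" for x y r r'
  proof -
    have "r = r' \<longleftrightarrow> (\<forall>m\<in>NEW. mark_sub \<theta> (EqP x m) = mark_sub \<theta> (EqP y m))"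
      using corr that unfolding corresponds_def by blast
    then show ?thesis by (simp only: mark_sub.simps of_bool_eq_iff)
  qed
  have h: "\<theta> x = Some (h r) \<and> h r \<in> NEW" if "\<sigma> x = Some r" "r \<in> R" for x r
  proof -
    let ?y = "SOME x. \<sigma> x = Some r"
    have y: "\<sigma> ?y = Some r" using that(1) by (rule someI)
    from new[OF that] obtain m where m: "m \<in> NEW" "\<theta> x = Some m" by blast
    then have "\<theta> ?y = Some m" using iff[OF that y that(2)] by blast
    then show ?thesis using m by (simp add: h_def)
  qed
  moreover have "inj_on h (R \<inter> ran \<sigma>)"
  proof (rule inj_onI)
    fix r r' assume r: "r \<in> R \<inter> ran \<sigma>" "r' \<in> R \<inter> ran \<sigma>" "h r = h r'"
    then obtain x y where xy: "\<sigma> x = Some r" "\<sigma> y = Some r'" by (auto simp: ran_def)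
    have "\<theta> x = \<theta> y" using h[OF xy(1)] h[OF xy(2)] r by simp
    then show "r = r'" using iff[OF xy(1) _ xy(2)] r(1,2) by simp
  qed
  moreover have "\<theta> x = Some p \<and> p \<in> PUB F" if "\<sigma> x = Some p" "p \<notin> R" for x p
  proof -
    have "ran \<sigma> \<subseteq> PUB F \<union> R" using corr by (simp add: corresponds_def)
    then have "p \<in> PUB F" using ranI[of \<sigma> x p] that by blast
    then have "mark_sub \<theta> (EqP x p) = 1" using corr that(1) unfolding corresponds_def by blast
    then show ?thesis using \<open>p \<in> PUB F\<close> by (simp only: mark_sub.simps of_bool_eq_1_iff simp_thms)
  qed
  ultimately show thesis using that by blast
qed

text \<open>The two sides differ by renaming the restricted names along \<open>h\<close>. Public
  names are untouched and cannot be captured, being disjoint from \<open>NEW\<close>.\<close>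

lemma rename_to_mark:
  assumes un: "is_union \<sigma> (n_threads F) \<sigma>s"
    and corr: "corresponds F NEW (set rs) \<sigma> (mark_sub \<theta>)"
    and dom: "\<And>i. i < n_threads F \<Longrightarrow> fn (Ss i) \<subseteq> dom (\<sigma>s i)"
  shows "res_list rs (par_list (map (\<lambda>i. subst_map (\<sigma>s i) (Ss i)) [0..<n_threads F]))
    \<cong> nu NEW (par_list (map (\<lambda>i. subst_map \<theta> (Ss i)) [0..<n_threads F]))"
proof -
  let ?n = "n_threads F" and ?A = "set rs"
  let ?P = "par_list (map (\<lambda>i. subst_map (\<sigma>s i) (Ss i)) [0..<?n])"
  let ?Q = "par_list (map (\<lambda>i. subst_map \<theta> (Ss i)) [0..<?n])"
  obtain h where h: "\<And>x r. \<sigma> x = Some r \<Longrightarrow> r \<in> ?A \<Longrightarrow> \<theta> x = Some (h r) \<and> h r \<in> NEW"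
    "inj_on h (?A \<inter> ran \<sigma>)" "\<And>x p. \<sigma> x = Some p \<Longrightarrow> p \<notin> ?A \<Longrightarrow> \<theta> x = Some p \<and> p \<in> PUB F"
    using corresponds_renaming[OF corr] by blast
  let ?g = "\<lambda>x. if x \<in> ?A then h x else id x"
  have val: "\<exists>a. \<sigma> x = Some a \<and> ap (\<sigma>s i) x = a" if "i < ?n" "x \<in> fn (Ss i)" for i x
    using dom[OF that(1)] that is_unionD[OF un, of x] by (force simp: ap_def)
  have fnP: "fn ?P \<subseteq> ran \<sigma>" using val by (fastforce simp: subst_map_ap ran_def)
  have pub: "fn ?P - ?A \<subseteq> PUB F" using fnP h(3) by (auto simp: ran_def)
  have new: "h ` (?A \<inter> fn ?P) \<subseteq> NEW" using fnP h(1) by (auto simp: ran_def)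
  have inj: "inj_on h (?A \<inter> fn ?P)" using h(2) by (rule inj_on_subset) (use fnP in blast)
  have disj: "h ` (?A \<inter> fn ?P) \<inter> id ` (fn ?P - ?A) = {}"
    using new pub PUB_NEW by (simp only: image_id id_apply) blast
  have "subst ?g ?P \<cong> ?Q"
    unfolding subst_par_list map_map
  proof (rule par_list_cong)
    have "subst ?g (subst_map (\<sigma>s i) (Ss i)) \<cong> subst_map \<theta> (Ss i)" if i: "i < ?n" for i
    proof -
      have "subst ?g (subst_map (\<sigma>s i) (Ss i)) \<cong> subst (?g \<circ> ap (\<sigma>s i)) (Ss i)"
        unfolding subst_map_ap by (rule subst_comp)
      also have "subst (?g \<circ> ap (\<sigma>s i)) (Ss i) = subst (ap \<theta>) (Ss i)"
      proof (rule subst_cong)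
        fix x assume "x \<in> fn (Ss i)"
        then obtain a where a: "\<sigma> x = Some a" "ap (\<sigma>s i) x = a" using val[OF i] by blast
        then show "(?g \<circ> ap (\<sigma>s i)) x = ap \<theta> x"
          using h(1)[OF a(1)] h(3)[OF a(1)] by (auto simp: ap_def[of \<theta>])
      qed
      finally show ?thesis by (simp only: subst_map_ap)
    qed
    then show "list_all2 (\<cong>) (map (subst ?g \<circ> (\<lambda>i. subst_map (\<sigma>s i) (Ss i))) [0..<?n])
        (map (\<lambda>i. subst_map \<theta> (Ss i)) [0..<?n])"
      by (simp add: list_all2_conv_all_nth)
  qed
  note gP = this
  then have fnQ: "fn ?Q = ?g ` fn ?P" using scong_fn[OF gP] by simp
  have "res_list rs ?P \<cong> nu ?A ?P" by (rule res_list_nu)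
  also have "nu ?A ?P = subst id (nu ?A ?P)" by (rule subst_id[symmetric])
  also have "\<dots> \<cong> nu (h ` (?A \<inter> fn ?P)) (subst ?g ?P)"
    using inj disj by (intro subst_nu) auto
  also have "\<dots> \<cong> nu (h ` (?A \<inter> fn ?P)) ?Q" using gP by (rule nu_cong)
  \<comment> \<open>New names outside the image of \<open>h\<close> do not occur in
    \<open>?Q\<close>, so restricting them as well changes nothing.\<close>
  also have "\<dots> \<cong> nu NEW ?Q"
  proof (rule nu_eq)
    have "h ` (?A \<inter> fn ?P) \<subseteq> fn ?Q" unfolding fnQ by auto
    moreover have "NEW \<inter> ?g ` fn ?P \<subseteq> h ` (?A \<inter> fn ?P)"
    proof
      fix y assume "y \<in> NEW \<inter> ?g ` fn ?P"
      then obtain x where x: "x \<in> fn ?P" "y = ?g x" "y \<in> NEW" by blast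
      have "x \<in> ?A" using x pub PUB_NEW by (cases "x \<in> ?A") auto
      then show "y \<in> h ` (?A \<inter> fn ?P)" using x by auto
    qed
    ultimately show "h ` (?A \<inter> fn ?P) \<inter> fn ?Q = NEW \<inter> fn ?Q" using new unfolding fnQ by blast
  qed simp_all
  finally show ?thesis .
qed

lemma inits_nf:
  assumes "(K, \<sigma>) \<in> set (inits F)"
  shows "K \<in> idents \<and> (is_choice (body K) \<or> is_call (body K)) \<and> dom \<sigma> = set (formals K) \<and>
    ran \<sigma> \<subseteq> set (restr F) \<union> PUB F"
proof -
  have "\<forall>(K, \<sigma>) \<in> set (inits F). \<exists>fs S. (K, fs, S) \<in> set (eqs F) \<and>
        (is_choice S \<or> is_call S) \<and> dom \<sigma> = set fs \<and> ran \<sigma> \<subseteq> set (restr F) \<union> PUB F"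
    using nf by (simp add: normal_form_def)
  with assms obtain fs S where e: "(K, fs, S) \<in> set (eqs F)"
    and *: "is_choice S \<or> is_call S" "dom \<sigma> = set fs" "ran \<sigma> \<subseteq> set (restr F) \<union> PUB F" by fast
  then show ?thesis using eqsD[OF e] by simp
qed

lemma finite_PUB: "finite (PUB F)"
proof -
  have "finite (ran \<sigma>)" if "(K, \<sigma>) \<in> set (inits F)" for K \<sigma>
    using inits_nf[OF that] by (intro finite_ran) simp
  then show ?thesis unfolding PUB_def by auto
qed

lemma sum_two_le:
  fixes f :: "'a \<Rightarrow> nat"
  assumes "finite A" "x \<in> A" "y \<in> A" "x \<noteq> y"
  shows "f x + f y \<le> sum f A"
  using sum_mono2[of A "{x, y}" f] assms by simp

text \<open>Converse of \<open>subst_marking_mark\<close>. The bound on the values of each name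
  makes the marked places \<open>EqP\<close> the graph of a partial map, the equation for
  \<open>NeqStar\<close> makes it injective on restricted names, and the complementary places are
  then forced.\<close>

lemma subst_marking_cases:
  assumes M: "subst_marking F NEW M"
  shows "\<exists>\<theta>. subst_ok \<theta> \<and> M = mark_sub \<theta>"
proof -
  let ?V = "INP F \<union> FRM F \<union> RESTR F" and ?A = "PUB F \<union> NEW"
  define \<theta> where "\<theta> x = (if \<exists>a. M (EqP x a) \<noteq> 0 then Some (SOME a. M (EqP x a) \<noteq> 0) else None)" for x
  have finA: "finite ?A" using finite_PUB by simp
  have out: "M p = 0" if "p \<notin> subst_places F NEW" for p using M that by (simp add: subst_marking_def)
  have pl: "x \<in> ?V \<and> a \<in> ?A \<and> (x \<in> RESTR F \<longrightarrow> a \<in> NEW)" if "M (EqP x a) \<noteq> 0" for x a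
    using out[of "EqP x a"] that distinct_binders(4,5) by (auto simp: subst_places_def)
  have le: "(\<Sum>a\<in>?A. M (EqP x a)) \<le> 1" if "x \<in> ?V" for x using M that by (simp add: subst_marking_def)
  have uniq: "a = b" if "M (EqP x a) \<noteq> 0" "M (EqP x b) \<noteq> 0" for x a b
  proof (rule ccontr)
    assume "a \<noteq> b"
    then have "M (EqP x a) + M (EqP x b) \<le> (\<Sum>a\<in>?A. M (EqP x a))"
      using pl that finA by (intro sum_two_le) auto
    then show False using le[of x] pl[OF that(1)] that by auto
  qed
  have one: "M (EqP x a) \<le> 1" for x a
  proof (cases "M (EqP x a) = 0")
    case False
    then have "M (EqP x a) \<le> (\<Sum>a\<in>?A. M (EqP x a))"
      using pl finA by (intro member_le_sum) auto
    then show ?thesis using le[of x] pl[OF False] by auto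
  qed simp
  have \<theta>: "\<theta> x = Some a \<longleftrightarrow> M (EqP x a) \<noteq> 0" for x a
  proof
    assume "\<theta> x = Some a"
    then show "M (EqP x a) \<noteq> 0"
      unfolding \<theta>_def by (metis (mono_tags, lifting) option.distinct(1) option.inject someI_ex)
  next
    assume a: "M (EqP x a) \<noteq> 0"
    then have "(SOME a. M (EqP x a) \<noteq> 0) = a" using uniq by (intro some_equality) auto
    then show "\<theta> x = Some a" using a unfolding \<theta>_def by auto
  qed
  have star: "M (NeqStar m) + (\<Sum>r\<in>RESTR F. M (EqP r m)) = 1" if "m \<in> NEW" for m
    using M that by (simp add: subst_marking_def)
  have "M p = mark_sub \<theta> p" for p
  proof (cases p)
    case (EqP x a)
    then show ?thesis using \<theta>[of x a] one[of x a] by (cases "M (EqP x a) = 0") auto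
  next
    case (NeqP x m)
    show ?thesis
    proof (cases "x \<in> INP F \<union> FRM F \<and> m \<in> NEW")
      case True
      then have "M (EqP x m) + M (NeqP x m) = 1" using M by (simp add: subst_marking_def)
      then show ?thesis using \<theta>[of x m] True NeqP by auto
    next
      case False
      then have "NeqP x m \<notin> subst_places F NEW" by (auto simp: subst_places_def)
      then show ?thesis using out False NeqP by auto
    qed
  next
    case (NeqStar m)
    show ?thesis
    proof (cases "m \<in> NEW")
      case True
      show ?thesis
      proof (cases "\<exists>r\<in>RESTR F. \<theta> r = Some m")
        case ex: True
        then obtain r where "r \<in> RESTR F" "M (EqP r m) \<noteq> 0" using \<theta> by blast
        then have "(\<Sum>r\<in>RESTR F. M (EqP r m)) \<noteq> 0" by auto
        then have "M (NeqStar m) = 0" using star[OF True] by linarith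
        then show ?thesis using ex NeqStar by auto
      next
        case False
        then have "(\<Sum>r\<in>RESTR F. M (EqP r m)) = 0" using \<theta> by auto
        then show ?thesis using star[OF True] False True NeqStar by auto
      qed
    next
      case False
      then have "NeqStar m \<notin> subst_places F NEW" by (auto simp: subst_places_def)
      then show ?thesis using out False NeqStar by auto
    qed
  qed
  then have "M = mark_sub \<theta>" by blast
  moreover have "r = r'" if "r \<in> RESTR F" "r' \<in> RESTR F" "\<theta> r = Some a" "\<theta> r' = Some a" for r r' a
  proof (rule ccontr)
    assume "r \<noteq> r'"
    then have "M (EqP r a) + M (EqP r' a) \<le> (\<Sum>r\<in>RESTR F. M (EqP r a))"
      using that by (intro sum_two_le) auto
    moreover have "a \<in> NEW" using that \<theta> pl by blast
    ultimately show False using star[of a] that(3,4) \<theta>[of r a] \<theta>[of r' a] by auto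
  qed
  moreover have "x \<in> ?V \<and> a \<in> ?A \<and> (x \<in> RESTR F \<longrightarrow> a \<in> NEW)" if "\<theta> x = Some a" for x a
    using pl that \<theta> by blast
  then have "dom \<theta> \<subseteq> RESTR F \<union> INP F \<union> FRM F" "ran \<theta> \<subseteq> ?A" "\<forall>r\<in>RESTR F. \<forall>a. \<theta> r = Some a \<longrightarrow> a \<in> NEW"
    unfolding ran_def by blast+
  ultimately have "M = mark_sub \<theta>" "subst_ok \<theta>" unfolding subst_ok_def by blast+
  then show ?thesis by blast
qed

end

section \<open>The initial marking and assembly of the bisimulation\<close>

locale fcp_start = fcp_net_spec +
  fixes \<sigma> :: "name \<rightharpoonup> name"
  assumes un: "is_union \<sigma> (n_threads F) (init_subst F)"
    and corr: "corresponds F NEW (set (restr F)) \<sigma> M\<^sub>s"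
begin

definition init_place :: "nat \<Rightarrow> aug" where
  "init_place i = (init_body F i, [])"

lemma init_facts:
  assumes "i < n_threads F"
  shows "init_ident F i \<in> idents" "init_body F i = body (init_ident F i)"
    "is_choice (init_body F i) \<or> is_call (init_body F i)"
    "dom (init_subst F i) = set (formals (init_ident F i))" "ran (init_subst F i) \<subseteq> set (restr F) \<union> PUB F"
proof -
  show "init_body F i = body (init_ident F i)" by (simp add: init_body_def body_def)
  moreover have "(init_ident F i, init_subst F i) \<in> set (inits F)" using assms by simp
  note inits_nf[OF this]
  ultimately show "init_ident F i \<in> idents" "is_choice (init_body F i) \<or> is_call (init_body F i)"
    "dom (init_subst F i) = set (formals (init_ident F i))" "ran (init_subst F i) \<subseteq> set (restr F) \<union> PUB F"
    by simp_all
qed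

lemma init_fresh: "i < n_threads F \<Longrightarrow> fresh_ok (init_ident F i) (init_body F i) []"
  using fresh_ok_body init_facts(1,2) by metis

text \<open>Correspondence with the initial substitution gives values to exactly the formals of the
  initial identifiers, and these are what \<open>place_dom\<close> demands at the initial
  places.\<close>

lemma init_inv: "\<exists>\<theta>. inv init_place \<theta> \<and> init_marking N = mark init_place \<theta>"
proof -
  have "subst_marking F NEW M\<^sub>s" using corr unfolding corresponds_def by blast
  then obtain \<theta> where \<theta>: "subst_ok \<theta>" "M\<^sub>s = mark_sub \<theta>" using subst_marking_cases by blast
  have "init_marking N p = mark init_place \<theta> p" for p
    by (cases p) (simp_all add: fcp_net_def init_place_def \<theta>(2))
  then have "init_marking N = mark init_place \<theta>" by blast
  moreover have "dom \<theta> = dom \<sigma>"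
  proof (intro set_eqI iffI)
    fix x assume "x \<in> dom \<theta>"
    then obtain a where "\<theta> x = Some a" by auto
    then have a: "M\<^sub>s (EqP x a) \<noteq> 0" by (simp add: \<theta>(2))
    have "\<forall>x a. x \<notin> dom \<sigma> \<longrightarrow> M\<^sub>s (EqP x a) = 0" using corr by (simp add: corresponds_def)
    with a show "x \<in> dom \<sigma>" by metis
  next
    fix x assume "x \<in> dom \<sigma>"
    then obtain a where a: "\<sigma> x = Some a" by auto
    obtain h where h: "\<And>x r. \<sigma> x = Some r \<Longrightarrow> r \<in> set (restr F) \<Longrightarrow> \<theta> x = Some (h r) \<and> h r \<in> NEW"
      "\<And>x p. \<sigma> x = Some p \<Longrightarrow> p \<notin> set (restr F) \<Longrightarrow> \<theta> x = Some p \<and> p \<in> PUB F"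
      using corresponds_renaming[OF corr[unfolded \<theta>(2)]] by metis
    show "x \<in> dom \<theta>" using h(1)[OF a] h(2)[OF a] by (cases "a \<in> set (restr F)") auto
  qed
  then have dom: "dom \<theta> = (\<Union>i < n_threads F. set (formals (init_ident F i)))"
    using is_unionD[OF un] init_facts(4) by (auto simp: dom_def set_eq_iff) blast+
  have sub: "set (formals (init_ident F i)) \<subseteq> thread_names i" "init_ident F i \<in> thread_idents F i"
    if "i < n_threads F" for i
    using init_facts(1)[OF that] by (auto simp: thread_names_def thread_idents_def names_def)
  have "dom \<theta> \<inter> thread_names i = place_dom (init_place i)" if i: "i < n_threads F" for i
  proof -
    have "dom \<theta> \<inter> thread_names i = set (formals (init_ident F i))"
      unfolding dom using i sub(1) thread_names_disjoint by (auto; metis IntI empty_iff subsetD)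
    then show ?thesis unfolding init_place_def fresh_dom[OF init_fresh[OF i]]
      using eqs_nf(2)[OF init_facts(1)[OF i]] init_facts(2)[OF i] by simp
  qed
  moreover have "pl_ok i (init_place i)" if "i < n_threads F" for i
    using sub(2)[OF that] fresh_ok_place[OF init_fresh[OF that]] by (auto simp: pl_ok_def init_place_def)
  moreover have "init_place i \<in> cf_places F NEW i" for i by (simp add: cf_places_def init_place_def)
  moreover have "dom \<theta> \<subseteq> (\<Union>i < n_threads F. thread_names i)" unfolding dom using sub(1) by blast
  ultimately show ?thesis using \<theta>(1) unfolding inv_def by blast
qed

lemma net_steps_inv:
  assumes "inv s \<theta>" "(mark s \<theta>, M') \<in> net_steps N"
  shows "\<exists>s' \<theta>'. M' = mark s' \<theta>' \<and> inv s' \<theta>' \<and>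
    (mark_proc s \<theta> \<cong> mark_proc s' \<theta>' \<or> react (eqs F) (mark_proc s \<theta>) (mark_proc s' \<theta>'))"
  using assms
proof (cases rule: net_steps_cases)
  case (Local i C q' \<theta>')
  then show ?thesis using inv_lstep(1)[OF assms(1)] lstep_mark_proc[OF assms(1)] by blast
next
  case (Sync i j a b C q1' D q2' \<theta>')
  then show ?thesis using inv_cstep(1)[OF assms(1)] cstep_mark_proc[OF assms(1)] by blast
qed

lemma reachable_inv:
  assumes "M \<in> reachable_markings N"
  obtains s \<theta> where "M = mark s \<theta>" "inv s \<theta>"
proof -
  have "(init_marking N, M) \<in> (net_steps N)\<^sup>*" using assms by (simp add: reachable_markings_def)
  then have "\<exists>s \<theta>. M = mark s \<theta> \<and> inv s \<theta>"
  proof (induction rule: rtrancl_induct)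
    case base
    then show ?case using init_inv by metis
  next
    case (step M M')
    then show ?case using net_steps_inv by metis
  qed
  then show thesis using that by blast
qed

lemma reachable_steps:
  "M \<in> reachable_markings N \<Longrightarrow> (M, M') \<in> (net_steps N)\<^sup>* \<Longrightarrow> M' \<in> reachable_markings N"
  by (auto simp: reachable_markings_def)

text \<open>The new names themselves serve as restricted names, with one restriction of
  \<open>\<theta>\<close> per thread as its substitution.\<close>

lemma bisim_relI:
  assumes G: "G \<in> reachable_procs F" "G \<cong> mark_proc s \<theta>"
    and M: "mark s \<theta> \<in> reachable_markings N" and inv: "inv s \<theta>"
    and settled: "\<And>i. i < n_threads F \<Longrightarrow> settled_place F NEW (s i)"
  shows "(scong_class G, mark s \<theta>) \<in> bisim_rel F NEW M\<^sub>s"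
proof -
  let ?n = "n_threads F" and ?rs = "sorted_list_of_set NEW"
  define Ss where "Ss i = fst (s i)" for i
  define ls where "ls i = snd (s i)" for i
  \<comment> \<open>At settled places this domain is \<open>place_dom\<close>; by the invariant the
    pieces together make up all of \<open>\<theta>\<close>.\<close>
  define \<sigma>s where "\<sigma>s i = \<theta> |` (fn (Ss i) \<union> set (ls i))" for i
  have s: "s i = (Ss i, ls i)" for i by (simp add: Ss_def ls_def)
  have ok: "subst_ok \<theta>" using inv by (simp add: inv_def)
  have dom: "place_dom (s i) = fn (Ss i) \<union> set (ls i)" "fn (Ss i) \<union> set (ls i) \<subseteq> dom \<theta>" if "i < ?n" for i
    using settled_dom[OF settled[OF that]] inv_dom[OF inv that] by (auto simp: Ss_def ls_def)
  have rs: "distinct ?rs" "set ?rs = NEW" by simp_all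
  have "stable_place F (s i) \<and> mark s \<theta> (Ctl i (s i)) > 0" if "i < ?n" for i
    using settled[OF that] that by (simp add: settled_place_def)
  then have "stable_marking F (mark s \<theta>)" unfolding stable_marking_def by blast
  moreover have "G \<cong> res_list ?rs (par_list (map (\<lambda>i. subst_map (\<sigma>s i) (Ss i)) [0..<?n]))"
  proof -
    have "subst_map (\<sigma>s i) (Ss i) = place_proc \<theta> (s i)" if "i < ?n" for i
    proof -
      have "place_proc \<theta> (s i) = subst_map \<theta> (Ss i)"
        using place_proc_settled settled[OF that] unfolding s by blast
      also have "\<dots> = subst_map (\<sigma>s i) (Ss i)"
        unfolding subst_map_ap by (rule subst_cong) (simp add: ap_def \<sigma>s_def)
      finally show ?thesis ..
    qed
    then have eq: "map (\<lambda>i. subst_map (\<sigma>s i) (Ss i)) [0..<?n] = map (\<lambda>i. place_proc \<theta> (s i)) [0..<?n]"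
      by simp
    show ?thesis unfolding eq using G(2) unfolding mark_proc_def nu_def .
  qed
  moreover have "(is_choice (Ss i) \<or> is_call (Ss i)) \<and> derived F NEW (Ss i, ls i) \<and>
      dom (\<sigma>s i) = fn (Ss i) \<union> set (ls i) \<and> ran (\<sigma>s i) \<subseteq> set ?rs \<union> PUB F" if "i < ?n" for i
  proof -
    have "derived F NEW (Ss i, ls i)" "stable_place F (Ss i, ls i)"
      using settled[OF that] by (simp_all add: settled_place_def s)
    moreover from this(2) have "is_choice (Ss i) \<or> is_call (Ss i)" by (cases "Ss i") auto
    moreover have "dom (\<sigma>s i) = fn (Ss i) \<union> set (ls i)" using dom(2)[OF that] by (auto simp: \<sigma>s_def)
    moreover have "ran (\<sigma>s i) \<subseteq> ran \<theta>" by (auto simp: \<sigma>s_def ran_def restrict_map_def)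
    ultimately show ?thesis using ok by (auto simp: subst_ok_def)
  qed
  moreover have "is_union \<theta> ?n \<sigma>s"
  proof -
    have "\<theta> x = Some a \<longleftrightarrow> (\<exists>i<?n. \<sigma>s i x = Some a)" for x a
    proof
      assume a: "\<theta> x = Some a"
      then obtain i where i: "i < ?n" "x \<in> thread_names i" using inv unfolding inv_def by blast
      then have "x \<in> place_dom (s i)" using inv a unfolding inv_def by blast
      then show "\<exists>i<?n. \<sigma>s i x = Some a" using i(1) a dom(1)[OF i(1)] by (auto simp: \<sigma>s_def)
    next
      assume "\<exists>i<?n. \<sigma>s i x = Some a"
      then show "\<theta> x = Some a" by (auto simp: \<sigma>s_def restrict_map_def split: if_splits)
    qed
    then show ?thesis unfolding is_union_def by (auto simp: Map.graph_def)
  qed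
  moreover have "corresponds F NEW (set ?rs) \<theta> (\<lambda>q. mark s \<theta> (Sub q))"
  proof -
    have "inj_on \<theta> (dom \<theta> \<inter> RESTR F)" using ok unfolding subst_ok_def by (auto intro!: inj_onI)
    moreover have "\<forall>r\<in>dom \<theta> \<inter> RESTR F. the (\<theta> r) \<in> NEW" using ok unfolding subst_ok_def by auto
    moreover have "dom \<theta> \<subseteq> INP F \<union> FRM F \<union> RESTR F" "ran \<theta> \<subseteq> PUB F \<union> NEW"
      using ok unfolding subst_ok_def by auto
    moreover have "r = r' \<longleftrightarrow> (\<forall>m\<in>NEW. mark s \<theta> (Sub (EqP x m)) = mark s \<theta> (Sub (EqP y m)))"
      if "\<theta> x = Some r" "r \<in> NEW" "\<theta> y = Some r'" "r' \<in> NEW" for x y r r'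
      using that by auto
    ultimately show ?thesis
      unfolding corresponds_def rs(2) using subst_marking_mark[OF ok] PUB_NEW by auto
  qed
  moreover have "\<forall>i < ?n. mark s \<theta> (Ctl i (Ss i, ls i)) = 1" by (simp add: s)
  moreover have "set ?rs \<inter> PUB F = {}" using PUB_NEW by auto
  ultimately show ?thesis
    unfolding bisim_rel_def using G(1) M rs(1) by blast
qed

text \<open>The restricted names witnessing \<open>bisim_rel\<close> are arbitrary; renaming them to
  the new names recorded in the marking yields the canonical process.\<close>

lemma bisim_relD:
  assumes "(c, M) \<in> bisim_rel F NEW M\<^sub>s"
  obtains G s \<theta> where "c = scong_class G" "G \<in> reachable_procs F" "M = mark s \<theta>"
    "M \<in> reachable_markings N" "inv s \<theta>" "\<And>i. i < n_threads F \<Longrightarrow> settled_place F NEW (s i)"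
    "G \<cong> mark_proc s \<theta>"
proof -
  let ?n = "n_threads F"
  from assms obtain G rs Ss ls \<sigma>s \<sigma>' where c: "c = scong_class G" "G \<in> reachable_procs F"
    and M: "M \<in> reachable_markings N"
    and G: "G \<cong> res_list rs (par_list (map (\<lambda>i. subst_map (\<sigma>s i) (Ss i)) [0..<?n]))"
    and th: "\<forall>i < ?n. (is_choice (Ss i) \<or> is_call (Ss i)) \<and> derived F NEW (Ss i, ls i) \<and>
           dom (\<sigma>s i) = fn (Ss i) \<union> set (ls i) \<and> ran (\<sigma>s i) \<subseteq> set rs \<union> PUB F"
    and un': "is_union \<sigma>' ?n \<sigma>s" and corr': "corresponds F NEW (set rs) \<sigma>' (\<lambda>q. M (Sub q))"
    and ctl: "\<forall>i < ?n. M (Ctl i (Ss i, ls i)) = 1"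
    unfolding bisim_rel_def by blast
  from M obtain s \<theta> where s: "M = mark s \<theta>" "inv s \<theta>" by (rule reachable_inv)
  have si: "s i = (Ss i, ls i)" if "i < ?n" for i
  proof -
    have "mark s \<theta> (Ctl i (Ss i, ls i)) = 1" using ctl that s(1) by simp
    then show ?thesis by (simp only: mark.simps of_bool_eq_1_iff)
  qed
  \<comment> \<open>A derived call has its full argument list because bodies call identifiers with
    the right arity, so it is stable.\<close>
  have settled: "settled_place F NEW (s i)" if "i < ?n" for i
  proof -
    have "derived F NEW (Ss i, ls i)" "is_choice (Ss i) \<or> is_call (Ss i)" using th that by auto
    moreover obtain K where "fresh_ok K (Ss i) (ls i)" using derived_fresh[OF calculation(1)] by auto
    ultimately show ?thesis
      using fresh_settled unfolding si[OF that] by (cases "Ss i") (auto simp: settled_place_def)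
  qed
  have "G \<cong> nu NEW (par_list (map (\<lambda>i. subst_map \<theta> (Ss i)) [0..<?n]))"
    using G rename_to_mark[OF un', of rs \<theta> Ss] corr' th by (auto simp: s(1) intro: scong.trans)
  moreover have "subst_map \<theta> (Ss i) = place_proc \<theta> (s i)" if "i < ?n" for i
    using place_proc_settled settled[OF that] si[OF that] by simp
  then have "map (\<lambda>i. subst_map \<theta> (Ss i)) [0..<?n] = map (\<lambda>i. place_proc \<theta> (s i)) [0..<?n]" by simp
  ultimately have "G \<cong> mark_proc s \<theta>" by (simp add: mark_proc_def)
  then show thesis using that c M s settled by blast
qed

text \<open>The restricted names and substitutions of the specification are the witnesses; an
  initial body is derived from its own equation in zero steps.\<close>

lemma start_bisim: "(scong_class (fcp_proc F), init_marking N) \<in> bisim_rel F NEW M\<^sub>s"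
proof -
  let ?n = "n_threads F"
  have settled: "settled_place F NEW (init_body F i, [])" if "i < ?n" for i
  proof (cases "is_call (init_body F i)")
    case True
    then show ?thesis using fresh_settled init_fresh[OF that] by (cases "init_body F i") auto
  next
    case False
    then have "is_choice (init_body F i)" using init_facts(3)[OF that] by simp
    then show ?thesis using init_fresh[OF that]
      by (cases "init_body F i") (auto simp: settled_place_def fresh_ok_def)
  qed
  have init: "init_marking N (Ctl i q) = of_bool (i < ?n \<and> q = (init_body F i, []))"
    "init_marking N (Sub p) = M\<^sub>s p" for i q p by (simp_all add: fcp_net_def)
  have "stable_marking F (init_marking N)"
    unfolding stable_marking_def using settled by (auto simp: init settled_place_def)
  moreover have "distinct (restr F)" "set (restr F) \<inter> PUB F = {}"
    using distinct_binders(1) by (auto simp: restr_binders_def PUB_def)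
  moreover have "fcp_proc F \<in> reachable_procs F" by (simp add: reachable_procs_def)
  moreover have "init_marking N \<in> reachable_markings N" by (simp add: reachable_markings_def)
  moreover have "fcp_proc F \<cong> res_list (restr F)
      (par_list (map (\<lambda>i. subst_map (init_subst F i) (init_body F i)) [0..<?n]))"
    unfolding fcp_proc_def by (rule scong.refl)
  moreover have "\<forall>i < ?n. (is_choice (init_body F i) \<or> is_call (init_body F i)) \<and>
      derived F NEW (init_body F i, []) \<and> dom (init_subst F i) = fn (init_body F i) \<union> set [] \<and>
      ran (init_subst F i) \<subseteq> set (restr F) \<union> PUB F"
    using init_facts settled eqs_nf(2) by (simp add: settled_place_def)
  moreover have "corresponds F NEW (set (restr F)) \<sigma> (\<lambda>q. init_marking N (Sub q))"
    using corr by (simp add: init)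
  moreover have "\<forall>i < ?n. init_marking N (Ctl i (init_body F i, [])) = 1" by (simp add: init)
  ultimately show ?thesis
    unfolding bisim_rel_def mem_Collect_eq using un
    by (intro exI[of _ "fcp_proc F"] exI[of _ "init_marking N"] exI[of _ "restr F"]
        exI[of _ "init_body F"] exI[of _ "\<lambda>i. []"] exI[of _ "init_subst F"] exI[of _ \<sigma>] conjI) simp_all
qed

lemma housekeeping_proc:
  assumes "(mark s \<theta>, M') \<in> (housekeeping F NEW M\<^sub>s)\<^sup>*" "inv s \<theta>"
  shows "\<exists>s' \<theta>'. M' = mark s' \<theta>' \<and> inv s' \<theta>' \<and> mark_proc s \<theta> \<cong> mark_proc s' \<theta>'"
  using assms(1)
proof (induction rule: rtrancl_induct)
  case base
  then show ?case using assms(2) scong.refl by blast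
next
  case (step M M')
  then obtain s' \<theta>' where s': "M = mark s' \<theta>'" "inv s' \<theta>'" "mark_proc s \<theta> \<cong> mark_proc s' \<theta>'" by blast
  from s'(2) step.hyps(2)[unfolded s'(1)] show ?case
  proof (cases rule: housekeeping_cases)
    case (1 i C q' \<theta>'')
    then have "mark_proc s' \<theta>' \<cong> mark_proc (s'(i := q')) \<theta>''" using lstep_mark_proc[OF s'(2)] by blast
    then show ?thesis using 1 inv_lstep(1)[OF s'(2)] s'(3) by (blast intro: scong.trans)
  qed
qed

text \<open>Housekeeping preserves the process up to \<open>\<cong>\<close>, so it does not matter
  which settled marking witnesses membership.\<close>

lemma full_bisim_relD:
  assumes "(c, M) \<in> full_bisim_rel F NEW M\<^sub>s"
  obtains G s \<theta> where "c = scong_class G" "G \<in> reachable_procs F" "M = mark s \<theta>"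
    "M \<in> reachable_markings N" "inv s \<theta>" "G \<cong> mark_proc s \<theta>"
proof -
  from assms obtain M' where M: "M \<in> reachable_markings N"
    and hk: "(M, M') \<in> (housekeeping F NEW M\<^sub>s)\<^sup>*" and M': "(c, M') \<in> bisim_rel F NEW M\<^sub>s"
    unfolding full_bisim_rel_def by blast
  from M obtain s \<theta> where s: "M = mark s \<theta>" "inv s \<theta>" by (rule reachable_inv)
  from housekeeping_proc[OF hk[unfolded s(1)] s(2)] obtain s1 \<theta>1 where
    1: "M' = mark s1 \<theta>1" "mark_proc s \<theta> \<cong> mark_proc s1 \<theta>1" by blast
  from M' obtain G s2 \<theta>2 where 2: "c = scong_class G" "G \<in> reachable_procs F" "M' = mark s2 \<theta>2"
    "G \<cong> mark_proc s2 \<theta>2" by (rule bisim_relD)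
  have "mark_proc s1 \<theta>1 = mark_proc s2 \<theta>2" using 1(1) 2(3) mark_proc_inj by metis
  then have "G \<cong> mark_proc s \<theta>" using 1(2) 2(4) by (metis scong.sym scong.trans)
  then show thesis using that 2 s M by blast
qed

text \<open>Completing the housekeeping leads to a settled marking with the same process, where
  \<open>bisim_relI\<close> applies.\<close>

lemma full_bisim_relI:
  assumes "G \<in> reachable_procs F" "mark s \<theta> \<in> reachable_markings N" "inv s \<theta>" "G \<cong> mark_proc s \<theta>"
  shows "(scong_class G, mark s \<theta>) \<in> full_bisim_rel F NEW M\<^sub>s"
proof -
  from progress[OF assms(3)] obtain s' \<theta>' where
    *: "(mark s \<theta>, mark s' \<theta>') \<in> (housekeeping F NEW M\<^sub>s)\<^sup>*" "inv s' \<theta>'"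
    "\<forall>i < n_threads F. settled_place F NEW (s' i)" "mark_proc s \<theta> \<cong> mark_proc s' \<theta>'" by blast
  have "(mark s \<theta>, mark s' \<theta>') \<in> (net_steps N)\<^sup>*"
    using *(1) rtrancl_mono[OF housekeeping_subset] by blast
  then have "mark s' \<theta>' \<in> reachable_markings N" using assms(2) reachable_steps by blast
  moreover have "G \<cong> mark_proc s' \<theta>'" using assms(4) *(4) by (rule scong.trans)
  ultimately have "(scong_class G, mark s' \<theta>') \<in> bisim_rel F NEW M\<^sub>s"
    using assms(1) *(2,3) by (intro bisim_relI) auto
  then show ?thesis using assms(2) *(1) unfolding full_bisim_rel_def by blast
qed

lemma bisim_rel_full: "bisim_rel F NEW M\<^sub>s \<subseteq> full_bisim_rel F NEW M\<^sub>s"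
  unfolding full_bisim_rel_def bisim_rel_def by blast

lemma scong_class_eq: "scong_class P = scong_class Q \<longleftrightarrow> P \<cong> Q"
  unfolding scong_class_def by (auto intro: scong.refl scong.sym scong.trans)

lemma net_path:
  assumes "M \<in> reachable_markings N" "(M, M') \<in> (net_steps N)\<^sup>*"
  shows "(M, M') \<in> (steps (net_tsys N))\<^sup>*"
  using assms(2)
proof (induction rule: rtrancl_induct)
  case (step M' M'')
  then have "M' \<in> reachable_markings N" "M'' \<in> reachable_markings N"
    using assms(1) reachable_steps by (meson rtrancl.rtrancl_into_rtrancl)+
  then have "(M', M'') \<in> steps (net_tsys N)" using step.hyps(2) by (simp add: net_tsys_def)
  with step.IH show ?case by (rule rtrancl.rtrancl_into_rtrancl)
qed simp

text \<open>With membership reduced to \<open>G \<cong> mark_proc s \<theta>\<close>, one direction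
  is \<open>progress\<close> followed by \<open>match\<close>, and the other is the effect of a
  single net step on \<open>mark_proc\<close>.\<close>

lemma full_bisim: "weak_bisimulation (fcp_tsys F) (net_tsys N) (full_bisim_rel F NEW M\<^sub>s)"
  unfolding weak_bisimulation_def
proof (intro conjI allI impI)
  show "full_bisim_rel F NEW M\<^sub>s \<subseteq> states (fcp_tsys F) \<times> states (net_tsys N)"
    by (auto simp: fcp_tsys_def net_tsys_def elim!: full_bisim_relD)
  show "(start (fcp_tsys F), start (net_tsys N)) \<in> full_bisim_rel F NEW M\<^sub>s"
    using start_bisim bisim_rel_full by (auto simp: fcp_tsys_def net_tsys_def)
next
  fix c M c'
  assume "(c, M) \<in> full_bisim_rel F NEW M\<^sub>s" and st: "(c, c') \<in> steps (fcp_tsys F)"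
  then obtain G s \<theta> where G: "c = scong_class G" "M = mark s \<theta>" "M \<in> reachable_markings N"
    "inv s \<theta>" "G \<cong> mark_proc s \<theta>" by (elim full_bisim_relD)
  from st obtain G1 G' where G1: "c = scong_class G1" "c' = scong_class G'"
    "G' \<in> reachable_procs F" "react (eqs F) G1 G'" by (auto simp: fcp_tsys_def)
  \<comment> \<open>The net settles every thread before it answers, because a reaction can be
    located only among guarded components.\<close>
  from progress[OF G(4)] obtain s1 \<theta>1 where
    1: "(M, mark s1 \<theta>1) \<in> (housekeeping F NEW M\<^sub>s)\<^sup>*" "inv s1 \<theta>1"
    "\<And>i. i < n_threads F \<Longrightarrow> settled_place F NEW (s1 i)" "mark_proc s \<theta> \<cong> mark_proc s1 \<theta>1"
    unfolding G(2) by blast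
  have "G1 \<cong> G" using G(1) G1(1) scong_class_eq by metis
  then have "G1 \<cong> mark_proc s1 \<theta>1" using G(5) 1(4) by (blast intro: scong.trans)
  from match[OF 1(2,3) G1(4) this] obtain s2 \<theta>2 where
    2: "(mark s1 \<theta>1, mark s2 \<theta>2) \<in> (net_steps N)\<^sup>*" "inv s2 \<theta>2" "G' \<cong> mark_proc s2 \<theta>2" by blast
  have path: "(M, mark s2 \<theta>2) \<in> (net_steps N)\<^sup>*"
    using 1(1) rtrancl_mono[OF housekeeping_subset] 2(1) by (meson rtrancl_trans subsetD)
  then have "(c', mark s2 \<theta>2) \<in> full_bisim_rel F NEW M\<^sub>s"
    unfolding G1(2) using reachable_steps[OF G(3) path] 2(2,3) G1(3) by (intro full_bisim_relI)
  then show "\<exists>M'. (M, M') \<in> (steps (net_tsys N))\<^sup>* \<and> (c', M') \<in> full_bisim_rel F NEW M\<^sub>s"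
    using net_path[OF G(3) path] by blast
next
  fix c M M'
  assume "(c, M) \<in> full_bisim_rel F NEW M\<^sub>s" and st: "(M, M') \<in> steps (net_tsys N)"
  then obtain G s \<theta> where G: "c = scong_class G" "G \<in> reachable_procs F" "M = mark s \<theta>"
    "M \<in> reachable_markings N" "inv s \<theta>" "G \<cong> mark_proc s \<theta>" by (elim full_bisim_relD)
  from st have M': "(mark s \<theta>, M') \<in> net_steps N" "M' \<in> reachable_markings N"
    by (auto simp: net_tsys_def G(3))
  from net_steps_inv[OF G(5) M'(1)] obtain s' \<theta>' where s': "M' = mark s' \<theta>'" "inv s' \<theta>'"
    and "mark_proc s \<theta> \<cong> mark_proc s' \<theta>' \<or> react (eqs F) (mark_proc s \<theta>) (mark_proc s' \<theta>')" by blast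
  then consider "mark_proc s \<theta> \<cong> mark_proc s' \<theta>'" | "react (eqs F) (mark_proc s \<theta>) (mark_proc s' \<theta>')"
    by blast
  then show "\<exists>c'. (c, c') \<in> (steps (fcp_tsys F))\<^sup>* \<and> (c', M') \<in> full_bisim_rel F NEW M\<^sub>s"
  proof cases
    case 1
    then have "G \<cong> mark_proc s' \<theta>'" using G(6) by (blast intro: scong.trans)
    then have "(c, M') \<in> full_bisim_rel F NEW M\<^sub>s"
      using G(1,2) s' M'(2) full_bisim_relI by blast
    then show ?thesis by blast
  next
    case 2
    let ?G = "mark_proc s' \<theta>'"
    have r: "react (eqs F) G ?G" using G(6) 2 scong.refl by (rule react.struct)
    then have reach: "?G \<in> reachable_procs F" using G(2) by (simp add: reachable_procs_def)
    then have "(c, scong_class ?G) \<in> steps (fcp_tsys F)" using r G(1,2) by (auto simp: fcp_tsys_def)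
    moreover have "(scong_class ?G, M') \<in> full_bisim_rel F NEW M\<^sub>s"
      using reach s' M'(2) full_bisim_relI scong.refl by blast
    ultimately show ?thesis by blast
  qed
qed

text \<open>At a settled marking, membership in either relation comes down to \<open>\<cong>\<close>
  with the process of that marking.\<close>

lemma full_settled: "full_bisim_rel F NEW M\<^sub>s \<inter> {(c, M). settled_marking F NEW M} = bisim_rel F NEW M\<^sub>s"
proof (intro set_eqI iffI)
  fix cM assume "cM \<in> full_bisim_rel F NEW M\<^sub>s \<inter> {(c, M). settled_marking F NEW M}"
  then obtain c M where cM: "cM = (c, M)" "(c, M) \<in> full_bisim_rel F NEW M\<^sub>s" "settled_marking F NEW M"
    by auto
  from cM(2) obtain G s \<theta> where G: "c = scong_class G" "G \<in> reachable_procs F" "M = mark s \<theta>"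
    "M \<in> reachable_markings N" "inv s \<theta>" "G \<cong> mark_proc s \<theta>" by (rule full_bisim_relD)
  have "settled_place F NEW (s i)" if "i < n_threads F" for i
    using cM(3) that unfolding settled_marking_def G(3) by (auto split: if_splits)
  then show "cM \<in> bisim_rel F NEW M\<^sub>s" unfolding cM(1) G(1,3) using G by (intro bisim_relI) auto
next
  fix cM assume b: "cM \<in> bisim_rel F NEW M\<^sub>s"
  obtain c M where cM: "cM = (c, M)" by force
  from b[unfolded cM] have "settled_marking F NEW M"
  proof (rule bisim_relD)
    fix G s \<theta> assume "M = mark s \<theta>" and settled: "\<And>i. i < n_threads F \<Longrightarrow> settled_place F NEW (s i)"
    have "settled_place F NEW (s i) \<and> M (Ctl i (s i)) > 0" if "i < n_threads F" for i
      using settled that \<open>M = mark s \<theta>\<close> by simp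
    then show ?thesis unfolding settled_marking_def by blast
  qed
  then show "cM \<in> full_bisim_rel F NEW M\<^sub>s \<inter> {(c, M). settled_marking F NEW M}"
    using b bisim_rel_full cM by auto
qed

end

theorem theorem6p3:
  fixes F :: fcp and NEW :: "name set" and \<sigma> :: "name \<rightharpoonup> name" and M\<^sub>s :: "splace \<Rightarrow> nat"
  assumes "normal_form F"
    and "new_names F NEW"
    and "is_union \<sigma> (n_threads F) (init_subst F)"
    and "corresponds F NEW (set (restr F)) \<sigma> M\<^sub>s"
  shows "(start (fcp_tsys F), start (net_tsys (fcp_net F NEW M\<^sub>s))) \<in> bisim_rel F NEW M\<^sub>s \<and>
    weak_bisimulation (fcp_tsys F) (net_tsys (fcp_net F NEW M\<^sub>s)) (full_bisim_rel F NEW M\<^sub>s) \<and>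
    full_bisim_rel F NEW M\<^sub>s \<inter> {(c, M). settled_marking F NEW M} = bisim_rel F NEW M\<^sub>s"
proof -
  interpret fcp_start F NEW M\<^sub>s \<sigma>
    by unfold_locales (fact assms)+
  show ?thesis
    using start_bisim full_bisim full_settled by (simp add: fcp_tsys_def net_tsys_def)
qed

end
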